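(* Let $a>0$ and let $\Omega=(-a,a)^2\subset\mathbb{R}^2$. Let $f\in C_0^2(\Omega)$ (extended by zero to $\mathbb{R}^2$), let $p(x,t)$ be the solution of the Cauchy problem $$p_{tt}=\Delta_x p,\quad t\ge 0,\ x\in\mathbb{R}^2,\qquad p(x,0)=f(x),\quad p_t(x,0)=0,$$ and let $P(y,t)=p(y,t)$ for $y\in\partial\Omega$, $t\in[0,\infty)$. Then $f$ can be reconstructed from the boundary values $P$ by the following formula: for every $x\in\Omega$, $$f(x)=\frac{1}{\pi}\sum_{j=1}^{4}\int\limits_{\Phi_j}\int\limits_{|x-y|}^{\infty}\left(\frac{\partial}{\partial r}\frac{P_j^{\mathrm{repl}}(y,r)}{r}\right)\frac{n_j\cdot(x-y)}{\sqrt{r^2-|x-y|^2}}\,dr\,dl(y),$$ where the families of lines $\Phi_j$, the normals $n_j$ and the replicated data $P_j^{\mathrm{repl}}$ are as defined in the context.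
   Context: $C_0^2(\Omega)$ denotes the twice continuously differentiable functions with compact support in $\Omega$. $dl(y)$ is the standard arc length; an integral over a family of lines is the integral over the union of the lines in the family. Solution of the wave equation: $p$ is given by $p(x,t)=\frac{\partial}{\partial t}\int_0^t\frac{m(x,r)\,r\,dr}{\sqrt{t^2-r^2}}$, where $m(x,r)=\frac1{2\pi}\int_{S^1}f(x+r\omega)\,d\omega$. Sides, normals and families of lines: the four sides of the square $\Omega$ are $S_1,\dots,S_4$. Each side lies on a line $\{x_i=\sigma a\}$ for some $i\in\{1,2\}$ and $\sigma\in\{+1,-1\}$. If $S_j$ is the side lying on $\{x_i=\sigma a\}$, then $n_j=\sigma e_i$ is the exterior unit normal to $S_j$ ($e_i$ being the $i$-th standard basis vector), and $\Phi_j$ is the family of all the parallel lines $\{x_i=\sigma a+4ka\}$, $k\in\mathbb{Z}$. All the lines in $\Phi_j$ are equipped with the same normal $n_j$. Replication operator: $E^{1D}$ extends a function $h$ defined on $(-a,a)$ to a function $h^{\mathrm{repl}}=E^{1D}h$ on $\mathbb{R}$ by odd reflections: if $\xi\ne(2m+1)a$ for all $m\in\mathbb{Z}$, let $n(\xi)$ be the unique integer with $|\xi-2n(\xi)a|<a$ and set $$h^{\mathrm{repl}}(\xi)=(-1)^{n(\xi)}h\bigl((-1)^{n(\xi)}(\xi-2n(\xi)a)\bigr);$$ also $h^{\mathrm{repl}}((2m+1)a)=0$ for all $m\in\mathbb{Z}$. Replicated data: for each $t$, $P_j^{\mathrm{repl}}(\cdot,t)=E^{1D}\bigl(P(\cdot,t)|_{S_j}\bigr)$,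 where $P(\cdot,t)|_{S_j}$ is regarded as a function on $(-a,a)$ of the coordinate other than $x_i$. For $y$ on any line of $\Phi_j$, $P_j^{\mathrm{repl}}(y,t)$ denotes the value of $P_j^{\mathrm{repl}}(\cdot,t)$ at the coordinate of $y$ other than $y_i$ (so the same replicated data are placed on every line of $\Phi_j$). *)

theory Defs
  imports "HOL-Analysis.Analysis"
begin

definition square :: "real \<Rightarrow> (real^2) set" where
  "square a = {x. \<forall>i. - a < x $ i \<and> x $ i < a}"

definition C2_on :: "'a::real_normed_vector set \<Rightarrow> ('a \<Rightarrow> real) \<Rightarrow> bool" where
  "C2_on S f \<longleftrightarrow>
     (\<exists>(f' :: 'a \<Rightarrow> 'a \<Rightarrow>\<^sub>L real) (f'' :: 'a \<Rightarrow> 'a \<Rightarrow>\<^sub>L ('a \<Rightarrow>\<^sub>L real)).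
        (\<forall>x\<in>S. (f has_derivative blinfun_apply (f' x)) (at x)) \<and>
        (\<forall>x\<in>S. (f' has_derivative blinfun_apply (f'' x)) (at x)) \<and>
        continuous_on S f'')"

text \<open>
  The class \<open>C\<^sub>0\<^sup>2(S)\<close> for open \<open>S\<close>. Its members are total functions, and the condition on the
  support forces them to vanish outside \<open>S\<close>, so they are already extended by zero.
\<close>

definition C2_compact_support :: "'a::real_normed_vector set \<Rightarrow> ('a \<Rightarrow> real) \<Rightarrow> bool" where
  "C2_compact_support S f \<longleftrightarrow>
     C2_on S f \<and> compact (closure {x. f x \<noteq> 0}) \<and> closure {x. f x \<noteq> 0} \<subseteq> S"

definition circular_mean :: "(real^2 \<Rightarrow> real) \<Rightarrow> real^2 \<Rightarrow> real \<Rightarrow> real" where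
  "circular_mean f x r =
     1 / (2 * pi) * (LINT \<theta>:{0..2 * pi}|lborel. f (x + r *\<^sub>R vector [cos \<theta>, sin \<theta>]))"

text \<open>
  The solution of \<open>p\<^sub>t\<^sub>t = \<Delta> p\<close>, \<open>p(x,0) = f(x)\<close>, \<open>p\<^sub>t(x,0) = 0\<close> for \<open>t \<ge> 0\<close>, given by Poisson's formula.
  For \<open>f\<close> merely of class \<open>C\<^sup>2\<close> it need not have classical second derivatives, so the formula is
  the definition. At \<open>t = 0\<close> the time derivative is one-sided.
\<close>

definition wave_solution :: "(real^2 \<Rightarrow> real) \<Rightarrow> real^2 \<Rightarrow> real \<Rightarrow> real" where
  "wave_solution f x t =
     vector_derivative
       (\<lambda>s. LINT r:{0..s}|lborel. circular_mean f x r * r / sqrt (s\<^sup>2 - r\<^sup>2))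
       (at t within {0..})"

text \<open>
  The pair \<open>(i, \<sigma>)\<close> stands for the side of \<open>square a\<close> that lies on the line \<open>x\<^sub>i = \<sigma> a\<close>.
\<close>

type_synonym side = "2 \<times> real"

definition sides :: "side set" where
  "sides = UNIV \<times> {1, -1}"

definition other_index :: "2 \<Rightarrow> 2" where
  "other_index i = (THE k. k \<noteq> i)"

definition axis_line_point :: "2 \<Rightarrow> real \<Rightarrow> real \<Rightarrow> real^2" where
  "axis_line_point i c s = (\<chi> k. if k = i then c else s)"

definition outer_normal :: "side \<Rightarrow> real^2" where
  "outer_normal = (\<lambda>(i, \<sigma>). \<sigma> *\<^sub>R axis i 1)"

definition line_offset :: "real \<Rightarrow> side \<Rightarrow> int \<Rightarrow> real" where
  "line_offset a = (\<lambda>(i, \<sigma>) k. \<sigma> * a + 4 * of_int k * a)"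

definition line_family :: "real \<Rightarrow> side \<Rightarrow> (real^2) set set" where
  "line_family a j = range (\<lambda>k. {y. y $ fst j = line_offset a j k})"

text \<open>
  Arc length on the union of the lines in \<open>line_family a j\<close>: each of the (disjoint) lines is
  parametrized by arc length, and the lengths on the individual lines are added up.
\<close>

definition arc_length :: "real \<Rightarrow> side \<Rightarrow> (real^2) measure" where
  "arc_length a j =
     distr (count_space UNIV \<Otimes>\<^sub>M lborel) borel
       (\<lambda>(k, s). axis_line_point (fst j) (line_offset a j k) s)"

definition replicate_odd :: "real \<Rightarrow> (real \<Rightarrow> real) \<Rightarrow> real \<Rightarrow> real" where
  "replicate_odd a h \<xi> =
     (if \<exists>m::int. \<xi> = (2 * of_int m + 1) * a then 0
      else let n = (THE n::int. \<bar>\<xi> - 2 * of_int n * a\<bar> < a)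
           in (-1) powi n * h ((-1) powi n * (\<xi> - 2 * of_int n * a)))"

definition replicated_data ::
    "real \<Rightarrow> (real^2 \<Rightarrow> real \<Rightarrow> real) \<Rightarrow> side \<Rightarrow> real^2 \<Rightarrow> real \<Rightarrow> real" where
  "replicated_data a P = (\<lambda>(i, \<sigma>) y t.
     replicate_odd a (\<lambda>s. P (axis_line_point i (\<sigma> * a) s) t) (y $ other_index i))"

lemma other_index_simps [simp]: "other_index 1 = 2" "other_index 2 = 1"
proof -
  show "other_index 1 = 2"
    unfolding other_index_def by (rule the_equality) (simp, metis exhaust_2)
  show "other_index 2 = 1"
    unfolding other_index_def by (rule the_equality) (simp, metis exhaust_2)
qed

lemma measurable_axis_line_point:
  "(\<lambda>(k, s). axis_line_point (fst j) (line_offset a j k) s)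
     \<in> count_space UNIV \<Otimes>\<^sub>M lborel \<rightarrow>\<^sub>M borel"
proof (rule measurable_pair_measure_countable1)
  fix k :: int
  have "continuous_on UNIV (axis_line_point (fst j) (line_offset a j k))"
    unfolding axis_line_point_def
  proof (rule continuous_on_vec_lambda)
    show "continuous_on UNIV (\<lambda>s. if l = fst j then line_offset a j k else s)" for l
      by (cases "l = fst j") simp_all
  qed
  then show "(\<lambda>s. case (k, s) of (k, s) \<Rightarrow> axis_line_point (fst j) (line_offset a j k) s)
      \<in> lborel \<rightarrow>\<^sub>M borel"
    by (simp add: borel_measurable_continuous_onI)
qed simp

lemma emeasure_arc_length:
  assumes "A \<in> sets borel"
  shows "emeasure (arc_length a j) A =
    (\<integral>\<^sup>+k. emeasure lborel {s. axis_line_point (fst j) (line_offset a j k) s \<in> A}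
       \<partial>count_space UNIV)"
proof -
  let ?g = "\<lambda>(k, s). axis_line_point (fst j) (line_offset a j k) s"
  have "emeasure (arc_length a j) A =
      emeasure (count_space UNIV \<Otimes>\<^sub>M lborel) (?g -` A \<inter> space (count_space UNIV \<Otimes>\<^sub>M lborel))"
    unfolding arc_length_def using assms measurable_axis_line_point by (rule emeasure_distr[rotated])
  also have "\<dots> = (\<integral>\<^sup>+k. emeasure lborel (Pair k -` (?g -` A \<inter> space (count_space UNIV \<Otimes>\<^sub>M lborel)))
       \<partial>count_space UNIV)"
    by (rule lborel.emeasure_pair_measure_alt)
       (rule measurable_sets[OF measurable_axis_line_point assms])
  finally show ?thesis
    by (simp add: vimage_def space_pair_measure)
qed

end

theory Submission imports Defs begin

text \<open>
  Let \<open>u\<close> be the primitive in time of the wave \<open>p\<close>; it is \<open>t\<close> times a spherical mean of \<open>f\<close>, it is of class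
  \<open>C\<^sup>2\<close>, and it solves the wave equation. With an auxiliary third coordinate \<open>q\<close> the kernel
  \<open>1 / sqrt (r\<^sup>2 - \<rho>\<^sup>2)\<close> becomes the retarded potential \<open>1 / R\<close>, \<open>R\<^sup>2 = \<rho>\<^sup>2 + q\<^sup>2\<close>, in three dimensions. The
  flux of the corresponding Kirchhoff field through the boundary of the square does not change when the square is
  scaled about the source point \<open>z\<close>, except for a contribution at \<open>q \<rightarrow> \<infinity>\<close> that vanishes by the decay of the wave.
  Scaling to \<open>0\<close> shows that the flux of \<open>p\<close> is \<open>- 2 \<pi> f z\<close> if \<open>z\<close> lies in the square and \<open>0\<close> otherwise.

  Now sum these identities, with alternating signs, over the mirror images \<open>z\<close> of \<open>x\<close> in the sides of the square.
  The images pair up under the reflection in the line of each side: the Neumann terms cancel, and the Dirichlet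
  terms are doubled. Keeping one image of each pair and moving it back to \<open>x\<close> turns the side
  into the lines of the family, and the data into the replicated data. Truncating the images to a box of size
  \<open>K\<close> leaves a remainder of order \<open>1 / K\<close>.
\<close>

section \<open>Spherical means\<close>

text \<open>For \<open>f\<close> of class C^2 the wave itself need not have second derivatives, so
  the differential identities are proved for its primitive, which has them, and are carried over to
  the wave by differentiating the integrated identities in a time shift. Scaling about the source
  sweeps out the prism over the square by its walls alone. In scaled coordinates the powers of the
  scale cancel against the singularity of 1/R, so no integrand is ever singular, and one computation
  serves sources inside and outside the square. Only the half q \<ge> 0 of the auxiliary axis is
  used, so the walls around an interior source subtend the solid angle 2 pi; doubling the Dirichlet
  terms leaves pi, the constant of the formula. The decay at hand bounds the Neumann term of an
  image only by the inverse square of its distance to the line of the side. That is not summable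
  over the planar array of images, so Neumann terms have to cancel inside finite boxes. The
  remainder estimate is uniform in the height of the prism, which allows the height to tend to
  infinity while the box is fixed.\<close>

definition has_grad2 :: "(real \<times> real \<Rightarrow> real) \<Rightarrow> (real \<times> real \<Rightarrow> real) \<Rightarrow> (real \<times> real \<Rightarrow> real) \<Rightarrow> bool" where
  "has_grad2 F F1 F2 \<longleftrightarrow> (\<forall>p. (F has_derivative (\<lambda>d. F1 p * fst d + F2 p * snd d)) (at p))"

text \<open>Arguments are two space coordinates and time, in this order throughout. With the partial
  derivatives kept as separate scalar functions, the chain rule along a curve produces a plain real
  derivative.\<close>

definition has_grad3 :: "(real \<times> real \<times> real \<Rightarrow> real) \<Rightarrow> (real \<times> real \<times> real \<Rightarrow> real) \<Rightarrow>
    (real \<times> real \<times> real \<Rightarrow> real) \<Rightarrow> (real \<times> real \<times> real \<Rightarrow> real) \<Rightarrow> bool" where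
  "has_grad3 F F1 F2 F3 \<longleftrightarrow>
     (\<forall>p. (F has_derivative (\<lambda>d. F1 p * fst d + F2 p * fst (snd d) + F3 p * snd (snd d))) (at p))"

lemma has_grad2_chain:
  assumes "has_grad2 F F1 F2"
    and "(\<alpha> has_real_derivative \<alpha>') (at s within S)" "(\<beta> has_real_derivative \<beta>') (at s within S)"
  shows "((\<lambda>s. F (\<alpha> s, \<beta> s)) has_real_derivative (F1 (\<alpha> s, \<beta> s) * \<alpha>' + F2 (\<alpha> s, \<beta> s) * \<beta>')) (at s within S)"
proof -
  have 1: "((\<lambda>s. (\<alpha> s, \<beta> s)) has_derivative (\<lambda>h. (\<alpha>' * h, \<beta>' * h))) (at s within S)"
    using assms(2,3) by (auto intro!: has_derivative_Pair simp: has_field_derivative_def)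
  have 2: "(F has_derivative (\<lambda>d. F1 (\<alpha> s, \<beta> s) * fst d + F2 (\<alpha> s, \<beta> s) * snd d)) (at (\<alpha> s, \<beta> s))"
    using assms(1) by (auto simp: has_grad2_def)
  show ?thesis
    unfolding has_field_derivative_def
    by (rule has_derivative_eq_rhs[OF has_derivative_compose[OF 1 2]]) (auto simp: fun_eq_iff algebra_simps)
qed

lemma has_grad3_chain:
  assumes "has_grad3 F F1 F2 F3"
    and "(\<alpha> has_real_derivative \<alpha>') (at s within S)" "(\<beta> has_real_derivative \<beta>') (at s within S)"
      "(\<gamma> has_real_derivative \<gamma>') (at s within S)"
  shows "((\<lambda>s. F (\<alpha> s, \<beta> s, \<gamma> s)) has_real_derivative
      (F1 (\<alpha> s, \<beta> s, \<gamma> s) * \<alpha>' + F2 (\<alpha> s, \<beta> s, \<gamma> s) * \<beta>' + F3 (\<alpha> s, \<beta> s, \<gamma> s) * \<gamma>')) (at s within S)"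
proof -
  have 1: "((\<lambda>s. (\<alpha> s, \<beta> s, \<gamma> s)) has_derivative (\<lambda>h. (\<alpha>' * h, \<beta>' * h, \<gamma>' * h))) (at s within S)"
    using assms(2-4) by (auto intro!: has_derivative_Pair simp: has_field_derivative_def)
  let ?p = "(\<alpha> s, \<beta> s, \<gamma> s)"
  have 2: "(F has_derivative (\<lambda>d. F1 ?p * fst d + F2 ?p * fst (snd d) + F3 ?p * snd (snd d))) (at ?p)"
    using assms(1) by (auto simp: has_grad3_def)
  show ?thesis
    unfolding has_field_derivative_def
    by (rule has_derivative_eq_rhs[OF has_derivative_compose[OF 1 2]]) (auto simp: fun_eq_iff algebra_simps)
qed

lemma has_grad2_continuous: "has_grad2 F F1 F2 \<Longrightarrow> continuous_on UNIV F"
  unfolding has_grad2_def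
  by (intro continuous_at_imp_continuous_on ballI) (rule has_derivative_continuous, erule spec)

lemma has_grad3_continuous: "has_grad3 F F1 F2 F3 \<Longrightarrow> continuous_on UNIV F"
  unfolding has_grad3_def
  by (intro continuous_at_imp_continuous_on ballI) (rule has_derivative_continuous, erule spec)

text \<open>Schwarz's theorem: the increment of \<open>F\<close> in the second variable is an
  integral of \<open>F2\<close>; differentiating it in the first variable brings \<open>F21\<close>
  under the integral. This lets the locale \<open>wave\<close> work with a single mixed derivative
  \<open>f12\<close>.\<close>

lemma has_grad2_mixed_eq:
  assumes F: "has_grad2 F F1 F2" and F1: "has_grad2 F1 F11 F12" and F2: "has_grad2 F2 F21 F22"
    and c: "continuous_on UNIV F21"
  shows "F12 = F21"
proof
  fix p :: "real \<times> real"
  obtain x y where p: "p = (x, y)" by (cases p)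
  have c2: "continuous_on UNIV F2"
    using F2 by (rule has_grad2_continuous)
  \<comment> \<open>The base point \<open>y - 1\<close> puts \<open>y\<close> in the interior of the
    interval, so that the derivative within the interval is the full one.\<close>
  have ftc: "integral {y - 1..t} (\<lambda>s. F2 (z, s)) = F (z, t) - F (z, y - 1)" if "t \<ge> y - 1" for z t
  proof (rule integral_unique, rule fundamental_theorem_of_calculus)
    show "((\<lambda>s. F (z, s)) has_vector_derivative F2 (z, s)) (at s within {y - 1..t})" for s
      using has_grad2_chain[OF F, of "\<lambda>_. z" 0 s "{y - 1..t}" "\<lambda>s. s" 1]
      by (auto simp: has_real_derivative_iff_has_vector_derivative)
  qed (use that in auto)
  have L: "((\<lambda>z. integral (cbox (y - 1) t) (\<lambda>s. F2 (z, s))) has_real_derivative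
      integral (cbox (y - 1) t) (\<lambda>s. F21 (x, s))) (at x within UNIV)" for t
  proof (rule leibniz_rule_field_derivative)
    show "((\<lambda>z. F2 (z, s)) has_real_derivative F21 (z, s)) (at z within UNIV)" for z s
      using has_grad2_chain[OF F2, of "\<lambda>z. z" 1 z UNIV "\<lambda>_. s" 0] by auto
    show "(\<lambda>s. F2 (z, s)) integrable_on cbox (y - 1) t" for z
      by (intro integrable_continuous continuous_on_compose2[OF c2] continuous_intros) auto
    show "continuous_on (UNIV \<times> cbox (y - 1) t) (\<lambda>(z, s). F21 (z, s))"
      by (auto intro: continuous_on_subset[OF c])
  qed auto
  have eq: "F1 (x, t) - F1 (x, y - 1) = integral {y - 1..t} (\<lambda>s. F21 (x, s))" if "t \<ge> y - 1" for t
  proof -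
    have "((\<lambda>z. F (z, t) - F (z, y - 1)) has_real_derivative F1 (x, t) - F1 (x, y - 1)) (at x)"
      using has_grad2_chain[OF F, of "\<lambda>z. z" 1 x UNIV "\<lambda>_. t" 0]
        has_grad2_chain[OF F, of "\<lambda>z. z" 1 x UNIV "\<lambda>_. y - 1" 0]
      by (auto intro!: derivative_eq_intros)
    moreover have "((\<lambda>z. F (z, t) - F (z, y - 1)) has_real_derivative integral {y - 1..t} (\<lambda>s. F21 (x, s))) (at x)"
      using L[of t] by (simp add: ftc that)
    ultimately show ?thesis by (rule DERIV_unique)
  qed
  have "((\<lambda>t. integral {y - 1..t} (\<lambda>s. F21 (x, s))) has_real_derivative F21 (x, y)) (at y within {y - 1..y + 1})"
    by (intro integral_has_real_derivative continuous_on_compose2[OF c] continuous_intros) auto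
  then have "((\<lambda>t. F1 (x, t) - F1 (x, y - 1)) has_real_derivative F21 (x, y)) (at y within {y - 1..y + 1})"
    by (rule has_field_derivative_transform_within[where d=1]) (auto simp: eq)
  moreover have "((\<lambda>t. F1 (x, t) - F1 (x, y - 1)) has_real_derivative F12 (x, y)) (at y within {y - 1..y + 1})"
    using has_grad2_chain[OF F1, of "\<lambda>_. x" 0 y "{y - 1..y + 1}" "\<lambda>t. t" 1]
    by (auto intro!: derivative_eq_intros)
  moreover have "at y within {y - 1..y + 1} = at y"
    by (rule at_within_interior) auto
  ultimately have "F12 (x, y) = F21 (x, y)"
    by (metis DERIV_unique)
  then show "F12 p = F21 p" by (simp add: p)
qed

abbreviation quarter :: "(real \<times> real) set" where
  "quarter \<equiv> cbox (0, 0) (pi / 2, 2 * pi)"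

abbreviation (input) sx :: "real \<times> real \<Rightarrow> real" where "sx v \<equiv> sin (fst v) * cos (snd v)"
abbreviation (input) sy :: "real \<times> real \<Rightarrow> real" where "sy v \<equiv> sin (fst v) * sin (snd v)"

text \<open>Integration over the upper half sphere of radius \<open>t\<close> in spherical coordinates, of a function that depends
  only on the orthogonal projection to the plane: Hadamard's descent from three to two dimensions.\<close>

definition hmean :: "(real \<times> real \<Rightarrow> real) \<Rightarrow> (real \<times> real \<Rightarrow> real) \<Rightarrow> real \<times> real \<times> real \<Rightarrow> real" where
  "hmean w g p = integral quarter (\<lambda>v. w v * g (fst p + snd (snd p) * sx v, fst (snd p) + snd (snd p) * sy v))"

lemma continuous_on_hmean_integrand:
  fixes w g :: "real \<times> real \<Rightarrow> real"
  assumes "continuous_on UNIV w" "continuous_on UNIV g"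
  shows "continuous_on S (\<lambda>v. w v * g (x + t * sx v, y + t * sy v))"
  by (intro continuous_intros continuous_on_compose2[OF assms(1)] continuous_on_compose2[OF assms(2)]) auto

lemma hmean_integrable:
  fixes w g :: "real \<times> real \<Rightarrow> real"
  assumes "continuous_on UNIV w" "continuous_on UNIV g"
  shows "(\<lambda>v. w v * g (x + t * sx v, y + t * sy v)) integrable_on quarter"
  by (intro integrable_continuous continuous_on_hmean_integrand assms)

lemma continuous_hmean:
  assumes "continuous_on UNIV w" "continuous_on UNIV g"
  shows "continuous_on UNIV (hmean w g)"
proof -
  have "continuous_on UNIV (\<lambda>p. integral quarter
      (\<lambda>v. w v * g (fst p + snd (snd p) * sx v, fst (snd p) + snd (snd p) * sy v)))"
    by (rule integral_continuous_on_param)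
      (auto simp: split_beta intro!: continuous_intros continuous_on_compose2[OF assms(1)]
        continuous_on_compose2[OF assms(2)])
  then show ?thesis by (simp add: hmean_def[abs_def])
qed

text \<open>Differentiation under the integral. A time derivative brings down the factors
  \<open>sx\<close> and \<open>sy\<close>, which are absorbed by the weight; this is why the weight
  is a parameter of \<open>hmean\<close>.\<close>

lemma has_grad3_hmean:
  assumes w: "continuous_on UNIV w" and g: "has_grad2 g g1 g2"
    and c: "continuous_on UNIV g1" "continuous_on UNIV g2"
  shows "has_grad3 (hmean w g) (hmean w g1) (hmean w g2)
    (\<lambda>p. hmean (\<lambda>v. w v * sx v) g1 p + hmean (\<lambda>v. w v * sy v) g2 p)"
  unfolding has_grad3_def
proof
  fix p :: "real \<times> real \<times> real"
  define e1 :: "(real \<times> real \<times> real) \<Rightarrow>\<^sub>L real" where "e1 = Blinfun fst"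
  define e2 :: "(real \<times> real \<times> real) \<Rightarrow>\<^sub>L real" where "e2 = Blinfun (\<lambda>d. fst (snd d))"
  define e3 :: "(real \<times> real \<times> real) \<Rightarrow>\<^sub>L real" where "e3 = Blinfun (\<lambda>d. snd (snd d))"
  have e: "blinfun_apply e1 d = fst d" "blinfun_apply e2 d = fst (snd d)" "blinfun_apply e3 d = snd (snd d)" for d
    unfolding e1_def e2_def e3_def
    by (simp_all add: bounded_linear_Blinfun_apply bounded_linear_fst bounded_linear_snd
        bounded_linear_compose[of fst snd] bounded_linear_compose[of snd snd])
  let ?q = "\<lambda>p v. (fst p + snd (snd p) * sx v, fst (snd p) + snd (snd p) * sy v)"
  let ?a = "\<lambda>p v. w v * g1 (?q p v)"
  let ?b = "\<lambda>p v. w v * g2 (?q p v)"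
  let ?c = "\<lambda>p v. (w v * sx v) * g1 (?q p v)"
  let ?d = "\<lambda>p v. (w v * sy v) * g2 (?q p v)"
  define fx where "fx = (\<lambda>p v. ?a p v *\<^sub>R e1 + ?b p v *\<^sub>R e2 + (?c p v + ?d p v) *\<^sub>R e3)"
  have wx: "continuous_on UNIV (\<lambda>v. w v * sx v)" and wy: "continuous_on UNIV (\<lambda>v. w v * sy v)"
    by (intro continuous_intros w)+
  note ints = hmean_integrable[OF w c(1)] hmean_integrable[OF w c(2)] hmean_integrable[OF wx c(1)]
    hmean_integrable[OF wy c(2)]
  have A: "((\<lambda>p. integral quarter (\<lambda>v. w v * g (?q p v))) has_derivative integral quarter (fx p)) (at p within UNIV)"
  proof (rule leibniz_rule)
    fix p v
    have 1: "((\<lambda>p. ?q p v) has_derivative (\<lambda>d. (fst d + snd (snd d) * sx v, fst (snd d) + snd (snd d) * sy v))) (at p within UNIV)"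
      by (auto intro!: derivative_eq_intros)
    have 2: "(g has_derivative (\<lambda>d. g1 (?q p v) * fst d + g2 (?q p v) * snd d)) (at (?q p v))"
      using g by (auto simp: has_grad2_def)
    have 3: "((\<lambda>p. w v * g (?q p v)) has_derivative (\<lambda>d. w v * (g1 (?q p v) * (fst d + snd (snd d) * sx v) + g2 (?q p v) * (fst (snd d) + snd (snd d) * sy v)))) (at p within UNIV)"
      using has_derivative_mult_right[OF has_derivative_compose[OF 1 2]] by simp
    have 4: "blinfun_apply (fx p v) = (\<lambda>d. w v * (g1 (?q p v) * (fst d + snd (snd d) * sx v) + g2 (?q p v) * (fst (snd d) + snd (snd d) * sy v)))"
      by (auto simp: fx_def e blinfun.bilinear_simps algebra_simps)
    show "((\<lambda>p. w v * g (?q p v)) has_derivative blinfun_apply (fx p v)) (at p within UNIV)"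
      unfolding 4 by (rule 3)
  next
    show "(\<lambda>v. w v * g (?q p v)) integrable_on quarter" for p
      by (rule hmean_integrable[OF w has_grad2_continuous[OF g]])
    show "continuous_on (UNIV \<times> quarter) (\<lambda>(p, v). fx p v)"
      unfolding fx_def split_beta
      by (intro continuous_intros continuous_on_compose2[OF w] continuous_on_compose2[OF c(1)]
          continuous_on_compose2[OF c(2)]) auto
  qed auto
  have B: "integral quarter (fx p) = integral quarter (?a p) *\<^sub>R e1 + integral quarter (?b p) *\<^sub>R e2
      + (integral quarter (?c p) + integral quarter (?d p)) *\<^sub>R e3"
  proof (rule integral_unique)
    show "(fx p has_integral integral quarter (?a p) *\<^sub>R e1 + integral quarter (?b p) *\<^sub>R e2
      + (integral quarter (?c p) + integral quarter (?d p)) *\<^sub>R e3) quarter"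
      unfolding fx_def by (intro has_integral_add has_integral_scaleR_left integrable_integral ints)
  qed
  show "(hmean w g has_derivative (\<lambda>d. hmean w g1 p * fst d + hmean w g2 p * fst (snd d)
      + (hmean (\<lambda>v. w v * sx v) g1 p + hmean (\<lambda>v. w v * sy v) g2 p) * snd (snd d))) (at p)"
    unfolding hmean_def[abs_def]
    by (rule has_derivative_eq_rhs[OF A]) (simp add: B blinfun.bilinear_simps e fun_eq_iff)
qed

lemma has_grad3_add:
  assumes "has_grad3 F F1 F2 F3" "has_grad3 G G1 G2 G3"
  shows "has_grad3 (\<lambda>p. F p + G p) (\<lambda>p. F1 p + G1 p) (\<lambda>p. F2 p + G2 p) (\<lambda>p. F3 p + G3 p)"
  unfolding has_grad3_def
proof
  fix p
  show "((\<lambda>p. F p + G p) has_derivative (\<lambda>d. (F1 p + G1 p) * fst d + (F2 p + G2 p) * fst (snd d)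
      + (F3 p + G3 p) * snd (snd d))) (at p)"
    by (rule has_derivative_eq_rhs[OF has_derivative_add[OF assms[unfolded has_grad3_def, rule_format]]])
      (auto simp: fun_eq_iff algebra_simps)
qed

lemma has_grad3_cmult:
  assumes "has_grad3 F F1 F2 F3"
  shows "has_grad3 (\<lambda>p. c * F p) (\<lambda>p. c * F1 p) (\<lambda>p. c * F2 p) (\<lambda>p. c * F3 p)"
  unfolding has_grad3_def
proof
  fix p
  show "((\<lambda>p. c * F p) has_derivative (\<lambda>d. c * F1 p * fst d + c * F2 p * fst (snd d)
      + c * F3 p * snd (snd d))) (at p)"
    by (rule has_derivative_eq_rhs[OF has_derivative_mult_right[OF assms[unfolded has_grad3_def, rule_format]]])
      (auto simp: fun_eq_iff algebra_simps)
qed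

lemma has_grad3_time_mult:
  assumes "has_grad3 F F1 F2 F3"
  shows "has_grad3 (\<lambda>p. snd (snd p) * F p) (\<lambda>p. snd (snd p) * F1 p) (\<lambda>p. snd (snd p) * F2 p)
    (\<lambda>p. F p + snd (snd p) * F3 p)"
  unfolding has_grad3_def
proof
  fix p :: "real \<times> real \<times> real"
  have 1: "((\<lambda>p. snd (snd p)) has_derivative (\<lambda>d :: real \<times> real \<times> real. snd (snd d))) (at p)"
    by (auto intro!: derivative_eq_intros)
  show "((\<lambda>p. snd (snd p) * F p) has_derivative (\<lambda>d. snd (snd p) * F1 p * fst d + snd (snd p) * F2 p * fst (snd d)
      + (F p + snd (snd p) * F3 p) * snd (snd d))) (at p)"
    by (rule has_derivative_eq_rhs[OF has_derivative_mult[OF 1 assms[unfolded has_grad3_def, rule_format]]])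
      (auto simp: fun_eq_iff algebra_simps)
qed

section \<open>Late-time decay of spherical means\<close>

lemma half_le_sin:
  fixes x :: real
  assumes "0 \<le> x" "x \<le> pi / 2"
  shows "x / 2 \<le> sin x"
proof (cases "x \<le> pi / 3")
  case True
  \<comment> \<open>Up to \<open>pi / 3\<close> the cosine is at least 1/2, so
    \<open>sin z - z / 2\<close> increases; beyond, the sine is at least \<open>sqrt 3 / 2\<close>,
    which exceeds \<open>pi / 4\<close>.\<close>
  have "sin 0 - 0 / 2 \<le> sin x - x / 2"
  proof (rule DERIV_nonneg_imp_nondecreasing[OF assms(1)])
    fix z assume z: "0 \<le> z" "z \<le> x"
    have "cos (pi / 3) \<le> cos z"
      using z True by (intro cos_monotone_0_pi_le) auto
    then show "\<exists>y. ((\<lambda>z. sin z - z / 2) has_real_derivative y) (at z) \<and> 0 \<le> y"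
      by (intro exI[of _ "cos z - 1 / 2"]) (auto intro!: derivative_eq_intros simp: cos_60)
  qed
  then show ?thesis by simp
next
  case False
  have "sin (pi / 3) \<le> sin x"
    using False assms by (intro sin_monotone_2pi_le) auto
  moreover have "pi / 4 \<le> sqrt 3 / 2"
  proof -
    have "pi / 4 \<le> 1.7 / 2" using pi_less_4 pi_approx by simp
    moreover have "(1.7::real) \<le> sqrt 3" by (rule real_le_rsqrt) (simp add: power2_eq_square)
    ultimately show ?thesis by linarith
  qed
  ultimately show ?thesis using assms by (simp add: sin_60)
qed

text \<open>A point of the half sphere projects into the support only if
  \<open>t * sin (fst v)\<close> is at most \<open>D\<close>. This cap near the pole has width of
  order 1/t in the polar angle, and on it every sine in the weight is worth another factor
  1/t.\<close>

lemma hmean_decay: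
  fixes w g :: "real \<times> real \<Rightarrow> real"
  assumes c: "continuous_on UNIV w" "continuous_on UNIV g"
    and w: "\<And>v. v \<in> quarter \<Longrightarrow> \<bar>w v\<bar> \<le> sin (fst v) ^ k" and g: "\<And>p. \<bar>g p\<bar> \<le> B"
    and supp: "\<And>p. M < \<bar>fst p\<bar> \<or> M < \<bar>snd p\<bar> \<Longrightarrow> g p = 0"
    and L: "\<bar>x\<bar> \<le> L" "\<bar>y\<bar> \<le> L" and t: "0 < t" and M: "0 \<le> M"
  shows "\<bar>hmean w g (x, y, t)\<bar> \<le> 4 * pi * B * (2 * (M + L)) ^ (k + 1) / t ^ (k + 1)"
proof -
  define D where "D = 2 * (M + L)"
  have B: "0 \<le> B" using g[of 0] by auto
  have D: "0 \<le> D" using L M by (simp add: D_def)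
  let ?h = "\<lambda>v. w v * g (x + t * sx v, y + t * sy v)"
  define \<delta> where "\<delta> = min (pi / 2) (2 * D / t)"
  have s0: "0 \<le> sin (fst v)" "0 \<le> fst v" "fst v \<le> pi / 2" if "v \<in> quarter" for v
  proof -
    have *: "0 \<le> fst v" "fst v \<le> pi / 2" using that by (cases v, auto)+
    then show "0 \<le> sin (fst v)" "0 \<le> fst v" "fst v \<le> pi / 2" using sin_ge_zero by auto
  qed
  have small: "t * sin (fst v) \<le> D" if v: "v \<in> quarter" and nz: "?h v \<noteq> 0" for v
  proof -
    have "\<bar>x + t * sx v\<bar> \<le> M" "\<bar>y + t * sy v\<bar> \<le> M"
      using supp[of "(x + t * sx v, y + t * sy v)"] nz by (auto simp: not_less[symmetric])
    then have "\<bar>t * sx v\<bar> \<le> M + L" "\<bar>t * sy v\<bar> \<le> M + L" using L by linarith+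
    then have "(t * sx v)\<^sup>2 \<le> (M + L)\<^sup>2" "(t * sy v)\<^sup>2 \<le> (M + L)\<^sup>2"
      by (metis abs_ge_zero power2_abs power_mono)+
    moreover have "D\<^sup>2 = 4 * (M + L)\<^sup>2" by (simp only: D_def power_mult_distrib) simp
    ultimately have "(t * sx v)\<^sup>2 + (t * sy v)\<^sup>2 \<le> D\<^sup>2"
      using zero_le_power2[of "M + L"] by linarith
    moreover have "(t * sx v)\<^sup>2 + (t * sy v)\<^sup>2 = (t * sin (fst v))\<^sup>2 * ((cos (snd v))\<^sup>2 + (sin (snd v))\<^sup>2)"
      unfolding power2_eq_square by algebra
    ultimately have "(t * sin (fst v))\<^sup>2 \<le> D\<^sup>2" by simp
    then show ?thesis using D by (rule power2_le_imp_le)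
  qed
  have eq: "integral quarter ?h = integral (cbox (0, 0) (\<delta>, 2 * pi)) ?h"
  proof (rule integral_spike_set)
    have "?h v = 0" if v: "v \<in> quarter" "v \<notin> cbox (0, 0) (\<delta>, 2 * pi)" for v
    proof (rule ccontr)
      assume nz: "?h v \<noteq> 0"
      have "t * sin (fst v) \<le> D" using small[OF v(1) nz] by simp
      moreover have "t * (fst v / 2) \<le> t * sin (fst v)"
        using s0[OF v(1)] t half_le_sin[of "fst v"] by (intro mult_left_mono) auto
      ultimately have "t * (fst v / 2) \<le> D" by linarith
      then have "fst v \<le> 2 * D / t" using t by (simp add: field_simps)
      then show False using v by (cases v) (auto simp: \<delta>_def)
    qed
    then have "{v \<in> quarter - cbox (0, 0) (\<delta>, 2 * pi). ?h v \<noteq> 0} = {}" by blast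
    then show "negligible {v \<in> quarter - cbox (0, 0) (\<delta>, 2 * pi). ?h v \<noteq> 0}" by (metis negligible_empty)
    have "{v \<in> cbox (0, 0) (\<delta>, 2 * pi) - quarter. ?h v \<noteq> 0} = {}"
      by (auto simp: \<delta>_def)
    then show "negligible {v \<in> cbox (0, 0) (\<delta>, 2 * pi) - quarter. ?h v \<noteq> 0}" by (metis negligible_empty)
  qed
  have nb: "norm (integral (cbox (0, 0) (\<delta>, 2 * pi)) ?h) \<le> (B * (D / t) ^ k) * measure lborel (cbox (0::real, 0::real) (\<delta>, 2 * pi))"
  proof (rule has_integral_bound)
    show "(?h has_integral integral (cbox (0, 0) (\<delta>, 2 * pi)) ?h) (cbox (0, 0) (\<delta>, 2 * pi))"
      by (intro integrable_integral integrable_continuous continuous_on_hmean_integrand c)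
    show "0 \<le> B * (D / t) ^ k" using B D t by simp
    fix v assume v: "v \<in> cbox (0, 0) (\<delta>, 2 * pi)"
    then have v': "v \<in> quarter" by (cases v) (auto simp: \<delta>_def)
    show "norm (?h v) \<le> B * (D / t) ^ k"
    proof (cases "?h v = 0")
      case False
      have "\<bar>w v\<bar> \<le> sin (fst v) ^ k" by (rule w[OF v'])
      also have "\<dots> \<le> (D / t) ^ k"
        using small[OF v' False] t s0[OF v'] by (intro power_mono) (auto simp: field_simps)
      finally have "\<bar>w v\<bar> * \<bar>g (x + t * sx v, y + t * sy v)\<bar> \<le> (D / t) ^ k * B"
        by (intro mult_mono g) (use D t in auto)
      then show ?thesis by (simp add: abs_mult mult.commute)
    next
      case True
      have "0 \<le> B * (D / t) ^ k" using B D t by simp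
      then show ?thesis by (simp only: True norm_zero)
    qed
  qed
  have cn: "measure lborel (cbox (0::real, 0::real) (\<delta>, 2 * pi)) \<le> 2 * D / t * (2 * pi)"
  proof -
    have "0 \<le> \<delta>" using D t by (auto simp: \<delta>_def)
    then have "measure lborel (cbox (0::real, 0::real) (\<delta>, 2 * pi)) = \<delta> * (2 * pi)" by (simp add: content_Pair)
    also have "\<dots> \<le> 2 * D / t * (2 * pi)" by (intro mult_right_mono) (auto simp: \<delta>_def)
    finally show ?thesis .
  qed
  note nb[folded eq]
  also have "(B * (D / t) ^ k) * measure lborel (cbox (0::real, 0::real) (\<delta>, 2 * pi)) \<le> (B * (D / t) ^ k) * (2 * D / t * (2 * pi))"
    using B D t by (intro mult_left_mono cn) simp
  also have "\<dots> = 4 * pi * B * D ^ (k + 1) / t ^ (k + 1)"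
    by (simp add: power_divide field_simps)
  finally show ?thesis by (simp add: hmean_def D_def)
qed

text \<open>Here \<open>s\<close>, \<open>k\<close> are sine and cosine of the polar angle, and
  \<open>d\<close>, \<open>c\<close> those of the azimuth. The defect in the wave equation is
  thereby split into an exact derivative in each angle; their sum is the sine of the polar angle
  times the Laplace-Beltrami operator of the sphere, up to a power of \<open>t\<close>.\<close>

lemma darboux_identity:
  fixes s k c d t :: real
  assumes "k\<^sup>2 = 1 - s\<^sup>2" "c\<^sup>2 = 1 - d\<^sup>2"
  shows "t * (s * A + s * B) - ((s * (s * c) * P + s * (s * d) * Q) + ((s * (s * c) * P + s * (s * d) * Q) +
      t * ((s * (s * c) * (s * c) * A + s * (s * c) * (s * d) * C) + (s * (s * d) * (s * c) * C + s * (s * d) * (s * d) * B))))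
    = ((k\<^sup>2 - s\<^sup>2) * (P * c + Q * d) + t * (s * k\<^sup>2) * (A * c\<^sup>2 + 2 * (C * (c * d)) + B * d\<^sup>2))
      + (- (P * c + Q * d) + t * s * (A * d\<^sup>2 - 2 * (C * (c * d)) + B * c\<^sup>2))"
  using assms by algebra

section \<open>The primitive of the wave and its derivatives\<close>

locale wave =
  fixes f f1 f2 f11 f12 f22 :: "real \<times> real \<Rightarrow> real" and M :: real
  assumes gf: "has_grad2 f f1 f2" and gf1: "has_grad2 f1 f11 f12" and gf2: "has_grad2 f2 f12 f22"
    and cf11: "continuous_on UNIV f11" and cf12: "continuous_on UNIV f12" and cf22: "continuous_on UNIV f22"
    and M: "0 \<le> M"
    and supp: "\<And>p. M < \<bar>fst p\<bar> \<or> M < \<bar>snd p\<bar> \<Longrightarrow>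
      f p = 0 \<and> f1 p = 0 \<and> f2 p = 0 \<and> f11 p = 0 \<and> f12 p = 0 \<and> f22 p = 0"
begin

lemmas cf = has_grad2_continuous[OF gf] and cf1 = has_grad2_continuous[OF gf1] and cf2 = has_grad2_continuous[OF gf2]

abbreviation (input) w0 :: "real \<times> real \<Rightarrow> real" where "w0 \<equiv> \<lambda>v. sin (fst v)"
abbreviation (input) wx :: "real \<times> real \<Rightarrow> real" where "wx \<equiv> \<lambda>v. sin (fst v) * sx v"
abbreviation (input) wy :: "real \<times> real \<Rightarrow> real" where "wy \<equiv> \<lambda>v. sin (fst v) * sy v"

text \<open>The unit half sphere has area \<open>2 * pi\<close>, which explains the normalisation.
  The lower half would contribute the same, as it has the same projection to the plane.\<close>

definition u :: "real \<times> real \<times> real \<Rightarrow> real" where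
  "u p = 1 / (2 * pi) * (snd (snd p) * hmean w0 f p)"
definition u1 where "u1 p = 1 / (2 * pi) * (snd (snd p) * hmean w0 f1 p)"
definition u2 where "u2 p = 1 / (2 * pi) * (snd (snd p) * hmean w0 f2 p)"
definition u11 where "u11 p = 1 / (2 * pi) * (snd (snd p) * hmean w0 f11 p)"
definition u12 where "u12 p = 1 / (2 * pi) * (snd (snd p) * hmean w0 f12 p)"
definition u22 where "u22 p = 1 / (2 * pi) * (snd (snd p) * hmean w0 f22 p)"
definition ut where
  "ut p = 1 / (2 * pi) * (hmean w0 f p + snd (snd p) * (hmean wx f1 p + hmean wy f2 p))"
definition ut1 where
  "ut1 p = 1 / (2 * pi) * (hmean w0 f1 p + snd (snd p) * (hmean wx f11 p + hmean wy f12 p))"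
definition ut2 where
  "ut2 p = 1 / (2 * pi) * (hmean w0 f2 p + snd (snd p) * (hmean wx f12 p + hmean wy f22 p))"
definition utt where
  "utt p = 1 / (2 * pi) * ((hmean wx f1 p + hmean wy f2 p) + ((hmean wx f1 p + hmean wy f2 p) + snd (snd p) *
     ((hmean (\<lambda>v. wx v * sx v) f11 p + hmean (\<lambda>v. wx v * sy v) f12 p)
    + (hmean (\<lambda>v. wy v * sx v) f12 p + hmean (\<lambda>v. wy v * sy v) f22 p))))"

lemma cw: "continuous_on UNIV w0" "continuous_on UNIV wx" "continuous_on UNIV wy"
  "continuous_on UNIV (\<lambda>v. wx v * sx v)" "continuous_on UNIV (\<lambda>v. wx v * sy v)"
  "continuous_on UNIV (\<lambda>v. wy v * sx v)" "continuous_on UNIV (\<lambda>v. wy v * sy v)"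
  by (intro continuous_intros)+

lemma grad_u: "has_grad3 u u1 u2 ut"
  unfolding u_def[abs_def] u1_def[abs_def] u2_def[abs_def] ut_def[abs_def]
  by (intro has_grad3_cmult has_grad3_time_mult has_grad3_hmean cw gf cf1 cf2)

lemma grad_u1: "has_grad3 u1 u11 u12 ut1"
  unfolding u1_def[abs_def] u11_def[abs_def] u12_def[abs_def] ut1_def[abs_def]
  by (intro has_grad3_cmult has_grad3_time_mult has_grad3_hmean cw gf1 cf11 cf12)

lemma grad_u2: "has_grad3 u2 u12 u22 ut2"
  unfolding u2_def[abs_def] u12_def[abs_def] u22_def[abs_def] ut2_def[abs_def]
  by (intro has_grad3_cmult has_grad3_time_mult has_grad3_hmean cw gf2 cf22 cf12)

lemma grad_ut: "has_grad3 ut ut1 ut2 utt"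
  unfolding ut_def[abs_def] ut1_def[abs_def] ut2_def[abs_def] utt_def[abs_def]
  by (intro has_grad3_cmult has_grad3_add has_grad3_time_mult has_grad3_hmean cw gf gf1 gf2 cf1 cf2 cf11 cf22 cf12)

lemma continuous_u: "continuous_on UNIV u11" "continuous_on UNIV u12" "continuous_on UNIV u22"
  "continuous_on UNIV ut1" "continuous_on UNIV ut2" "continuous_on UNIV utt"
  unfolding u11_def[abs_def] u12_def[abs_def] u22_def[abs_def] ut1_def[abs_def] ut2_def[abs_def] utt_def[abs_def]
  by (intro continuous_intros continuous_hmean cw cf cf1 cf2 cf11 cf12 cf22)+

lemma ut_initial: "ut (x, y, 0) = f (x, y)"
proof -
  have "integral quarter (\<lambda>v. sin (fst v) * f (x, y)) = integral quarter (\<lambda>v. sin (fst v)) * f (x, y)"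
    by simp
  also have "integral quarter (\<lambda>v. sin (fst v)) = integral (cbox 0 (pi / 2)) (\<lambda>\<phi>. integral (cbox 0 (2 * pi)) (\<lambda>\<theta>. sin \<phi>))"
    by (subst integral_prod_continuous) (auto intro!: continuous_intros)
  also have "\<dots> = 2 * pi * integral {0..pi / 2} sin" by simp
  also have "integral {0..pi / 2} sin = - cos (pi / 2) - - cos 0"
    by (rule integral_unique, rule fundamental_theorem_of_calculus)
      (auto intro!: derivative_eq_intros simp: has_real_derivative_iff_has_vector_derivative[symmetric])
  finally show ?thesis by (simp add: ut_def hmean_def del: integral_mult_left)
qed

text \<open>Darboux's equation for spherical means: the defect integrates to zero because it is a
  sum of exact angular derivatives without boundary terms.\<close>

lemma wave_equation: "utt p = u11 p + u22 p"
proof -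
  obtain x y t where p: "p = (x, y, t)" by (cases p) auto
  let ?q = "\<lambda>v. (x + t * sx v, y + t * sy v)"
  define I1 where "I1 = (\<lambda>v. ((cos (fst v))\<^sup>2 - (sin (fst v))\<^sup>2) * (f1 (?q v) * cos (snd v) + f2 (?q v) * sin (snd v))
     + t * (sin (fst v) * (cos (fst v))\<^sup>2) * (f11 (?q v) * (cos (snd v))\<^sup>2 + 2 * (f12 (?q v) * (cos (snd v) * sin (snd v)))
       + f22 (?q v) * (sin (snd v))\<^sup>2))"
  define I2 where "I2 = (\<lambda>v. - (f1 (?q v) * cos (snd v) + f2 (?q v) * sin (snd v))
     + t * sin (fst v) * (f11 (?q v) * (sin (snd v))\<^sup>2 - 2 * (f12 (?q v) * (cos (snd v) * sin (snd v)))
       + f22 (?q v) * (cos (snd v))\<^sup>2))"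
  have cq: "continuous_on S (\<lambda>v. h (?q v))" if "continuous_on UNIV h" for h :: "real \<times> real \<Rightarrow> real" and S
    by (rule continuous_on_compose2[OF that]) (auto intro!: continuous_intros)
  have c1: "continuous_on S I1" and c2: "continuous_on S I2" for S
    unfolding I1_def I2_def by (intro continuous_intros cq cf1 cf2 cf11 cf12 cf22)+
  note chain = has_grad2_chain[of _ _ _ "\<lambda>\<phi>. x + t * (sin \<phi> * cos \<theta>)" "t * (cos \<phi> * cos \<theta>)" \<phi> UNIV
      "\<lambda>\<phi>. y + t * (sin \<phi> * sin \<theta>)" "t * (cos \<phi> * sin \<theta>)" for \<phi> \<theta>]
  note chain' = has_grad2_chain[of _ _ _ "\<lambda>\<theta>. x + t * (sin \<phi> * cos \<theta>)" "t * (sin \<phi> * - sin \<theta>)" \<theta> UNIV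
      "\<lambda>\<theta>. y + t * (sin \<phi> * sin \<theta>)" "t * (sin \<phi> * cos \<theta>)" for \<phi> \<theta>]
  have J1: "integral (cbox 0 (pi / 2)) (\<lambda>\<phi>. I1 (\<phi>, \<theta>)) = 0" for \<theta>
  proof -
    \<comment> \<open>The factor \<open>sin \<phi> * cos \<phi>\<close> vanishes at the pole and at
      the equator, so both boundary terms disappear.\<close>
    let ?G = "\<lambda>\<phi>. sin \<phi> * cos \<phi> * (f1 (?q (\<phi>, \<theta>)) * cos \<theta> + f2 (?q (\<phi>, \<theta>)) * sin \<theta>)"
    have "((\<lambda>\<phi>. I1 (\<phi>, \<theta>)) has_integral ?G (pi / 2) - ?G 0) {0..pi / 2}"
    proof (rule fundamental_theorem_of_calculus)
      fix \<phi>
      have d: "((\<lambda>\<phi>. x + t * (sin \<phi> * cos \<theta>)) has_real_derivative t * (cos \<phi> * cos \<theta>)) (at \<phi>)"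
        "((\<lambda>\<phi>. y + t * (sin \<phi> * sin \<theta>)) has_real_derivative t * (cos \<phi> * sin \<theta>)) (at \<phi>)"
        by (auto intro!: derivative_eq_intros)
      have "(?G has_real_derivative I1 (\<phi>, \<theta>)) (at \<phi>)"
        by (rule derivative_eq_intros chain[OF gf1 d] chain[OF gf2 d] refl | simp)+
          (simp add: I1_def power2_eq_square algebra_simps)
      then show "(?G has_vector_derivative I1 (\<phi>, \<theta>)) (at \<phi> within {0..pi / 2})"
        by (simp add: has_real_derivative_iff_has_vector_derivative has_vector_derivative_at_within)
    qed simp
    then show ?thesis by (auto intro!: integral_unique)
  qed
  have J2: "integral (cbox 0 (2 * pi)) (\<lambda>\<theta>. I2 (\<phi>, \<theta>)) = 0" for \<phi>
  proof -
    \<comment> \<open>Up to the factor \<open>t * sin \<phi>\<close> this is the derivative of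
      \<open>f\<close> along a circle of latitude; the boundary terms cancel by periodicity.\<close>
    let ?G = "\<lambda>\<theta>. f2 (?q (\<phi>, \<theta>)) * cos \<theta> - f1 (?q (\<phi>, \<theta>)) * sin \<theta>"
    have "((\<lambda>\<theta>. I2 (\<phi>, \<theta>)) has_integral ?G (2 * pi) - ?G 0) {0..2 * pi}"
    proof (rule fundamental_theorem_of_calculus)
      fix \<theta>
      have d: "((\<lambda>\<theta>. x + t * (sin \<phi> * cos \<theta>)) has_real_derivative t * (sin \<phi> * - sin \<theta>)) (at \<theta>)"
        "((\<lambda>\<theta>. y + t * (sin \<phi> * sin \<theta>)) has_real_derivative t * (sin \<phi> * cos \<theta>)) (at \<theta>)"
        by (auto intro!: derivative_eq_intros)
      have "(?G has_real_derivative I2 (\<phi>, \<theta>)) (at \<theta>)"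
        by (rule derivative_eq_intros chain'[OF gf1 d] chain'[OF gf2 d] refl | simp)+
          (simp add: I2_def power2_eq_square algebra_simps)
      then show "(?G has_vector_derivative I2 (\<phi>, \<theta>)) (at \<theta> within {0..2 * pi})"
        by (simp add: has_real_derivative_iff_has_vector_derivative has_vector_derivative_at_within)
    qed simp
    then show ?thesis by (auto intro!: integral_unique)
  qed
  have "integral quarter I1 = integral (cbox 0 (pi / 2)) (\<lambda>\<phi>. integral (cbox 0 (2 * pi)) (\<lambda>\<theta>. I1 (\<phi>, \<theta>)))"
    by (rule integral_prod_continuous[OF c1])
  also have "\<dots> = integral (cbox 0 (2 * pi)) (\<lambda>\<theta>. integral (cbox 0 (pi / 2)) (\<lambda>\<phi>. I1 (\<phi>, \<theta>)))"
    by (rule integral_swap_continuous) (use c1 in \<open>simp add: case_prod_unfold\<close>)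
  finally have K1: "integral quarter I1 = 0" by (simp only: J1 integral_0)
  have K2: "integral quarter I2 = 0"
    by (rule trans[OF integral_prod_continuous[OF c2]]) (simp only: J2 integral_0)
  let ?L = "\<lambda>v. t * (w0 v * f11 (?q v) + w0 v * f22 (?q v)) - ((wx v * f1 (?q v) + wy v * f2 (?q v)) +
        ((wx v * f1 (?q v) + wy v * f2 (?q v)) + t * ((wx v * sx v * f11 (?q v) + wx v * sy v * f12 (?q v))
          + (wy v * sx v * f12 (?q v) + wy v * sy v * f22 (?q v)))))"
  let ?R = "(hmean wx f1 p + hmean wy f2 p) + ((hmean wx f1 p + hmean wy f2 p) + t *
     ((hmean (\<lambda>v. wx v * sx v) f11 p + hmean (\<lambda>v. wx v * sy v) f12 p)
    + (hmean (\<lambda>v. wy v * sx v) f12 p + hmean (\<lambda>v. wy v * sy v) f22 p)))"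
  have i: "((\<lambda>v. w v * g (?q v)) has_integral hmean w g p) quarter"
    if "continuous_on UNIV w" "continuous_on UNIV g" for w g
    using integrable_integral[OF hmean_integrable[OF that, of x t y]] by (simp add: hmean_def p)
  have "(?L has_integral t * (hmean w0 f11 p + hmean w0 f22 p) - ?R) quarter"
    by (intro has_integral_add has_integral_diff has_integral_mult_right i cw cf1 cf2 cf11 cf12 cf22)
  moreover have "?L v = I1 v + I2 v" for v :: "real \<times> real"
    unfolding I1_def I2_def by (rule darboux_identity) (rule cos_squared_eq)+
  ultimately have "((\<lambda>v. I1 v + I2 v) has_integral t * (hmean w0 f11 p + hmean w0 f22 p) - ?R) quarter"
    by (rule has_integral_eq[rotated])
  moreover have "((\<lambda>v. I1 v + I2 v) has_integral integral quarter I1 + integral quarter I2) quarter"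
    by (intro has_integral_add integrable_integral integrable_continuous c1 c2)
  ultimately have "t * (hmean w0 f11 p + hmean w0 f22 p) - ?R = integral quarter I1 + integral quarter I2"
    by (rule has_integral_unique)
  then have R: "?R = t * (hmean w0 f11 p + hmean w0 f22 p)"
    by (simp only: K1 K2)
  have "snd (snd p) = t" by (simp add: p)
  then have "utt p = 1 / (2 * pi) * ?R" by (simp only: utt_def)
  also have "\<dots> = u11 p + u22 p"
    unfolding R u11_def u22_def by (simp only: p fst_conv snd_conv distrib_left)
  finally show ?thesis .
qed

end

section \<open>Kirchhoff fluxes through the faces of the square\<close>

text \<open>Exchanging the coordinates turns the faces perpendicular to the second axis into faces
  perpendicular to the first, so only the latter have to be computed with.\<close>

definition swap3 :: "(real \<times> real \<times> real \<Rightarrow> real) \<Rightarrow> real \<times> real \<times> real \<Rightarrow> real" where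
  "swap3 F p = F (fst (snd p), fst p, snd (snd p))"

text \<open>A time shift keeps the wave equation, and the derivative in the shift is the time
  derivative. It carries the flux identity from a C^2 solution over to its time derivative.\<close>

definition shift3 :: "real \<Rightarrow> (real \<times> real \<times> real \<Rightarrow> real) \<Rightarrow> real \<times> real \<times> real \<Rightarrow> real" where
  "shift3 h F p = F (fst p, fst (snd p), snd (snd p) + h)"

lemma has_grad3_swap3:
  assumes "has_grad3 F F1 F2 F3"
  shows "has_grad3 (swap3 F) (swap3 F2) (swap3 F1) (swap3 F3)"
  unfolding has_grad3_def
proof
  fix p :: "real \<times> real \<times> real"
  let ?q = "(fst (snd p), fst p, snd (snd p))"
  have 1: "((\<lambda>p. (fst (snd p), fst p, snd (snd p))) has_derivative
      (\<lambda>d :: real \<times> real \<times> real. (fst (snd d), fst d, snd (snd d)))) (at p)"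
    by (auto intro!: derivative_eq_intros)
  have 2: "(F has_derivative (\<lambda>d. F1 ?q * fst d + F2 ?q * fst (snd d) + F3 ?q * snd (snd d))) (at ?q)"
    using assms by (simp only: has_grad3_def)
  show "(swap3 F has_derivative (\<lambda>d. swap3 F2 p * fst d + swap3 F1 p * fst (snd d)
      + swap3 F3 p * snd (snd d))) (at p)"
    unfolding swap3_def[abs_def]
    by (rule has_derivative_eq_rhs[OF has_derivative_compose[OF 1 2]]) (simp add: fun_eq_iff)
qed

lemma has_grad3_shift3:
  assumes "has_grad3 F F1 F2 F3"
  shows "has_grad3 (shift3 h F) (shift3 h F1) (shift3 h F2) (shift3 h F3)"
  unfolding has_grad3_def
proof
  fix p :: "real \<times> real \<times> real"
  let ?q = "(fst p, fst (snd p), snd (snd p) + h)"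
  have 1: "((\<lambda>p. (fst p, fst (snd p), snd (snd p) + h)) has_derivative
      (\<lambda>d :: real \<times> real \<times> real. (fst d, fst (snd d), snd (snd d)))) (at p)"
    by (auto intro!: derivative_eq_intros)
  have 2: "(F has_derivative (\<lambda>d. F1 ?q * fst d + F2 ?q * fst (snd d) + F3 ?q * snd (snd d))) (at ?q)"
    using assms by (simp only: has_grad3_def)
  show "(shift3 h F has_derivative (\<lambda>d. shift3 h F1 p * fst d + shift3 h F2 p * fst (snd d)
      + shift3 h F3 p * snd (snd d))) (at p)"
    unfolding shift3_def[abs_def]
    by (rule has_derivative_eq_rhs[OF has_derivative_compose[OF 1 2]]) (simp add: fun_eq_iff)
qed

lemma continuous_swap3: "continuous_on UNIV F \<Longrightarrow> continuous_on UNIV (swap3 F)"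
  unfolding swap3_def[abs_def] by (rule continuous_on_compose2[of UNIV F]) (auto intro!: continuous_intros)

lemma continuous_shift3: "continuous_on UNIV F \<Longrightarrow> continuous_on UNIV (shift3 h F)"
  unfolding shift3_def[abs_def] by (rule continuous_on_compose2[of UNIV F]) (auto intro!: continuous_intros)

text \<open>Distance from \<open>(\<xi>, \<eta>, 0)\<close> to \<open>(\<xi> + b, c, q)\<close>. The third coordinate \<open>q\<close> is an auxiliary one, on which
  the wave does not depend: it turns the kernel \<open>1 / sqrt (r\<^sup>2 - \<rho>\<^sup>2)\<close> into the distance in three
  dimensions via \<open>r\<^sup>2 = \<rho>\<^sup>2 + q\<^sup>2\<close>.\<close>

definition rad :: "real \<Rightarrow> real \<Rightarrow> real \<times> real \<Rightarrow> real" where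
  "rad b \<eta> v = sqrt (b\<^sup>2 + (fst v - \<eta>)\<^sup>2 + (snd v)\<^sup>2)"

abbreviation (input) pos3 :: "real \<Rightarrow> real \<Rightarrow> real \<Rightarrow> real \<Rightarrow> real \<times> real \<Rightarrow> real \<times> real \<times> real" where
  "pos3 b \<xi> \<eta> s v \<equiv> (\<xi> + s * b, \<eta> + s * (fst v - \<eta>), s * rad b \<eta> v)"

text \<open>Flux of the Kirchhoff vector field through a face of the square, scaled by \<open>s\<close> about the
  source point \<open>(\<xi>, \<eta>)\<close>.\<close>

definition face where
  "face a Q b \<xi> \<eta> F G H s = integral (cbox (- a, 0) (a, Q))
     (\<lambda>v. s * F (pos3 b \<xi> \<eta> s v) * b / rad b \<eta> v ^ 2 - G (pos3 b \<xi> \<eta> s v) * b / rad b \<eta> v ^ 3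
        - s * H (pos3 b \<xi> \<eta> s v) / rad b \<eta> v)"

lemma rad_pos: "b \<noteq> 0 \<Longrightarrow> 0 < rad b \<eta> v"
  unfolding rad_def by (intro real_sqrt_gt_zero add_pos_nonneg) auto

lemma rad_sq: "(rad b \<eta> v)\<^sup>2 = b\<^sup>2 + (fst v - \<eta>)\<^sup>2 + (snd v)\<^sup>2"
  unfolding rad_def by (rule real_sqrt_pow2) (intro add_nonneg_nonneg, auto)

lemma continuous_on_rad [continuous_intros]:
  "continuous_on S f \<Longrightarrow> continuous_on S (\<lambda>x. rad b \<eta> (f x))"
  unfolding rad_def by (intro continuous_intros)

lemma rad_deriv_fst:
  assumes "b \<noteq> 0"
  shows "((\<lambda>c. rad b \<eta> (c, q)) has_real_derivative (c - \<eta>) / rad b \<eta> (c, q)) (at c within S)"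
proof -
  have "0 < b\<^sup>2 + (c - \<eta>)\<^sup>2 + q\<^sup>2" using assms by (intro add_pos_nonneg) auto
  then show ?thesis
    unfolding rad_def fst_conv snd_conv by (auto intro!: derivative_eq_intros simp: field_simps)
qed

lemma rad_deriv_snd:
  assumes "b \<noteq> 0"
  shows "((\<lambda>q. rad b \<eta> (c, q)) has_real_derivative q / rad b \<eta> (c, q)) (at q within S)"
proof -
  have "0 < b\<^sup>2 + (c - \<eta>)\<^sup>2 + q\<^sup>2" using assms by (intro add_pos_nonneg) auto
  then show ?thesis
    unfolding rad_def fst_conv snd_conv by (auto intro!: derivative_eq_intros simp: field_simps)
qed

text \<open>The Kirchhoff field is divergence free exactly because of the wave equation. Pulled back
  to a face, with \<open>z\<close> for the distance along the face from the foot of the source, this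
  says that the derivative of the flux density in the scale is a sum of a derivative along the face
  and a derivative in \<open>q\<close>.\<close>

lemma kirchhoff_divergence_identity:
  fixes R :: real
  assumes R: "R \<noteq> 0" "R\<^sup>2 = b\<^sup>2 + z\<^sup>2 + q\<^sup>2" and w: "utt = u11 + u22"
  shows "(ut * b / R\<^sup>2 + s * (ut1 * b + ut2 * z + utt * R) * b / R\<^sup>2) - (u1 * b + u2 * z + ut * R) * b / R ^ 3
      - (u1 / R + s * (u11 * b + u12 * z + ut1 * R) / R)
    = (- (u1 + z * (u12 * s + ut1 * (s * (z / R))) - b * (u22 * s + ut2 * (s * (z / R)))) / R
        + (z * u1 - b * u2) * (z / R) / R\<^sup>2)
      + (- (u1 + q * (ut1 * (s * (q / R)))) / R + q * u1 * (q / R) / R\<^sup>2)"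
proof -
  \<comment> \<open>With \<open>k * R = 1\<close> in place of the quotients the identity becomes
    polynomial modulo the relations.\<close>
  define k where "k = 1 / R"
  have k: "k * R = 1" using R by (simp add: k_def)
  have "(ut * b * k\<^sup>2 + s * (ut1 * b + ut2 * z + utt * R) * b * k\<^sup>2) - (u1 * b + u2 * z + ut * R) * b * k ^ 3
      - (u1 * k + s * (u11 * b + u12 * z + ut1 * R) * k)
    = (- (u1 + z * (u12 * s + ut1 * (s * (z * k))) - b * (u22 * s + ut2 * (s * (z * k)))) * k
        + (z * u1 - b * u2) * (z * k) * k\<^sup>2)
      + (- (u1 + q * (ut1 * (s * (q * k)))) * k + q * u1 * (q * k) * k\<^sup>2)"
    using R(2) k w by algebra
  then show ?thesis by (simp add: k_def divide_inverse power_inverse)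
qed

lemma face_integrand_derivs:
  fixes r b :: real
  assumes r: "r \<noteq> 0" and F: "(F has_real_derivative F') (at s within T)" and G: "(G has_real_derivative G') (at s within T)"
    and H: "(H has_real_derivative H') (at s within T)"
  shows "((\<lambda>s. s * F s * b / r ^ 2 - G s * b / r ^ 3 - s * H s / r) has_real_derivative
    (F s * b / r ^ 2 + s * F' * b / r ^ 2) - G' * b / r ^ 3 - (H s / r + s * H' / r)) (at s within T)"
proof -
  have "((\<lambda>s. s * F s * (b / r ^ 2) - G s * (b / r ^ 3) - s * H s * (1 / r)) has_real_derivative
    ((1 * F s + F' * s) * (b / r ^ 2) - G' * (b / r ^ 3) - (1 * H s + H' * s) * (1 / r))) (at s within T)"
    by (intro DERIV_diff DERIV_cmult_right DERIV_mult DERIV_ident F G H)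
  then show ?thesis by (simp add: algebra_simps add_divide_distrib)
qed

lemma edge_integrand_derivs:
  fixes b \<eta> :: real
  assumes r: "r c \<noteq> 0" and F: "(F has_real_derivative F') (at c within T)" and G: "(G has_real_derivative G') (at c within T)"
    and R: "(r has_real_derivative r') (at c within T)"
  shows "((\<lambda>c. - ((c - \<eta>) * F c - b * G c) / r c) has_real_derivative
    - (F c + (c - \<eta>) * F' - b * G') / r c + ((c - \<eta>) * F c - b * G c) * r' / (r c)\<^sup>2) (at c within T)"
proof -
  have "((\<lambda>c. - ((c - \<eta>) * F c - b * G c) / r c) has_real_derivative
    ((- (((1 - 0) * F c + F' * (c - \<eta>)) - b * G')) * r c - (- ((c - \<eta>) * F c - b * G c)) * r') / (r c * r c)) (at c within T)"
    by (intro DERIV_divide DERIV_minus DERIV_diff DERIV_mult DERIV_cmult DERIV_ident DERIV_const F G R r)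
  moreover have gen: "(- P * r c - - Y * w) / (r c * r c) = - P / r c + Y * w / (r c)\<^sup>2" for P Y w
    using r by (simp add: field_simps power2_eq_square)
  have "((- (((1 - 0) * F c + F' * (c - \<eta>)) - b * G')) * r c - (- ((c - \<eta>) * F c - b * G c)) * r') / (r c * r c)
     = - (F c + (c - \<eta>) * F' - b * G') / r c + ((c - \<eta>) * F c - b * G c) * r' / (r c)\<^sup>2"
    using gen[of "F c + (c - \<eta>) * F' - b * G'" "(c - \<eta>) * F c - b * G c" r'] by (simp add: mult.commute)
  ultimately show ?thesis by simp
qed
text \<open>By the divergence identity only edge terms survive: the two vertical edges and the top.
  The bottom edge is silent since its term carries the factor \<open>q = 0\<close>.\<close>

lemma face_has_derivative:
  fixes a Q b \<xi> \<eta> :: real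
  assumes U: "has_grad3 U U1 U2 Ut" and U1: "has_grad3 U1 U11 U12 Ut1" and U2: "has_grad3 U2 U12 U22 Ut2"
    and Ut: "has_grad3 Ut Ut1 Ut2 Utt"
    and c: "continuous_on UNIV U11" "continuous_on UNIV U12" "continuous_on UNIV U22"
      "continuous_on UNIV Ut1" "continuous_on UNIV Ut2" "continuous_on UNIV Utt"
    and wave: "\<And>p. Utt p = U11 p + U22 p"
    and b: "b \<noteq> 0" and a: "0 \<le> a" and Q: "0 \<le> Q"
  defines "A \<equiv> \<lambda>s v. - ((fst v - \<eta>) * U1 (pos3 b \<xi> \<eta> s v) - b * U2 (pos3 b \<xi> \<eta> s v)) / rad b \<eta> v"
  shows "(face a Q b \<xi> \<eta> Ut U U1 has_real_derivative
     (integral {0..Q} (\<lambda>q. A s (a, q)) - integral {0..Q} (\<lambda>q. A s (- a, q)))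
     - integral {- a..a} (\<lambda>c. Q * U1 (pos3 b \<xi> \<eta> s (c, Q)) / rad b \<eta> (c, Q))) (at s)"
proof -
  let ?R = "rad b \<eta>" and ?X = "pos3 b \<xi> \<eta>" and ?box = "cbox (- a, 0) (a, Q)"
  let ?E = "\<lambda>s v. s * Ut (?X s v) * b / ?R v ^ 2 - U (?X s v) * b / ?R v ^ 3 - s * U1 (?X s v) / ?R v"
  define dE where "dE = (\<lambda>s v. (Ut (?X s v) * b / ?R v ^ 2 + s * (Ut1 (?X s v) * b + Ut2 (?X s v) * (fst v - \<eta>) + Utt (?X s v) * ?R v) * b / ?R v ^ 2)
     - (U1 (?X s v) * b + U2 (?X s v) * (fst v - \<eta>) + Ut (?X s v) * ?R v) * b / ?R v ^ 3
     - (U1 (?X s v) / ?R v + s * (U11 (?X s v) * b + U12 (?X s v) * (fst v - \<eta>) + Ut1 (?X s v) * ?R v) / ?R v))"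
  define dA where "dA = (\<lambda>s v. - (U1 (?X s v) + (fst v - \<eta>) * (U12 (?X s v) * s + Ut1 (?X s v) * (s * ((fst v - \<eta>) / ?R v)))
      - b * (U22 (?X s v) * s + Ut2 (?X s v) * (s * ((fst v - \<eta>) / ?R v)))) / ?R v
        + ((fst v - \<eta>) * U1 (?X s v) - b * U2 (?X s v)) * ((fst v - \<eta>) / ?R v) / ?R v ^ 2)"
  define dB where "dB = (\<lambda>s v. - (U1 (?X s v) + snd v * (Ut1 (?X s v) * (s * (snd v / ?R v)))) / ?R v
      + snd v * U1 (?X s v) * (snd v / ?R v) / ?R v ^ 2)"
  note cU = has_grad3_continuous[OF U] has_grad3_continuous[OF U1] has_grad3_continuous[OF U2]
    has_grad3_continuous[OF Ut] c
  have Rpos: "0 < ?R v" for v using b by (rule rad_pos)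
  then have R0: "?R v \<noteq> 0" for v by (metis less_irrefl)
  have cX: "continuous_on S (\<lambda>x. F (?X (g x) (h x)))"
    if "continuous_on UNIV F" "continuous_on S g" "continuous_on S h" for F :: "_ \<Rightarrow> real" and S :: "'z::topological_space set" and g h
    by (rule continuous_on_compose2[OF that(1)]) (auto intro!: continuous_intros that)
  have eq: "dE s v = dA s v + dB s v" for s v
    unfolding dE_def dA_def dB_def by (rule kirchhoff_divergence_identity[OF R0 rad_sq wave])
  have cdE: "continuous_on S (\<lambda>x. dE (g x) (h x))"
    if "continuous_on S g" "continuous_on S h" for S :: "'z::topological_space set" and g h
    unfolding dE_def by (intro continuous_intros cX cU that ballI) (simp_all add: R0)
  have cdA: "continuous_on S (\<lambda>x. dA (g x) (h x))"
    if "continuous_on S g" "continuous_on S h" for S :: "'z::topological_space set" and g h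
    unfolding dA_def by (intro continuous_intros cX cU that ballI) (simp_all add: R0)
  have cdB: "continuous_on S (\<lambda>x. dB (g x) (h x))"
    if "continuous_on S g" "continuous_on S h" for S :: "'z::topological_space set" and g h
    unfolding dB_def by (intro continuous_intros cX cU that ballI) (simp_all add: R0)
  have dX: "((\<lambda>s. F (?X s v)) has_real_derivative (F1 (?X s v) * b + F2 (?X s v) * (fst v - \<eta>) + F3 (?X s v) * ?R v)) (at s within T)"
    if "has_grad3 F F1 F2 F3" for F F1 F2 F3 s v T
    by (rule has_grad3_chain[OF that]) (auto intro!: derivative_eq_intros)
  have dXc: "((\<lambda>c. F (?X s (c, q))) has_real_derivative (F2 (?X s (c, q)) * s + F3 (?X s (c, q)) * (s * ((c - \<eta>) / ?R (c, q))))) (at c within T)"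
    if "has_grad3 F F1 F2 F3" for F F1 F2 F3 s c q T
    unfolding fst_conv
    by (rule DERIV_cong[OF has_grad3_chain[OF that, where \<alpha>'=0 and \<beta>'=s and \<gamma>'="s * ((c - \<eta>) / ?R (c, q))" and s=c and S=T
        and \<alpha>="\<lambda>_. \<xi> + s * b" and \<beta>="\<lambda>c. \<eta> + s * (c - \<eta>)" and \<gamma>="\<lambda>c. s * ?R (c, q)"]])
      (auto intro!: derivative_eq_intros rad_deriv_fst[OF b])
  have dXq: "((\<lambda>q. F (?X s (c, q))) has_real_derivative (F3 (?X s (c, q)) * (s * (q / ?R (c, q))))) (at q within T)"
    if "has_grad3 F F1 F2 F3" for F F1 F2 F3 s c q T
    unfolding fst_conv
    by (rule DERIV_cong[OF has_grad3_chain[OF that, where \<alpha>'=0 and \<beta>'=0 and \<gamma>'="s * (q / ?R (c, q))" and s=q and S=T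
        and \<alpha>="\<lambda>_. \<xi> + s * b" and \<beta>="\<lambda>_. \<eta> + s * (c - \<eta>)" and \<gamma>="\<lambda>q. s * ?R (c, q)"]])
      (auto intro!: derivative_eq_intros rad_deriv_snd[OF b])
  have "((\<lambda>s. integral ?box (?E s)) has_real_derivative integral ?box (dE s)) (at s within UNIV)"
  proof (rule leibniz_rule_field_derivative)
    fix s v
    show "((\<lambda>s. ?E s v) has_real_derivative dE s v) (at s within UNIV)"
      unfolding dE_def by (rule face_integrand_derivs[OF R0 dX[OF Ut] dX[OF U] dX[OF U1]])
    show "?E s integrable_on ?box"
      by (intro integrable_continuous continuous_intros cX cU ballI) (simp_all add: R0)
    show "continuous_on (UNIV \<times> ?box) (\<lambda>(s, v). dE s v)"
      unfolding split_beta by (intro cdE continuous_intros)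
  qed auto
  moreover have "integral ?box (dE s) = integral ?box (dA s) + integral ?box (dB s)"
    unfolding eq by (intro integral_add integrable_continuous cdA cdB continuous_intros)
  moreover have "integral ?box (dA s) = integral {0..Q} (\<lambda>q. A s (a, q)) - integral {0..Q} (\<lambda>q. A s (- a, q))"
  proof -
    have cA: "continuous_on S (\<lambda>x. A s (h x))" if "continuous_on S h" for S :: "'z::topological_space set" and h
      unfolding A_def by (intro continuous_intros cX cU that ballI) (simp_all add: R0)
    have 1: "integral (cbox (- a) a) (\<lambda>c. dA s (c, q)) = A s (a, q) - A s (- a, q)" for q
      unfolding cbox_interval
    proof (rule integral_unique, rule fundamental_theorem_of_calculus)
      fix c
      show "((\<lambda>c. A s (c, q)) has_vector_derivative dA s (c, q)) (at c within {- a..a})"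
        unfolding has_real_derivative_iff_has_vector_derivative[symmetric] A_def dA_def fst_conv snd_conv
        by (rule edge_integrand_derivs[OF R0 dXc[OF U1, unfolded fst_conv] dXc[OF U2, unfolded fst_conv] rad_deriv_fst[OF b]])
    qed (use a in auto)
    have "integral ?box (dA s) = integral (cbox (- a) a) (\<lambda>c. integral (cbox 0 Q) (\<lambda>q. dA s (c, q)))"
      by (intro integral_prod_continuous cdA continuous_intros)
    also have "\<dots> = integral (cbox 0 Q) (\<lambda>q. integral (cbox (- a) a) (\<lambda>c. dA s (c, q)))"
      by (rule integral_swap_continuous) (auto simp: split_beta intro!: cdA continuous_intros)
    also have "\<dots> = integral (cbox 0 Q) (\<lambda>q. A s (a, q) - A s (- a, q))"
      by (simp only: 1)
    also have "\<dots> = integral (cbox 0 Q) (\<lambda>q. A s (a, q)) - integral (cbox 0 Q) (\<lambda>q. A s (- a, q))"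
      by (intro integral_diff integrable_continuous cA continuous_intros)
    finally show ?thesis by simp
  qed
  moreover have "integral ?box (dB s) = - integral {- a..a} (\<lambda>c. Q * U1 (?X s (c, Q)) / ?R (c, Q))"
  proof -
    have 1: "integral (cbox 0 Q) (\<lambda>q. dB s (c, q)) = - (Q * U1 (?X s (c, Q)) / ?R (c, Q)) - - (0 * U1 (?X s (c, 0)) / ?R (c, 0))" for c
      unfolding cbox_interval
    proof (rule integral_unique, rule fundamental_theorem_of_calculus)
      fix q
      show "((\<lambda>q. - (q * U1 (?X s (c, q)) / ?R (c, q))) has_vector_derivative dB s (c, q)) (at q within {0..Q})"
        unfolding has_real_derivative_iff_has_vector_derivative[symmetric] dB_def fst_conv snd_conv
        using edge_integrand_derivs[where r="\<lambda>q. ?R (c, q)" and b=0 and \<eta>=0 and G="\<lambda>_. 0" and G'=0,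
            OF R0 dXq[OF U1, of s c q "{0..Q}", unfolded fst_conv] DERIV_const rad_deriv_snd[OF b]]
        by simp
    qed (use Q in auto)
    have "integral ?box (dB s) = integral (cbox (- a) a) (\<lambda>c. integral (cbox 0 Q) (\<lambda>q. dB s (c, q)))"
      by (intro integral_prod_continuous cdB continuous_intros)
    then show ?thesis unfolding 1 by simp
  qed
  ultimately show ?thesis
    unfolding face_def[abs_def] by simp
qed

text \<open>\<open>face\<close> uses the normal along the positive axis, so the two faces at
  \<open>- a\<close> enter with a minus sign to make the total flux an outward one.\<close>

definition flux where
  "flux a Q \<xi> \<eta> F G H1 H2 s =
     face a Q (a - \<xi>) \<xi> \<eta> F G H1 s - face a Q (- a - \<xi>) \<xi> \<eta> F G H1 s
     + face a Q (a - \<eta>) \<eta> \<xi> (swap3 F) (swap3 G) (swap3 H2) s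
     - face a Q (- a - \<eta>) \<eta> \<xi> (swap3 F) (swap3 G) (swap3 H2) s"

text \<open>Total flux through the lid \<open>q = Q\<close> of the truncated prism while it is scaled from \<open>0\<close> to \<open>1\<close>.\<close>

definition lid where
  "lid a Q b \<xi> \<eta> H = integral (cbox (0, - a) (1, a))
     (\<lambda>w. Q * H (pos3 b \<xi> \<eta> (fst w) (snd w, Q)) / rad b \<eta> (snd w, Q))"

definition lids where
  "lids a Q \<xi> \<eta> H1 H2 = lid a Q (a - \<xi>) \<xi> \<eta> H1 - lid a Q (- a - \<xi>) \<xi> \<eta> H1
     + lid a Q (a - \<eta>) \<eta> \<xi> (swap3 H2) - lid a Q (- a - \<eta>) \<eta> \<xi> (swap3 H2)"

text \<open>The signed solid angle under which the truncated face is seen from the source; it is the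
  coefficient of the source value when the prism is shrunk to a point.\<close>

definition angle :: "real \<Rightarrow> real \<Rightarrow> real \<Rightarrow> real \<Rightarrow> real" where
  "angle a Q b \<eta> = integral (cbox (- a, 0) (a, Q)) (\<lambda>v. b / rad b \<eta> v ^ 3)"

definition angles where
  "angles a Q \<xi> \<eta> = angle a Q (a - \<xi>) \<eta> - angle a Q (- a - \<xi>) \<eta>
     + angle a Q (a - \<eta>) \<xi> - angle a Q (- a - \<eta>) \<xi>"

lemma face_0: "face a Q b \<xi> \<eta> F G H 0 = - G (\<xi>, \<eta>, 0) * angle a Q b \<eta>"
proof -
  have "face a Q b \<xi> \<eta> F G H 0 = integral (cbox (- a, 0) (a, Q)) (\<lambda>v. - G (\<xi>, \<eta>, 0) * (b / rad b \<eta> v ^ 3))"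
    unfolding face_def by simp
  then show ?thesis unfolding angle_def by (simp only: integral_mult_right)
qed

lemma flux_0: "flux a Q \<xi> \<eta> F G H1 H2 0 = - G (\<xi>, \<eta>, 0) * angles a Q \<xi> \<eta>"
  by (simp add: flux_def face_0 angles_def swap3_def algebra_simps)

text \<open>Each vertical edge of the prism belongs to two faces, and its two contributions
  \<open>?I\<close> cancel, so the derivative in the scale consists of the top edges alone.
  Integrating it from scale 0 to 1 gives \<open>lids\<close>; at scale 0 only the solid angles
  remain.\<close>

lemma flux_identity:
  fixes a Q \<xi> \<eta> :: real
  assumes U: "has_grad3 U U1 U2 Ut" and U1: "has_grad3 U1 U11 U12 Ut1" and U2: "has_grad3 U2 U12 U22 Ut2"
    and Ut: "has_grad3 Ut Ut1 Ut2 Utt"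
    and c: "continuous_on UNIV U11" "continuous_on UNIV U12" "continuous_on UNIV U22"
      "continuous_on UNIV Ut1" "continuous_on UNIV Ut2" "continuous_on UNIV Utt"
    and wave: "\<And>p. Utt p = U11 p + U22 p"
    and a: "0 \<le> a" and Q: "0 \<le> Q"
    and b: "a - \<xi> \<noteq> 0" "- a - \<xi> \<noteq> 0" "a - \<eta> \<noteq> 0" "- a - \<eta> \<noteq> 0"
  shows "flux a Q \<xi> \<eta> Ut U U1 U2 1 = - U (\<xi>, \<eta>, 0) * angles a Q \<xi> \<eta> - lids a Q \<xi> \<eta> U1 U2"
proof -
  define A where "A = (\<lambda>b z q s. - (z * U1 (\<xi> + s * b, \<eta> + s * z, s * sqrt (b\<^sup>2 + z\<^sup>2 + q\<^sup>2))
      - b * U2 (\<xi> + s * b, \<eta> + s * z, s * sqrt (b\<^sup>2 + z\<^sup>2 + q\<^sup>2))) / sqrt (b\<^sup>2 + z\<^sup>2 + q\<^sup>2))"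
  let ?I = "\<lambda>b z s. integral {0..Q} (\<lambda>q. A b z q s)"
  let ?e = "\<lambda>b \<xi> \<eta> H s. integral {- a..a} (\<lambda>c. Q * H (pos3 b \<xi> \<eta> s (c, Q)) / rad b \<eta> (c, Q))"
  note cU = has_grad3_continuous[OF U1] has_grad3_continuous[OF U2]
  have 1: "(face a Q b \<xi> \<eta> Ut U U1 has_real_derivative
      ?I b (a - \<eta>) s - ?I b (- a - \<eta>) s - ?e b \<xi> \<eta> U1 s) (at s)" if b: "b \<noteq> 0" for b s
    using face_has_derivative[OF U U1 U2 Ut c wave b a Q, of \<xi> \<eta> s]
    unfolding A_def rad_def fst_conv snd_conv .
  have 2: "(face a Q b \<eta> \<xi> (swap3 Ut) (swap3 U) (swap3 U2) has_real_derivative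
      - ?I (a - \<xi>) b s + ?I (- a - \<xi>) b s - ?e b \<eta> \<xi> (swap3 U2) s) (at s)" if b: "b \<noteq> 0" for b s
  proof -
    have *: "swap3 Utt p = swap3 U22 p + swap3 U11 p" for p
      by (simp add: swap3_def wave)
    \<comment> \<open>Seen from the adjacent face, \<open>b\<close> and \<open>z\<close> trade
      places, which reverses the sign of the edge term.\<close>
    have neg: "integral {0..Q} (\<lambda>q. - (z * swap3 U2 (\<eta> + s * b, \<xi> + s * z, s * sqrt (b\<^sup>2 + z\<^sup>2 + q\<^sup>2))
      - b * swap3 U1 (\<eta> + s * b, \<xi> + s * z, s * sqrt (b\<^sup>2 + z\<^sup>2 + q\<^sup>2))) / sqrt (b\<^sup>2 + z\<^sup>2 + q\<^sup>2)) = - ?I z b s" for z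
      unfolding A_def integral_neg[symmetric]
      by (intro integral_cong) (simp add: swap3_def add.commute[of "b\<^sup>2"] diff_divide_distrib)
    show ?thesis
      using face_has_derivative[OF has_grad3_swap3[OF U] has_grad3_swap3[OF U2] has_grad3_swap3[OF U1]
        has_grad3_swap3[OF Ut] c(3,2,1,5,4,6)[THEN continuous_swap3] * b a Q, of \<eta> \<xi> s]
      unfolding rad_def fst_conv snd_conv neg by simp
  qed
  have D: "(flux a Q \<xi> \<eta> Ut U U1 U2 has_real_derivative
      - (?e (a - \<xi>) \<xi> \<eta> U1 s - ?e (- a - \<xi>) \<xi> \<eta> U1 s + ?e (a - \<eta>) \<eta> \<xi> (swap3 U2) s
          - ?e (- a - \<eta>) \<eta> \<xi> (swap3 U2) s)) (at s within {0..1})" for s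
    unfolding flux_def[abs_def]
    by (rule DERIV_cong[OF DERIV_diff[OF DERIV_add[OF DERIV_diff[OF 1[OF b(1)] 1[OF b(2)]] 2[OF b(3)]] 2[OF b(4)],
          THEN has_field_derivative_at_within]]) (simp only: algebra_simps)
  have "((\<lambda>s. - (?e (a - \<xi>) \<xi> \<eta> U1 s - ?e (- a - \<xi>) \<xi> \<eta> U1 s + ?e (a - \<eta>) \<eta> \<xi> (swap3 U2) s
          - ?e (- a - \<eta>) \<eta> \<xi> (swap3 U2) s)) has_integral flux a Q \<xi> \<eta> Ut U U1 U2 1 - flux a Q \<xi> \<eta> Ut U U1 U2 0) {0..1}"
    by (rule fundamental_theorem_of_calculus)
      (simp_all only: has_real_derivative_iff_has_vector_derivative[symmetric] D zero_le_one)
  moreover have e: "(?e b \<xi> \<eta> H has_integral lid a Q b \<xi> \<eta> H) {0..1}"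
    if b: "b \<noteq> 0" and H: "continuous_on UNIV H" for b \<xi> \<eta> H
  proof -
    have R0: "rad b \<eta> v \<noteq> 0" for v using rad_pos[OF b] by (metis less_irrefl)
    have cH: "continuous_on S (\<lambda>w. H (pos3 b \<xi> \<eta> (fst w) (snd w, Q)))" for S
      by (rule continuous_on_compose2[OF H]) (auto intro!: continuous_intros)
    have cg: "continuous_on S (\<lambda>w. Q * H (pos3 b \<xi> \<eta> (fst w) (snd w, Q)) / rad b \<eta> (snd w, Q))" for S
      by (intro continuous_intros cH ballI R0)
    have i: "integral (cbox 0 1) (?e b \<xi> \<eta> H) = lid a Q b \<xi> \<eta> H"
      unfolding lid_def cbox_interval[symmetric]
      using integral_prod_continuous[OF cg, of 0 "- a" 1 a] by simp
    have "continuous_on (cbox 0 1) (\<lambda>s. integral (cbox (- a) a) (\<lambda>c. Q * H (pos3 b \<xi> \<eta> s (c, Q)) / rad b \<eta> (c, Q)))"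
      by (rule integral_continuous_on_param) (use cg in \<open>simp add: split_beta\<close>)
    then have "?e b \<xi> \<eta> H integrable_on cbox 0 1"
      unfolding cbox_interval by (intro integrable_continuous_interval)
    from integrable_integral[OF this] show ?thesis unfolding i by simp
  qed
  have "((\<lambda>s. - (?e (a - \<xi>) \<xi> \<eta> U1 s - ?e (- a - \<xi>) \<xi> \<eta> U1 s + ?e (a - \<eta>) \<eta> \<xi> (swap3 U2) s
          - ?e (- a - \<eta>) \<eta> \<xi> (swap3 U2) s)) has_integral - lids a Q \<xi> \<eta> U1 U2) {0..1}"
    unfolding lids_def
    by (intro has_integral_neg has_integral_diff has_integral_add e b cU continuous_swap3)
  ultimately have "flux a Q \<xi> \<eta> Ut U U1 U2 1 - flux a Q \<xi> \<eta> Ut U U1 U2 0 = - lids a Q \<xi> \<eta> U1 U2"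
    by (rule has_integral_unique)
  then show ?thesis by (simp add: flux_0)
qed

lemma shift3_0 [simp]: "shift3 0 F = F"
  by (simp add: shift3_def[abs_def])

lemma swap3_shift3: "swap3 (shift3 h F) = shift3 h (swap3 F)"
  by (simp add: shift3_def[abs_def] swap3_def[abs_def])

lemma shift3_deriv:
  assumes "has_grad3 F F1 F2 F3"
  shows "((\<lambda>h. shift3 h F p) has_real_derivative shift3 h F3 p) (at h within S)"
  unfolding shift3_def
  by (rule DERIV_cong[OF has_grad3_chain[OF assms, where \<alpha>'=0 and \<beta>'=0 and \<gamma>'=1]])
    (auto intro!: derivative_eq_intros)

lemma face_shift_deriv:
  assumes F: "has_grad3 F F1 F2 F3" and G: "has_grad3 G G1 G2 G3" and H: "has_grad3 H H1 H2 H3"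
    and c: "continuous_on UNIV F3" "continuous_on UNIV G3" "continuous_on UNIV H3" and b: "b \<noteq> 0"
  shows "((\<lambda>h. face a Q b \<xi> \<eta> (shift3 h F) (shift3 h G) (shift3 h H) 1) has_real_derivative
    face a Q b \<xi> \<eta> F3 G3 H3 1) (at 0)"
proof -
  have R0: "rad b \<eta> v \<noteq> 0" for v using rad_pos[OF b] by (metis less_irrefl)
  have cX: "continuous_on S (\<lambda>x. shift3 (g x) F (pos3 b \<xi> \<eta> 1 (k x)))"
    if "continuous_on UNIV F" "continuous_on S g" "continuous_on S k" for F and S :: "'z::topological_space set" and g k
    unfolding shift3_def
    by (rule continuous_on_compose2[OF that(1)]) (auto intro!: continuous_intros that)
  let ?E = "\<lambda>F G H v. 1 * F (pos3 b \<xi> \<eta> 1 v) * b / rad b \<eta> v ^ 2 - G (pos3 b \<xi> \<eta> 1 v) * b / rad b \<eta> v ^ 3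
        - 1 * H (pos3 b \<xi> \<eta> 1 v) / rad b \<eta> v"
  have "((\<lambda>h. integral (cbox (- a, 0) (a, Q)) (?E (shift3 h F) (shift3 h G) (shift3 h H))) has_real_derivative
      integral (cbox (- a, 0) (a, Q)) (?E (shift3 0 F3) (shift3 0 G3) (shift3 0 H3))) (at 0 within UNIV)"
  proof (rule leibniz_rule_field_derivative)
    fix h v
    show "((\<lambda>h. ?E (shift3 h F) (shift3 h G) (shift3 h H) v) has_real_derivative ?E (shift3 h F3) (shift3 h G3) (shift3 h H3) v) (at h within UNIV)"
      by (intro DERIV_diff DERIV_cdivide DERIV_cmult DERIV_cmult_right shift3_deriv[OF F] shift3_deriv[OF G] shift3_deriv[OF H])
    show "?E (shift3 h F) (shift3 h G) (shift3 h H) integrable_on cbox (- a, 0) (a, Q)"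
      by (intro integrable_continuous continuous_intros cX has_grad3_continuous[OF F] has_grad3_continuous[OF G]
          has_grad3_continuous[OF H] ballI) (simp_all add: R0)
    show "continuous_on (UNIV \<times> cbox (- a, 0) (a, Q)) (\<lambda>(h, v). ?E (shift3 h F3) (shift3 h G3) (shift3 h H3) v)"
      unfolding split_beta by (intro continuous_intros cX c ballI) (simp_all add: R0)
  qed auto
  then show ?thesis unfolding face_def by simp
qed

lemma lid_shift_deriv:
  assumes H: "has_grad3 H H1 H2 H3" and c: "continuous_on UNIV H3" and b: "b \<noteq> 0"
  shows "((\<lambda>h. lid a Q b \<xi> \<eta> (shift3 h H)) has_real_derivative lid a Q b \<xi> \<eta> H3) (at 0)"
proof -
  have R0: "rad b \<eta> v \<noteq> 0" for v using rad_pos[OF b] by (metis less_irrefl)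
  have cX: "continuous_on S (\<lambda>x. shift3 (g x) F (pos3 b \<xi> \<eta> (fst (k x)) (snd (k x), Q)))"
    if "continuous_on UNIV F" "continuous_on S g" "continuous_on S k" for F and S :: "'z::topological_space set" and g k
    unfolding shift3_def
    by (rule continuous_on_compose2[OF that(1)]) (auto intro!: continuous_intros that)
  let ?E = "\<lambda>H w. Q * H (pos3 b \<xi> \<eta> (fst w) (snd w, Q)) / rad b \<eta> (snd w, Q)"
  have "((\<lambda>h. integral (cbox (0, - a) (1, a)) (?E (shift3 h H))) has_real_derivative
      integral (cbox (0, - a) (1, a)) (?E (shift3 0 H3))) (at 0 within UNIV)"
  proof (rule leibniz_rule_field_derivative)
    fix h v
    show "((\<lambda>h. ?E (shift3 h H) v) has_real_derivative ?E (shift3 h H3) v) (at h within UNIV)"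
      by (intro DERIV_cdivide DERIV_cmult shift3_deriv[OF H])
    show "?E (shift3 h H) integrable_on cbox (0, - a) (1, a)"
      by (intro integrable_continuous continuous_intros cX has_grad3_continuous[OF H] ballI) (simp_all add: R0)
    show "continuous_on (UNIV \<times> cbox (0, - a) (1, a)) (\<lambda>(h, v). ?E (shift3 h H3) v)"
      unfolding split_beta by (intro continuous_intros cX c ballI) (simp_all add: R0)
  qed auto
  then show ?thesis unfolding lid_def by simp
qed

context wave begin

text \<open>For \<open>f\<close> of class \<open>C\<^sup>2\<close> only the primitive \<open>u\<close> of the wave \<open>ut\<close> has classical second derivatives.
  The identity for \<open>ut\<close> is therefore the time derivative of the identity for the shifts of \<open>u\<close>.\<close>

lemma flux_identity_ut:
  assumes a: "0 \<le> a" and Q: "0 \<le> Q"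
    and b: "a - \<xi> \<noteq> 0" "- a - \<xi> \<noteq> 0" "a - \<eta> \<noteq> 0" "- a - \<eta> \<noteq> 0"
  shows "flux a Q \<xi> \<eta> utt ut ut1 ut2 1 = - f (\<xi>, \<eta>) * angles a Q \<xi> \<eta> - lids a Q \<xi> \<eta> ut1 ut2"
proof -
  have *: "flux a Q \<xi> \<eta> (shift3 h ut) (shift3 h u) (shift3 h u1) (shift3 h u2) 1
      = - shift3 h u (\<xi>, \<eta>, 0) * angles a Q \<xi> \<eta> - lids a Q \<xi> \<eta> (shift3 h u1) (shift3 h u2)" for h
    by (rule flux_identity[OF has_grad3_shift3[OF grad_u] has_grad3_shift3[OF grad_u1] has_grad3_shift3[OF grad_u2]
          has_grad3_shift3[OF grad_ut] continuous_u[THEN continuous_shift3] _ a Q b])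
      (simp add: shift3_def wave_equation)
  note cont = has_grad3_continuous[OF grad_ut] continuous_u
  have X: "((\<lambda>h. flux a Q \<xi> \<eta> (shift3 h ut) (shift3 h u) (shift3 h u1) (shift3 h u2) 1) has_real_derivative
      flux a Q \<xi> \<eta> utt ut ut1 ut2 1) (at 0)"
    unfolding flux_def swap3_shift3
    by (intro DERIV_diff DERIV_add face_shift_deriv b continuous_swap3 cont)
      (rule grad_u grad_u1 grad_u2 grad_ut has_grad3_swap3)+
  have Y: "((\<lambda>h. - shift3 h u (\<xi>, \<eta>, 0) * angles a Q \<xi> \<eta> - lids a Q \<xi> \<eta> (shift3 h u1) (shift3 h u2)) has_real_derivative
      - shift3 0 ut (\<xi>, \<eta>, 0) * angles a Q \<xi> \<eta> - lids a Q \<xi> \<eta> ut1 ut2) (at 0)"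
    unfolding lids_def swap3_shift3
    by (intro DERIV_diff DERIV_add DERIV_cmult_right DERIV_minus shift3_deriv[OF grad_u] lid_shift_deriv b continuous_swap3 cont)
      (rule grad_u grad_u1 grad_u2 grad_ut has_grad3_swap3)+
  show ?thesis
    using DERIV_unique[OF X[unfolded *] Y] by (simp add: ut_initial)
qed

end

section \<open>Decay of the wave and of the flux through the lid\<close>

lemma compact_abs_bounded:
  fixes g :: "'a::topological_space \<Rightarrow> real"
  assumes "compact S" "continuous_on S g"
  obtains B where "\<And>p. p \<in> S \<Longrightarrow> \<bar>g p\<bar> \<le> B"
proof -
  have "bounded (g ` S)" using assms compact_continuous_image compact_imp_bounded by blast
  then obtain B where "\<forall>y\<in>g ` S. norm y \<le> B" unfolding bounded_iff by blast
  then show ?thesis by (intro that[of B]) auto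
qed

lemma bounded_of_support:
  fixes g :: "real \<times> real \<Rightarrow> real"
  assumes "continuous_on UNIV g" and supp: "\<And>p. M < \<bar>fst p\<bar> \<or> M < \<bar>snd p\<bar> \<Longrightarrow> g p = 0"
  obtains B where "\<And>p. \<bar>g p\<bar> \<le> B"
proof -
  obtain B where B: "\<And>p. p \<in> cbox (- M, - M) (M, M) \<Longrightarrow> \<bar>g p\<bar> \<le> B"
    using compact_abs_bounded[OF compact_cbox continuous_on_subset[OF assms(1) subset_UNIV]] by blast
  have "\<bar>g p\<bar> \<le> max B 0" for p
  proof (cases "p \<in> cbox (- M, - M) (M, M)")
    case True
    then show ?thesis using B[of p] by simp
  next
    case False
    then have "M < \<bar>fst p\<bar> \<or> M < \<bar>snd p\<bar>" by (cases p) auto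
    then show ?thesis using supp[of p] by simp
  qed
  then show ?thesis by (rule that)
qed

definition decays :: "real \<Rightarrow> nat \<Rightarrow> (real \<times> real \<times> real \<Rightarrow> real) \<Rightarrow> bool" where
  "decays L k h \<longleftrightarrow> (\<exists>C. \<forall>x y t. \<bar>x\<bar> \<le> L \<and> \<bar>y\<bar> \<le> L \<and> 0 < t \<longrightarrow> t ^ k * \<bar>h (x, y, t)\<bar> \<le> C)"

lemma decays_hmean:
  fixes w g :: "real \<times> real \<Rightarrow> real"
  assumes c: "continuous_on UNIV w" "continuous_on UNIV g"
    and w: "\<And>v. v \<in> quarter \<Longrightarrow> \<bar>w v\<bar> \<le> sin (fst v) ^ k"
    and supp: "\<And>p. M < \<bar>fst p\<bar> \<or> M < \<bar>snd p\<bar> \<Longrightarrow> g p = 0" and M: "0 \<le> M" and m: "m = Suc k"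
  shows "decays L m (hmean w g)"
proof -
  obtain B where B: "\<And>p. \<bar>g p\<bar> \<le> B" using bounded_of_support[OF c(2) supp] by blast
  show ?thesis
    unfolding decays_def m
    using hmean_decay[OF c w B supp _ _ _ M] by (intro exI) (auto simp: field_simps)
qed

lemma decays_add:
  assumes "decays L k h" "decays L k h'"
  shows "decays L k (\<lambda>p. h p + h' p)"
proof -
  obtain C C' where C: "\<And>x y t. \<bar>x\<bar> \<le> L \<Longrightarrow> \<bar>y\<bar> \<le> L \<Longrightarrow> 0 < t \<Longrightarrow> t ^ k * \<bar>h (x, y, t)\<bar> \<le> C"
    "\<And>x y t. \<bar>x\<bar> \<le> L \<Longrightarrow> \<bar>y\<bar> \<le> L \<Longrightarrow> 0 < t \<Longrightarrow> t ^ k * \<bar>h' (x, y, t)\<bar> \<le> C'"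
    using assms unfolding decays_def by blast
  have "t ^ k * \<bar>h (x, y, t) + h' (x, y, t)\<bar> \<le> C + C'" if "\<bar>x\<bar> \<le> L" "\<bar>y\<bar> \<le> L" "0 < t" for x y t
  proof -
    have "t ^ k * \<bar>h (x, y, t) + h' (x, y, t)\<bar> \<le> t ^ k * (\<bar>h (x, y, t)\<bar> + \<bar>h' (x, y, t)\<bar>)"
      using that by (intro mult_left_mono) auto
    then show ?thesis using C[OF that] by (simp add: distrib_left)
  qed
  then show ?thesis unfolding decays_def by blast
qed

lemma decays_cmult:
  assumes "decays L k h"
  shows "decays L k (\<lambda>p. c * h p)"
proof -
  obtain C where C: "\<And>x y t. \<bar>x\<bar> \<le> L \<Longrightarrow> \<bar>y\<bar> \<le> L \<Longrightarrow> 0 < t \<Longrightarrow> t ^ k * \<bar>h (x, y, t)\<bar> \<le> C"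
    using assms unfolding decays_def by blast
  have "t ^ k * \<bar>c * h (x, y, t)\<bar> \<le> \<bar>c\<bar> * C" if "\<bar>x\<bar> \<le> L" "\<bar>y\<bar> \<le> L" "0 < t" for x y t
    using mult_left_mono[OF C[OF that], of "\<bar>c\<bar>"] by (simp add: abs_mult mult.left_commute)
  then show ?thesis unfolding decays_def by blast
qed

lemma decays_time_mult:
  assumes "decays L (Suc k) h"
  shows "decays L k (\<lambda>p. snd (snd p) * h p)"
  using assms unfolding decays_def by (auto simp: abs_mult mult_ac)

context wave begin

lemma weights: "v \<in> quarter \<Longrightarrow> \<bar>w0 v\<bar> \<le> sin (fst v) ^ 1"
  "v \<in> quarter \<Longrightarrow> \<bar>wx v\<bar> \<le> sin (fst v) ^ 2" "v \<in> quarter \<Longrightarrow> \<bar>wy v\<bar> \<le> sin (fst v) ^ 2"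
  "v \<in> quarter \<Longrightarrow> \<bar>wx v * sx v\<bar> \<le> sin (fst v) ^ 3" "v \<in> quarter \<Longrightarrow> \<bar>wx v * sy v\<bar> \<le> sin (fst v) ^ 3"
  "v \<in> quarter \<Longrightarrow> \<bar>wy v * sx v\<bar> \<le> sin (fst v) ^ 3" "v \<in> quarter \<Longrightarrow> \<bar>wy v * sy v\<bar> \<le> sin (fst v) ^ 3"
proof -
  have s: "0 \<le> sin (fst v)" if "v \<in> quarter" for v
    using that by (cases v) (auto intro!: sin_ge_zero)
  have m: "\<bar>s * z\<bar> \<le> s" if "0 \<le> s" "\<bar>z\<bar> \<le> 1" for s z :: real
    using mult_left_mono[OF that(2,1)] that by (simp add: abs_mult)
  have cs: "\<bar>cos \<theta> * sin \<theta>\<bar> \<le> 1" "\<bar>cos \<theta> * cos \<theta>\<bar> \<le> 1" "\<bar>sin \<theta> * sin \<theta>\<bar> \<le> 1" for \<theta> :: real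
    using mult_le_one[OF abs_cos_le_one abs_ge_zero abs_sin_le_one, of \<theta> \<theta>]
      mult_le_one[OF abs_cos_le_one abs_ge_zero abs_cos_le_one, of \<theta> \<theta>]
      mult_le_one[OF abs_sin_le_one abs_ge_zero abs_sin_le_one, of \<theta> \<theta>] by (simp_all add: abs_mult)
  show "v \<in> quarter \<Longrightarrow> \<bar>w0 v\<bar> \<le> sin (fst v) ^ 1" using s by auto
  show "v \<in> quarter \<Longrightarrow> \<bar>wx v\<bar> \<le> sin (fst v) ^ 2" "v \<in> quarter \<Longrightarrow> \<bar>wy v\<bar> \<le> sin (fst v) ^ 2"
    using m[of "sin (fst v) ^ 2" "cos (snd v)"] m[of "sin (fst v) ^ 2" "sin (snd v)"]
    by (simp_all add: power2_eq_square mult.assoc)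
  show "v \<in> quarter \<Longrightarrow> \<bar>wx v * sx v\<bar> \<le> sin (fst v) ^ 3" "v \<in> quarter \<Longrightarrow> \<bar>wx v * sy v\<bar> \<le> sin (fst v) ^ 3"
    "v \<in> quarter \<Longrightarrow> \<bar>wy v * sx v\<bar> \<le> sin (fst v) ^ 3" "v \<in> quarter \<Longrightarrow> \<bar>wy v * sy v\<bar> \<le> sin (fst v) ^ 3"
    using s[of v] cs[of "snd v"] m[of "sin (fst v) ^ 3" "cos (snd v) * sin (snd v)"]
      m[of "sin (fst v) ^ 3" "cos (snd v) * cos (snd v)"] m[of "sin (fst v) ^ 3" "sin (snd v) * sin (snd v)"]
    by (simp_all add: power3_eq_cube mult.assoc mult.left_commute mult.commute)
qed

text \<open>A time derivative adds a sine to the weight and so gains one order, whereas an explicit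
  factor \<open>t\<close> costs one. Space derivatives only change the function under the mean and
  gain nothing.\<close>

lemma decays_wave: "decays L 2 ut" "decays L 2 ut1" "decays L 2 ut2" "decays L 3 utt"
proof -
  have d: "decays L 2 (hmean w0 h)" "decays L 3 (hmean wx h)" "decays L 3 (hmean wy h)"
    "decays L 4 (hmean (\<lambda>v. wx v * sx v) h)" "decays L 4 (hmean (\<lambda>v. wx v * sy v) h)"
    "decays L 4 (hmean (\<lambda>v. wy v * sx v) h)" "decays L 4 (hmean (\<lambda>v. wy v * sy v) h)"
    if c: "continuous_on UNIV h" and z: "\<And>p. M < \<bar>fst p\<bar> \<or> M < \<bar>snd p\<bar> \<Longrightarrow> h p = 0" for h
    by (rule decays_hmean[OF _ c _ z M], rule cw, erule weights, assumption, simp)+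
  have z: "M < \<bar>fst p\<bar> \<or> M < \<bar>snd p\<bar> \<Longrightarrow> f p = 0" "M < \<bar>fst p\<bar> \<or> M < \<bar>snd p\<bar> \<Longrightarrow> f1 p = 0"
    "M < \<bar>fst p\<bar> \<or> M < \<bar>snd p\<bar> \<Longrightarrow> f2 p = 0" "M < \<bar>fst p\<bar> \<or> M < \<bar>snd p\<bar> \<Longrightarrow> f11 p = 0"
    "M < \<bar>fst p\<bar> \<or> M < \<bar>snd p\<bar> \<Longrightarrow> f12 p = 0" "M < \<bar>fst p\<bar> \<or> M < \<bar>snd p\<bar> \<Longrightarrow> f22 p = 0" for p
    using supp by auto
  have t: "decays L 3 h \<Longrightarrow> decays L 2 (\<lambda>p. snd (snd p) * h p)" "decays L 4 h \<Longrightarrow> decays L 3 (\<lambda>p. snd (snd p) * h p)" for h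
    using decays_time_mult[of L 2 h] decays_time_mult[of L 3 h] by simp_all
  show "decays L 2 ut" "decays L 2 ut1" "decays L 2 ut2" "decays L 3 utt"
    unfolding ut_def[abs_def] ut1_def[abs_def] ut2_def[abs_def] utt_def[abs_def]
    by (intro decays_cmult decays_add t d cf cf1 cf2 cf11 cf12 cf22; rule z; assumption)+
qed

text \<open>The bound on \<open>t ^ 2 * H\<close> degenerates at small times, where compactness
  takes over. The factor 4 comes from \<open>1 + t\<close> being at most twice the larger of 1 and
  \<open>t\<close>.\<close>

lemma gradient_decay:
  assumes H: "H = ut1 \<or> H = ut2"
  obtains C where "0 \<le> C" "\<And>x y t. \<bar>x\<bar> \<le> L \<Longrightarrow> \<bar>y\<bar> \<le> L \<Longrightarrow> 0 \<le> t \<Longrightarrow> \<bar>H (x, y, t)\<bar> \<le> C / (1 + t)\<^sup>2"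
proof -
  have "decays L 2 H" using H decays_wave by blast
  then obtain C where C: "\<And>x y t. \<bar>x\<bar> \<le> L \<and> \<bar>y\<bar> \<le> L \<and> 0 < t \<Longrightarrow> t ^ 2 * \<bar>H (x, y, t)\<bar> \<le> C"
    unfolding decays_def by blast
  have cH: "continuous_on UNIV H" using H continuous_u by auto
  obtain B where B: "\<And>p. p \<in> cbox (- L, - L, 0) (L, L, 1) \<Longrightarrow> \<bar>H p\<bar> \<le> B"
    using compact_abs_bounded[OF compact_cbox continuous_on_subset[OF cH subset_UNIV]] by blast
  have "\<bar>H (x, y, t)\<bar> \<le> 4 * max 0 (max B C) / (1 + t)\<^sup>2" if p: "\<bar>x\<bar> \<le> L" "\<bar>y\<bar> \<le> L" "0 \<le> t" for x y t
  proof -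
    have "(1 + t)\<^sup>2 * \<bar>H (x, y, t)\<bar> \<le> 4 * max 0 (max B C)"
    proof (cases "t \<le> 1")
      case True
      have "\<bar>H (x, y, t)\<bar> \<le> B" using p True by (intro B) auto
      moreover have "(1 + t)\<^sup>2 \<le> 2\<^sup>2" using p True by (intro power_mono) auto
      ultimately have "(1 + t)\<^sup>2 * \<bar>H (x, y, t)\<bar> \<le> 2\<^sup>2 * B" by (intro mult_mono) auto
      then show ?thesis by simp
    next
      case False
      have "(1 + t)\<^sup>2 \<le> (2 * t)\<^sup>2" using False by (intro power_mono) auto
      then have "(1 + t)\<^sup>2 * \<bar>H (x, y, t)\<bar> \<le> (2 * t)\<^sup>2 * \<bar>H (x, y, t)\<bar>" by (intro mult_right_mono) auto
      also have "\<dots> = 4 * (t ^ 2 * \<bar>H (x, y, t)\<bar>)" by (simp add: power_mult_distrib)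
      also have "\<dots> \<le> 4 * C" using C[of x y t] p False by auto
      finally show ?thesis by simp
    qed
    then show ?thesis using p by (simp add: field_simps)
  qed
  then show ?thesis by (intro that[of "4 * max 0 (max B C)"]) auto
qed

end

lemma snd_le_rad: "\<bar>snd v\<bar> \<le> rad b \<eta> v"
proof -
  have "sqrt ((snd v)\<^sup>2) \<le> rad b \<eta> v"
    unfolding rad_def by (rule real_sqrt_le_mono) simp
  then show ?thesis by simp
qed

lemma integral_inverse_square:
  assumes "0 \<le> (Q::real)"
  shows "integral {0..1} (\<lambda>s. 1 / (1 + s * Q)\<^sup>2) = 1 / (1 + Q)"
proof -
  \<comment> \<open>The primitive \<open>s / (1 + s * Q)\<close> differs by a constant from the
    obvious one, and has no exception at \<open>Q = 0\<close>.\<close>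
  have "((\<lambda>s. 1 / (1 + s * Q)\<^sup>2) has_integral 1 / (1 + 1 * Q) - 0 / (1 + 0 * Q)) {0..1}"
  proof (rule fundamental_theorem_of_calculus[where f="\<lambda>s. s / (1 + s * Q)"])
    fix s :: real assume "s \<in> {0..1}"
    then have p: "1 + s * Q > 0" using assms by (auto intro: add_pos_nonneg)
    have "((\<lambda>s. s / (1 + s * Q)) has_real_derivative (1 * (1 + s * Q) - s * (0 + 1 * Q)) / ((1 + s * Q) * (1 + s * Q))) (at s within {0..1})"
      by (intro DERIV_divide DERIV_add DERIV_const DERIV_ident DERIV_cmult_right) (use p in auto)
    then show "((\<lambda>s. s / (1 + s * Q)) has_vector_derivative 1 / (1 + s * Q)\<^sup>2) (at s within {0..1})"
      by (simp add: has_real_derivative_iff_has_vector_derivative power2_eq_square)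
  qed simp
  then show ?thesis by (simp add: integral_unique)
qed

text \<open>On the lid at scale \<open>s\<close> the ratio \<open>Q / R\<close> is at most 1 and the
  time is at least \<open>s * Q\<close>. The quadratic decay therefore bounds the integral by a
  multiple of the integral of 1/(1 + s Q)^2 over the scales, which is 1/(1 + Q).\<close>

lemma lid_tendsto_0:
  assumes H: "continuous_on UNIV H" and b: "b \<noteq> 0" and a: "0 \<le> a"
    and bd: "\<And>L. \<exists>C\<ge>0. \<forall>x y t. \<bar>x\<bar> \<le> L \<longrightarrow> \<bar>y\<bar> \<le> L \<longrightarrow> 0 \<le> t \<longrightarrow> \<bar>H (x, y, t)\<bar> \<le> C / (1 + t)\<^sup>2"
  shows "((\<lambda>Q. lid a Q b \<xi> \<eta> H) \<longlongrightarrow> 0) at_top"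
proof -
  \<comment> \<open>Bounds both coordinates of all scaled points, for scales at most 1 and positions
    within \<open>a\<close> on the face.\<close>
  define L where "L = \<bar>\<xi>\<bar> + \<bar>b\<bar> + 2 * \<bar>\<eta>\<bar> + a"
  obtain C where C0: "0 \<le> C" and C: "\<And>x y t. \<bar>x\<bar> \<le> L \<Longrightarrow> \<bar>y\<bar> \<le> L \<Longrightarrow> 0 \<le> t \<Longrightarrow> \<bar>H (x, y, t)\<bar> \<le> C / (1 + t)\<^sup>2"
    using bd[of L] by blast
  have R: "0 < rad b \<eta> v" for v using b by (rule rad_pos)
  then have R0: "rad b \<eta> v \<noteq> 0" for v by (metis less_irrefl)
  have bound: "norm (lid a Q b \<xi> \<eta> H) \<le> 2 * a * C / (1 + Q)" if Q: "0 \<le> Q" for Q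
  proof -
    let ?h = "\<lambda>w. Q * H (pos3 b \<xi> \<eta> (fst w) (snd w, Q)) / rad b \<eta> (snd w, Q)"
    let ?g = "\<lambda>w. C * (1 / (1 + fst w * Q)\<^sup>2)"
    have cH: "continuous_on S (\<lambda>w. H (pos3 b \<xi> \<eta> (fst w) (snd w, Q)))" for S
      by (rule continuous_on_compose2[OF H]) (auto intro!: continuous_intros)
    have p: "1 + fst w * Q > 0" if "w \<in> cbox (0, - a) (1, a)" for w :: "real \<times> real"
      using that Q by (cases w) (auto intro!: add_pos_nonneg)
    have cg: "continuous_on (cbox (0, - a) (1, a)) ?g"
      by (intro continuous_intros) (use p in fastforce)
    have "norm (integral (cbox (0, - a) (1, a)) ?h) \<le> integral (cbox (0, - a) (1, a)) ?g"
    proof (rule integral_norm_bound_integral)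
      show "?h integrable_on cbox (0, - a) (1, a)"
        by (intro integrable_continuous continuous_intros cH ballI R0)
      show "?g integrable_on cbox (0, - a) (1, a)"
        by (intro integrable_continuous cg)
      fix w :: "real \<times> real" assume w: "w \<in> cbox (0, - a) (1, a)"
      obtain s c where sc: "w = (s, c)" by (cases w)
      then have s: "0 \<le> s" "s \<le> 1" "\<bar>c\<bar> \<le> a" using w by auto
      let ?R = "rad b \<eta> (c, Q)"
      have RQ: "Q \<le> ?R" using snd_le_rad[where v="(c, Q)" and b=b and \<eta>=\<eta>] Q by simp
      have "\<bar>s * b\<bar> \<le> \<bar>b\<bar>" "\<bar>s * (c - \<eta>)\<bar> \<le> \<bar>c - \<eta>\<bar>"
        using mult_right_mono[OF s(2), of "\<bar>b\<bar>"] mult_right_mono[OF s(2), of "\<bar>c - \<eta>\<bar>"] s by (simp_all add: abs_mult)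
      then have "\<bar>\<xi> + s * b\<bar> \<le> L" "\<bar>\<eta> + s * (c - \<eta>)\<bar> \<le> L" using s unfolding L_def by linarith+
      then have "\<bar>H (\<xi> + s * b, \<eta> + s * (c - \<eta>), s * ?R)\<bar> \<le> C / (1 + s * ?R)\<^sup>2"
        using s R[of "(c, Q)"] by (intro C) auto
      also have "\<dots> \<le> C / (1 + s * Q)\<^sup>2"
      proof -
        have "0 < 1 + s * Q" using s Q by (intro add_pos_nonneg) auto
        moreover have "1 + s * Q \<le> 1 + s * ?R" using s RQ by (intro add_left_mono mult_left_mono) auto
        ultimately show ?thesis using C0 by (intro divide_left_mono power_mono mult_pos_pos zero_less_power) auto
      qed
      finally have "\<bar>H (\<xi> + s * b, \<eta> + s * (c - \<eta>), s * ?R)\<bar> \<le> C / (1 + s * Q)\<^sup>2" .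
      moreover have "Q / ?R \<le> 1" using RQ R[of "(c, Q)"] by simp
      ultimately have "(Q / ?R) * \<bar>H (\<xi> + s * b, \<eta> + s * (c - \<eta>), s * ?R)\<bar> \<le> 1 * (C / (1 + s * Q)\<^sup>2)"
        by (intro mult_mono) auto
      then show "norm (?h w) \<le> ?g w"
        using Q R[of "(c, Q)"] by (simp add: sc abs_mult)
    qed
    also have "integral (cbox (0, - a) (1, a)) ?g = integral {0..1} (\<lambda>s. 2 * a * C * (1 / (1 + s * Q)\<^sup>2))"
      using integral_prod_continuous[OF cg] a by (simp add: mult.commute)
    also have "\<dots> = 2 * a * C / (1 + Q)"
      unfolding integral_mult_right integral_inverse_square[OF Q] by simp
    finally show ?thesis unfolding lid_def by simp
  qed
  have "((\<lambda>Q. 2 * a * C / (1 + Q)) \<longlongrightarrow> 0) at_top"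
    by (intro tendsto_divide_0[OF tendsto_const] filterlim_at_top_imp_at_infinity
        filterlim_tendsto_add_at_top[OF tendsto_const filterlim_ident])
  then show ?thesis
    by (rule Lim_null_comparison[rotated])
      (use bound in \<open>auto intro: eventually_mono[OF eventually_ge_at_top[of 0]]\<close>)
qed

section \<open>Solid angles of the walls\<close>

lemma inverse_rad_cube_antiderivative:
  assumes b: "b \<noteq> 0"
  shows "((\<lambda>q. q / ((b\<^sup>2 + (c - \<eta>)\<^sup>2) * rad b \<eta> (c, q))) has_real_derivative 1 / rad b \<eta> (c, q) ^ 3) (at q within S)"
proof -
  let ?R = "rad b \<eta> (c, q)" and ?m = "b\<^sup>2 + (c - \<eta>)\<^sup>2"
  have m: "?m > 0" using b by (intro add_pos_nonneg) auto
  have R: "0 < ?R" using b by (rule rad_pos)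
  have gen: "k * k / r / ((k * r) * (k * r)) = 1 / r ^ 3" if "k \<noteq> 0" "r \<noteq> 0" for k r :: real
    using that by (simp add: field_simps power3_eq_cube)
  have "(1 * (?m * ?R) - q * (?m * (q / ?R))) / ((?m * ?R) * (?m * ?R)) = ?m * (?R\<^sup>2 - q\<^sup>2) / ?R / ((?m * ?R) * (?m * ?R))"
    using R by (simp add: field_simps power2_eq_square)
  also have "?R\<^sup>2 - q\<^sup>2 = ?m" by (simp add: rad_sq)
  also have "?m * ?m / ?R / ((?m * ?R) * (?m * ?R)) = 1 / ?R ^ 3"
    by (rule gen) (use m R in auto)
  finally have eq: "(1 * (?m * ?R) - q * (?m * (q / ?R))) / ((?m * ?R) * (?m * ?R)) = 1 / ?R ^ 3" .
  have "((\<lambda>q. q / (?m * rad b \<eta> (c, q))) has_real_derivative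
      (1 * (?m * ?R) - q * (?m * (q / ?R))) / ((?m * ?R) * (?m * ?R))) (at q within S)"
    by (intro DERIV_divide DERIV_ident DERIV_cmult rad_deriv_snd b) (use m R in auto)
  then show ?thesis unfolding eq .
qed

lemma integral_inverse_rad_cube:
  assumes b: "b \<noteq> 0" and Q: "0 \<le> Q"
  shows "integral {0..Q} (\<lambda>q. 1 / rad b \<eta> (c, q) ^ 3) = Q / ((b\<^sup>2 + (c - \<eta>)\<^sup>2) * rad b \<eta> (c, Q))"
proof -
  let ?m = "b\<^sup>2 + (c - \<eta>)\<^sup>2"
  have "((\<lambda>q. 1 / rad b \<eta> (c, q) ^ 3) has_integral Q / (?m * rad b \<eta> (c, Q)) - 0 / (?m * rad b \<eta> (c, 0))) {0..Q}"
    using inverse_rad_cube_antiderivative[OF b] Q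
    by (intro fundamental_theorem_of_calculus[where f="\<lambda>q. q / (?m * rad b \<eta> (c, q))"])
      (simp_all only: has_real_derivative_iff_has_vector_derivative)
  then show ?thesis by (simp add: integral_unique)
qed

lemma continuous_on_inverse_rad_cube:
  assumes b: "b \<noteq> 0"
  shows "continuous_on S (\<lambda>v. 1 / rad b \<eta> v ^ 3)"
  by (intro continuous_intros) (use rad_pos[OF b] in \<open>simp add: less_imp_neq[symmetric]\<close>)

text \<open>The classical arctangent formula for the solid angle of a rectangle: integration in
  \<open>q\<close> is elementary, and what is left is the derivative of one arctangent in the
  position on the face.\<close>

lemma angle_eq_arctan:
  assumes b: "b \<noteq> 0" and Q: "0 \<le> Q" and a: "0 \<le> a"
  shows "angle a Q b \<eta> = arctan ((a - \<eta>) * Q / (b * rad b \<eta> (a, Q))) - arctan ((- a - \<eta>) * Q / (b * rad b \<eta> (- a, Q)))"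
proof -
  have R: "0 < rad b \<eta> v" for v using b by (rule rad_pos)
  have "angle a Q b \<eta> = b * integral (cbox (- a, 0) (a, Q)) (\<lambda>v. 1 / rad b \<eta> v ^ 3)"
    unfolding angle_def by (subst integral_mult_right[symmetric]) simp
  also have "integral (cbox (- a, 0) (a, Q)) (\<lambda>v. 1 / rad b \<eta> v ^ 3)
      = integral {- a..a} (\<lambda>c. Q / ((b\<^sup>2 + (c - \<eta>)\<^sup>2) * rad b \<eta> (c, Q)))"
    using integral_prod_continuous[OF continuous_on_inverse_rad_cube[OF b]]
    by (simp add: integral_inverse_rad_cube[OF b Q])
  also have "b * integral {- a..a} (\<lambda>c. Q / ((b\<^sup>2 + (c - \<eta>)\<^sup>2) * rad b \<eta> (c, Q)))
     = integral {- a..a} (\<lambda>c. b * (Q / ((b\<^sup>2 + (c - \<eta>)\<^sup>2) * rad b \<eta> (c, Q))))"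
    by (simp only: integral_mult_right)
  also have "\<dots> = arctan ((a - \<eta>) * Q / (b * rad b \<eta> (a, Q))) - arctan ((- a - \<eta>) * Q / (b * rad b \<eta> (- a, Q)))"
  proof (rule integral_unique, rule fundamental_theorem_of_calculus)
    fix c
    let ?R = "rad b \<eta> (c, Q)" and ?z = "c - \<eta>"
    let ?m = "b\<^sup>2 + ?z\<^sup>2"
    have m: "?m > 0" using b by (intro add_pos_nonneg) auto
    have mQ: "b\<^sup>2 + Q\<^sup>2 > 0" using b by (intro add_pos_nonneg) auto
    have Rc: "?R > 0" by (rule R)
    have Rsq: "?R\<^sup>2 = ?m + Q\<^sup>2" by (simp add: rad_sq)
    have "((\<lambda>c. (c - \<eta>) * Q / (b * rad b \<eta> (c, Q))) has_real_derivative
        ((1 - 0) * Q * (b * ?R) - ?z * Q * (b * (?z / ?R))) / ((b * ?R) * (b * ?R))) (at c within {- a..a})"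
      by (intro DERIV_divide DERIV_cmult_right DERIV_diff DERIV_ident DERIV_const DERIV_cmult rad_deriv_fst b)
        (use b Rc in auto)
    moreover have "((1 - 0) * Q * (b * ?R) - ?z * Q * (b * (?z / ?R))) / ((b * ?R) * (b * ?R)) = Q * (b\<^sup>2 + Q\<^sup>2) / (b * ?R ^ 3)"
    proof -
      have "((1 - 0) * Q * (b * ?R) - ?z * Q * (b * (?z / ?R))) / ((b * ?R) * (b * ?R)) = Q * b * (?R\<^sup>2 - ?z\<^sup>2) / ?R / ((b * ?R) * (b * ?R))"
        using Rc by (simp add: field_simps power2_eq_square)
      also have "?R\<^sup>2 - ?z\<^sup>2 = b\<^sup>2 + Q\<^sup>2" unfolding Rsq by simp
      finally show ?thesis using b Rc by (simp add: power3_eq_cube)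
    qed
    ultimately have d: "((\<lambda>c. (c - \<eta>) * Q / (b * rad b \<eta> (c, Q))) has_real_derivative Q * (b\<^sup>2 + Q\<^sup>2) / (b * ?R ^ 3)) (at c within {- a..a})"
      by simp
    have e: "inverse (1 + (?z * Q / (b * ?R))\<^sup>2) * (Q * (b\<^sup>2 + Q\<^sup>2) / (b * ?R ^ 3)) = b * (Q / (?m * ?R))"
    proof -
      have "1 + (?z * Q / (b * ?R))\<^sup>2 = (b\<^sup>2 * ?R\<^sup>2 + ?z\<^sup>2 * Q\<^sup>2) / (b\<^sup>2 * ?R\<^sup>2)"
        using b Rc by (simp add: power_divide power_mult_distrib add_divide_distrib)
      also have "b\<^sup>2 * ?R\<^sup>2 + ?z\<^sup>2 * Q\<^sup>2 = ?m * (b\<^sup>2 + Q\<^sup>2)"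
        unfolding Rsq by (simp add: algebra_simps)
      finally have "1 + (?z * Q / (b * ?R))\<^sup>2 = ?m * (b\<^sup>2 + Q\<^sup>2) / (b\<^sup>2 * ?R\<^sup>2)" .
      then have "inverse (1 + (?z * Q / (b * ?R))\<^sup>2) * (Q * (b\<^sup>2 + Q\<^sup>2) / (b * ?R ^ 3)) = (b\<^sup>2 * ?R\<^sup>2) / (?m * (b\<^sup>2 + Q\<^sup>2)) * (Q * (b\<^sup>2 + Q\<^sup>2) / (b * ?R ^ 3))"
        by simp
      also have "\<dots> = b * (Q / (?m * ?R))"
        using b Rc m mQ by (simp add: power2_eq_square[of b] power2_eq_square[of ?R] power3_eq_cube del: zero_less_power2)
      finally show ?thesis .
    qed
    show "((\<lambda>c. arctan ((c - \<eta>) * Q / (b * rad b \<eta> (c, Q)))) has_vector_derivative b * (Q / (?m * ?R))) (at c within {- a..a})"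
      unfolding has_real_derivative_iff_has_vector_derivative[symmetric]
      using DERIV_chain2[OF DERIV_arctan d] unfolding e .
  qed (use a in auto)
  finally show ?thesis .
qed

lemma ratio_tendsto_1: "((\<lambda>Q. Q / rad b \<eta> (c, Q)) \<longlongrightarrow> 1) at_top"
proof -
  let ?m = "b\<^sup>2 + (c - \<eta>)\<^sup>2"
  have "((\<lambda>Q. 1 / sqrt (?m / Q\<^sup>2 + 1)) \<longlongrightarrow> 1 / sqrt (0 + 1)) at_top"
    by (intro tendsto_intros tendsto_divide_0[OF tendsto_const] filterlim_at_top_imp_at_infinity
        filterlim_pow_at_top filterlim_ident) auto
  moreover have "\<forall>\<^sub>F Q in at_top. 1 / sqrt (?m / Q\<^sup>2 + 1) = Q / rad b \<eta> (c, Q)"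
  proof (rule eventually_mono[OF eventually_gt_at_top[of 0]])
    fix Q :: real assume Q: "0 < Q"
    have "?m / Q\<^sup>2 + 1 = (?m + Q\<^sup>2) / Q\<^sup>2" using Q by (simp add: add_divide_distrib)
    then have "sqrt (?m / Q\<^sup>2 + 1) = rad b \<eta> (c, Q) / Q" using Q by (simp add: rad_def real_sqrt_divide)
    then show "1 / sqrt (?m / Q\<^sup>2 + 1) = Q / rad b \<eta> (c, Q)" by simp
  qed
  ultimately show ?thesis by (auto elim: tendsto_cong[THEN iffD1, rotated])
qed

text \<open>As the wall grows to a half strip, its solid angle becomes the plane angle under which
  the side is seen from the source.\<close>

lemma angle_tendsto:
  assumes b: "b \<noteq> 0" and a: "0 \<le> a"
  shows "((\<lambda>Q. angle a Q b \<eta>) \<longlongrightarrow> arctan ((a - \<eta>) / b) - arctan ((- a - \<eta>) / b)) at_top"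
proof -
  have "((\<lambda>Q. arctan ((a - \<eta>) / b * (Q / rad b \<eta> (a, Q))) - arctan ((- a - \<eta>) / b * (Q / rad b \<eta> (- a, Q))))
      \<longlongrightarrow> arctan ((a - \<eta>) / b * 1) - arctan ((- a - \<eta>) / b * 1)) at_top"
    by (intro tendsto_intros ratio_tendsto_1)
  moreover have "\<forall>\<^sub>F Q in at_top. arctan ((a - \<eta>) / b * (Q / rad b \<eta> (a, Q))) - arctan ((- a - \<eta>) / b * (Q / rad b \<eta> (- a, Q))) = angle a Q b \<eta>"
    by (rule eventually_mono[OF eventually_ge_at_top[of 0]]) (simp add: angle_eq_arctan[OF b _ a])
  ultimately show ?thesis by (auto elim: tendsto_cong[THEN iffD1, rotated])
qed

text \<open>Seen from an interior point, every corner gives two complementary angles, the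
  arctangents of a ratio and of its inverse. The four corners add up to a full turn.\<close>

lemma angles_tendsto:
  assumes "\<bar>\<xi>\<bar> < a" "\<bar>\<eta>\<bar> < a"
  shows "((\<lambda>Q. angles a Q \<xi> \<eta>) \<longlongrightarrow> 2 * pi) at_top"
proof -
  have p: "0 < a - \<xi>" "0 < a + \<xi>" "0 < a - \<eta>" "0 < a + \<eta>" and a: "0 \<le> a" using assms by auto
  have inv: "arctan (x / y) + arctan (y / x) = pi / 2" if "0 < x" "0 < y" for x y
    using arctan_inverse[of "y / x"] that by (simp add: sgn_if field_simps)
  have neg: "(- a - \<eta>) / z = - ((a + \<eta>) / z)" "(- a - \<xi>) / z = - ((a + \<xi>) / z)" "z / (- a - \<xi>) = - (z / (a + \<xi>))"
     "z / (- a - \<eta>) = - (z / (a + \<eta>))" for z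
    by (metis minus_divide_left minus_add_distrib uminus_add_conv_diff diff_conv_add_uminus add.commute minus_divide_right)+
  have "((\<lambda>Q. angles a Q \<xi> \<eta>) \<longlongrightarrow> (arctan ((a - \<eta>) / (a - \<xi>)) - arctan ((- a - \<eta>) / (a - \<xi>)))
     - (arctan ((a - \<eta>) / (- a - \<xi>)) - arctan ((- a - \<eta>) / (- a - \<xi>)))
     + (arctan ((a - \<xi>) / (a - \<eta>)) - arctan ((- a - \<xi>) / (a - \<eta>)))
     - (arctan ((a - \<xi>) / (- a - \<eta>)) - arctan ((- a - \<xi>) / (- a - \<eta>)))) at_top"
    unfolding angles_def by (intro tendsto_intros angle_tendsto a) (use p in auto)
  also have "(arctan ((a - \<eta>) / (a - \<xi>)) - arctan ((- a - \<eta>) / (a - \<xi>)))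
     - (arctan ((a - \<eta>) / (- a - \<xi>)) - arctan ((- a - \<eta>) / (- a - \<xi>)))
     + (arctan ((a - \<xi>) / (a - \<eta>)) - arctan ((- a - \<xi>) / (a - \<eta>)))
     - (arctan ((a - \<xi>) / (- a - \<eta>)) - arctan ((- a - \<xi>) / (- a - \<eta>))) = 2 * pi"
    unfolding neg arctan_minus
    using inv[OF p(1) p(3)] inv[OF p(1) p(4)] inv[OF p(2) p(3)] inv[OF p(2) p(4)] by simp
  finally show ?thesis .
qed

context wave begin

text \<open>At an exterior source \<open>f\<close> vanishes, and the solid angle term is zero at
  every height; at an interior one the solid angles fill up to \<open>2 * pi\<close>. The lids
  vanish in either case.\<close>

lemma flux_tendsto:
  assumes a: "0 \<le> a" and b: "a - \<xi> \<noteq> 0" "- a - \<xi> \<noteq> 0" "a - \<eta> \<noteq> 0" "- a - \<eta> \<noteq> 0"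
    and f: "f (\<xi>, \<eta>) = 0 \<or> (\<bar>\<xi>\<bar> < a \<and> \<bar>\<eta>\<bar> < a)"
  shows "((\<lambda>Q. flux a Q \<xi> \<eta> utt ut ut1 ut2 1) \<longlongrightarrow> - 2 * pi * f (\<xi>, \<eta>)) at_top"
proof -
  have c: "continuous_on UNIV ut1" "continuous_on UNIV (swap3 ut2)"
    using continuous_u continuous_swap3 by auto
  have b1: "\<exists>C\<ge>0. \<forall>x y t. \<bar>x\<bar> \<le> L \<longrightarrow> \<bar>y\<bar> \<le> L \<longrightarrow> 0 \<le> t \<longrightarrow> \<bar>ut1 (x, y, t)\<bar> \<le> C / (1 + t)\<^sup>2" for L
    by (rule gradient_decay[of ut1 L]) auto
  have b2: "\<exists>C\<ge>0. \<forall>x y t. \<bar>x\<bar> \<le> L \<longrightarrow> \<bar>y\<bar> \<le> L \<longrightarrow> 0 \<le> t \<longrightarrow> \<bar>swap3 ut2 (x, y, t)\<bar> \<le> C / (1 + t)\<^sup>2" for L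
    by (rule gradient_decay[of ut2 L]) (auto simp: swap3_def)
  have "((\<lambda>Q. lids a Q \<xi> \<eta> ut1 ut2) \<longlongrightarrow> 0 - 0 + 0 - 0) at_top"
    unfolding lids_def by (intro tendsto_intros lid_tendsto_0 c a b b1 b2)
  moreover have "((\<lambda>Q. - f (\<xi>, \<eta>) * angles a Q \<xi> \<eta>) \<longlongrightarrow> - f (\<xi>, \<eta>) * (2 * pi)) at_top"
    using f
  proof
    assume "\<bar>\<xi>\<bar> < a \<and> \<bar>\<eta>\<bar> < a"
    then show ?thesis by (intro tendsto_intros angles_tendsto) auto
  qed simp
  ultimately have "((\<lambda>Q. - f (\<xi>, \<eta>) * angles a Q \<xi> \<eta> - lids a Q \<xi> \<eta> ut1 ut2) \<longlongrightarrow> - f (\<xi>, \<eta>) * (2 * pi) - (0 - 0 + 0 - 0)) at_top"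
    by (rule tendsto_diff[rotated])
  moreover have "\<forall>\<^sub>F Q in at_top. - f (\<xi>, \<eta>) * angles a Q \<xi> \<eta> - lids a Q \<xi> \<eta> ut1 ut2 = flux a Q \<xi> \<eta> utt ut ut1 ut2 1"
    by (rule eventually_mono[OF eventually_ge_at_top[of 0]]) (simp add: flux_identity_ut[OF a _ b])
  ultimately show ?thesis by (auto elim: tendsto_cong[THEN iffD1, rotated] simp: mult.commute)
qed

end

section \<open>Mirror images\<close>

text \<open>If \<open>F\<close> is the time derivative of \<open>G\<close>, the bracket is the
  derivative of \<open>G / r\<close> at the distance \<open>r = R\<close>, the quantity in the
  reconstruction formula. In contrast to \<open>face\<close>, the wall \<open>\<beta>\<close> is an
  absolute coordinate here, so that the source can move while the data stay.\<close>

definition dkern where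
  "dkern \<beta> \<xi> \<eta> F G v = (\<beta> - \<xi>) * (F (\<beta>, fst v, rad (\<beta> - \<xi>) \<eta> v) / rad (\<beta> - \<xi>) \<eta> v
     - G (\<beta>, fst v, rad (\<beta> - \<xi>) \<eta> v) / rad (\<beta> - \<xi>) \<eta> v ^ 2) / rad (\<beta> - \<xi>) \<eta> v"

definition dface where
  "dface a Q \<beta> \<xi> \<eta> F G = integral (cbox (- a, 0) (a, Q)) (dkern \<beta> \<xi> \<eta> F G)"

definition nface where
  "nface a Q \<beta> \<xi> \<eta> H = integral (cbox (- a, 0) (a, Q))
     (\<lambda>v. H (\<beta>, fst v, rad (\<beta> - \<xi>) \<eta> v) / rad (\<beta> - \<xi>) \<eta> v)"

definition dline where
  "dline \<beta> \<xi> \<eta> F G c = (LINT q:{0..}|lborel. dkern \<beta> \<xi> \<eta> F G (c, q))"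

text \<open>The orbit of \<open>x\<close> under the group generated by the reflections in
  \<open>a\<close> and \<open>- a\<close>: even indices are translations, an odd \<open>m\<close> is
  the reflection in \<open>m * a\<close>. \<open>parity\<close> is the sign character of this
  group.\<close>

definition mirror :: "real \<Rightarrow> real \<Rightarrow> int \<Rightarrow> real" where
  "mirror a x m = (if even m then x else - x) + 2 * of_int m * a"

definition parity :: "int \<Rightarrow> real" where
  "parity m = (if even m then 1 else - 1)"

lemma rad_minus: "rad (- b) \<eta> v = rad b \<eta> v"
  by (simp add: rad_def)

lemma mirror_reflect:
  assumes "\<sigma> \<in> {1, - 1}"
  shows "mirror a x (\<sigma> - m) = 2 * (of_int \<sigma> * a) - mirror a x m" "parity (\<sigma> - m) = - parity m"
  using assms by (auto simp: mirror_def parity_def algebra_simps)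

lemma mirror_ne_side:
  assumes "\<sigma> \<in> {1, - 1 :: int}" "\<bar>x\<bar> < a"
  shows "of_int \<sigma> * a \<noteq> mirror a x m"
proof
  assume "of_int \<sigma> * a = mirror a x m"
  then have "(if even m then x else - x) = (of_int \<sigma> - 2 * of_int m) * a" by (simp add: mirror_def algebra_simps)
  then have "\<bar>x\<bar> = \<bar>(of_int \<sigma> - 2 * of_int m) * a\<bar>" by (metis abs_minus_cancel)
  then have "\<bar>x\<bar> = \<bar>real_of_int (\<sigma> - 2 * m)\<bar> * a" using assms by (simp add: abs_mult)
  \<comment> \<open>An image on the side would make \<open>x\<close> an odd multiple of
    \<open>a\<close> up to sign, and an odd integer has modulus at least 1.\<close>
  moreover have "1 \<le> \<bar>\<sigma> - 2 * m\<bar>" using assms by auto presburger+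
  then have "1 \<le> \<bar>real_of_int (\<sigma> - 2 * m)\<bar>" by linarith
  then have "1 * a \<le> \<bar>real_of_int (\<sigma> - 2 * m)\<bar> * a" using assms by (intro mult_right_mono) auto
  ultimately show False using assms by simp
qed

text \<open>Reflecting the source in the wall keeps its distance to every point of the wall and
  reverses the normal component, which enters the Dirichlet kernel linearly and the Neumann kernel
  not at all.\<close>

lemma dface_reflect: "dface a Q \<beta> (2 * \<beta> - \<xi>) \<eta> F G = - dface a Q \<beta> \<xi> \<eta> F G"
proof -
  have "dkern \<beta> (2 * \<beta> - \<xi>) \<eta> F G v = - dkern \<beta> \<xi> \<eta> F G v" for v
  proof -
    have e: "\<beta> - (2 * \<beta> - \<xi>) = - (\<beta> - \<xi>)" by simp
    show ?thesis unfolding dkern_def e rad_minus by (simp only: mult_minus_left minus_divide_left)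
  qed
  then have "dkern \<beta> (2 * \<beta> - \<xi>) \<eta> F G = (\<lambda>v. - dkern \<beta> \<xi> \<eta> F G v)" by blast
  then show ?thesis unfolding dface_def by simp
qed

lemma nface_reflect: "nface a Q \<beta> (2 * \<beta> - \<xi>) \<eta> H = nface a Q \<beta> \<xi> \<eta> H"
  using rad_minus[of "\<beta> - \<xi>" \<eta>] by (simp add: nface_def)

lemma sum_int_interval_extend:
  fixes v :: "int \<Rightarrow> real"
  assumes "0 \<le> K"
  shows "sum v {- (K + 1)..K + 1} = sum v {- K..K} + v (K + 1) + v (- (K + 1))"
proof -
  have "{- (K + 1)..K + 1} = insert (K + 1) (insert (- (K + 1)) {- K..K})" using assms by auto
  then show ?thesis using assms by simp
qed

text \<open>The involution \<open>m \<mapsto> \<sigma> - m\<close> exchanges even and odd indices,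
  so even ones represent the pairs. It does not preserve the symmetric box: the partner of
  \<open>- (2 * int K * \<sigma>)\<close> falls outside, and this one even index has to be corrected
  for.\<close>

lemma sum_paired:
  fixes v :: "int \<Rightarrow> real"
  assumes \<sigma>: "\<sigma> \<in> {1, - 1}" and v: "\<And>m. v (\<sigma> - m) = e * v m"
  shows "(\<Sum>m\<in>{- (2 * int K)..2 * int K}. v m) = (1 + e) * (\<Sum>k\<in>{- int K..int K}. v (2 * k)) - e * v (- (2 * int K * \<sigma>))"
proof (induction K)
  case (Suc K)
  let ?z = "2 * int K"
  have odd: "v (z + 1) + v (- (z + 1)) = e * (v (- (z * \<sigma>)) + v ((z + 2) * \<sigma>))" for z
  proof -
    consider "\<sigma> = 1" | "\<sigma> = - 1" using \<sigma> by blast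
    then show ?thesis
    proof cases
      case 1
      have "v (z + 1) = v (\<sigma> - - z)" "v (- (z + 1)) = v (\<sigma> - (z + 2))"
        by (rule arg_cong[of _ _ v], simp add: 1)+
      then show ?thesis unfolding v by (simp add: 1 algebra_simps)
    next
      case 2
      have "v (z + 1) = v (\<sigma> - - (z + 2))" "v (- (z + 1)) = v (\<sigma> - z)"
        by (rule arg_cong[of _ _ v], simp add: 2)+
      then show ?thesis unfolding v by (simp add: 2 algebra_simps)
    qed
  qed
  have even: "v z + v (- z) = v (z * \<sigma>) + v (- (z * \<sigma>))" for z using \<sigma> by auto
  have "sum v {- (?z + 1 + 1)..?z + 1 + 1} = sum v {- ?z..?z} + v (?z + 1) + v (- (?z + 1)) + v (?z + 1 + 1) + v (- (?z + 1 + 1))"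
    by (subst sum_int_interval_extend, simp)+ simp
  moreover have z: "?z + 1 + 1 = 2 * int (Suc K)" by simp
  ultimately have A: "sum v {- (2 * int (Suc K))..2 * int (Suc K)} = sum v {- ?z..?z} + (v (?z + 1) + v (- (?z + 1)))
      + (v (2 * int (Suc K)) + v (- (2 * int (Suc K))))"
    by (simp only: add.assoc)
  have "sum (\<lambda>k. v (2 * k)) {- (int K + 1)..int K + 1} = sum (\<lambda>k. v (2 * k)) {- int K..int K} + v (2 * (int K + 1)) + v (2 * (- (int K + 1)))"
    by (rule sum_int_interval_extend) simp
  moreover have "int K + 1 = int (Suc K)" "2 * (- int (Suc K)) = - (2 * int (Suc K))" by simp_all
  ultimately have B: "(\<Sum>k\<in>{- int (Suc K)..int (Suc K)}. v (2 * k)) = (\<Sum>k\<in>{- int K..int K}. v (2 * k)) + v (2 * int (Suc K)) + v (- (2 * int (Suc K)))"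
    by (simp only:)
  have z2: "?z + 2 = 2 * int (Suc K)" by simp
  show ?case
    using Suc.IH odd[of ?z] even[of "2 * int (Suc K)"] unfolding A B z2 by algebra
qed (simp add: algebra_simps)

section \<open>Estimates for the terms of one side\<close>

lemma inverse_rad_cube_integrable:
  assumes b: "b \<noteq> 0"
  shows "set_integrable lborel {0..} (\<lambda>q. 1 / rad b \<eta> (c, q) ^ 3)"
    and "(LINT q:{0..}|lborel. 1 / rad b \<eta> (c, q) ^ 3) = 1 / (b\<^sup>2 + (c - \<eta>)\<^sup>2)"
proof -
  let ?m = "b\<^sup>2 + (c - \<eta>)\<^sup>2"
  have m: "?m > 0" using b by (intro add_pos_nonneg) auto
  have R: "0 < rad b \<eta> v" for v using b by (rule rad_pos)
  have "((\<lambda>q. 1 / ?m * (q / rad b \<eta> (c, q))) \<longlongrightarrow> 1 / ?m * 1) at_top"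
    by (intro tendsto_intros ratio_tendsto_1)
  then have lim: "((\<lambda>q. q / (?m * rad b \<eta> (c, q))) \<longlongrightarrow> 1 / ?m) at_top" by simp
  have nn: "(\<integral>\<^sup>+q. ennreal (1 / rad b \<eta> (c, q) ^ 3) * indicator {0..} q \<partial>lborel) = ennreal (1 / ?m - 0 / (?m * rad b \<eta> (c, 0)))"
  proof (rule nn_integral_FTC_atLeast[OF _ inverse_rad_cube_antiderivative[OF b] _ lim])
    show "(\<lambda>q. 1 / rad b \<eta> (c, q) ^ 3) \<in> borel_measurable borel"
      unfolding rad_def fst_conv snd_conv by measurable
    show "0 \<le> 1 / rad b \<eta> (c, q) ^ 3" for q using R[of "(c, q)"] by simp
  qed
  have hb: "has_bochner_integral lborel (\<lambda>q. indicator {0..} q *\<^sub>R (1 / rad b \<eta> (c, q) ^ 3)) (1 / ?m)"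
  proof (rule has_bochner_integral_nn_integral)
    show "(\<lambda>q. indicator {0..} q *\<^sub>R (1 / rad b \<eta> (c, q) ^ 3)) \<in> borel_measurable lborel"
      unfolding rad_def fst_conv snd_conv by measurable
    show "AE q in lborel. 0 \<le> indicator {0..} q *\<^sub>R (1 / rad b \<eta> (c, q) ^ 3)"
      using R by (auto simp: indicator_def intro!: AE_I2 less_imp_le)
    have "(\<integral>\<^sup>+q. ennreal (indicator {0..} q *\<^sub>R (1 / rad b \<eta> (c, q) ^ 3)) \<partial>lborel) = (\<integral>\<^sup>+q. ennreal (1 / rad b \<eta> (c, q) ^ 3) * indicator {0..} q \<partial>lborel)"
      by (intro nn_integral_cong) (simp add: indicator_def)
    then show "(\<integral>\<^sup>+q. ennreal (indicator {0..} q *\<^sub>R (1 / rad b \<eta> (c, q) ^ 3)) \<partial>lborel) = ennreal (1 / ?m)"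
      using nn by simp
  qed (use m in simp)
  show "set_integrable lborel {0..} (\<lambda>q. 1 / rad b \<eta> (c, q) ^ 3)"
    using hb unfolding set_integrable_def by (rule integrable.intros)
  show "(LINT q:{0..}|lborel. 1 / rad b \<eta> (c, q) ^ 3) = 1 / ?m"
    using hb unfolding set_lebesgue_integral_def by (rule has_bochner_integral_integral_eq)
qed

text \<open>The wave near two opposite sides, in coordinates in which these are perpendicular to the
  first axis: \<open>G\<close> is the wave, \<open>F\<close> its time derivative, \<open>H\<close>
  its normal derivative. The bounds are those of \<open>decays_wave\<close> with one common
  constant.\<close>

locale side_data =
  fixes a C :: real and F G H :: "real \<times> real \<times> real \<Rightarrow> real"
  assumes a: "0 < a" and cF: "continuous_on UNIV F" and cG: "continuous_on UNIV G" and cH: "continuous_on UNIV H"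
    and bF: "\<And>\<beta> c t. \<bar>\<beta>\<bar> \<le> a \<Longrightarrow> \<bar>c\<bar> \<le> a \<Longrightarrow> 0 < t \<Longrightarrow> t ^ 3 * \<bar>F (\<beta>, c, t)\<bar> \<le> C"
    and bG: "\<And>\<beta> c t. \<bar>\<beta>\<bar> \<le> a \<Longrightarrow> \<bar>c\<bar> \<le> a \<Longrightarrow> 0 < t \<Longrightarrow> t ^ 2 * \<bar>G (\<beta>, c, t)\<bar> \<le> C"
    and bH: "\<And>\<beta> c t. \<bar>\<beta>\<bar> \<le> a \<Longrightarrow> \<bar>c\<bar> \<le> a \<Longrightarrow> 0 < t \<Longrightarrow> t ^ 2 * \<bar>H (\<beta>, c, t)\<bar> \<le> C"
begin

lemma C_nonneg: "0 \<le> C"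
  using bG[of 0 0 1] a by auto

lemma continuous_on_dkern [continuous_intros]:
  assumes "\<beta> \<noteq> \<xi>" "continuous_on S g"
  shows "continuous_on S (\<lambda>x. dkern \<beta> \<xi> \<eta> F G (g x))"
proof -
  have R0: "rad (\<beta> - \<xi>) \<eta> v \<noteq> 0" for v using rad_pos[of "\<beta> - \<xi>" \<eta> v] assms by simp
  show ?thesis
    unfolding dkern_def
    by (intro continuous_intros continuous_on_compose2[OF cF] continuous_on_compose2[OF cG] assms ballI)
      (simp_all add: R0)
qed

lemma continuous_on_nkern:
  assumes "\<beta> \<noteq> \<xi>"
  shows "continuous_on S (\<lambda>v. H (\<beta>, fst v, rad (\<beta> - \<xi>) \<eta> v) / rad (\<beta> - \<xi>) \<eta> v)"
proof -
  have R0: "rad (\<beta> - \<xi>) \<eta> v \<noteq> 0" for v using rad_pos[of "\<beta> - \<xi>" \<eta> v] assms by simp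
  show ?thesis
    by (intro continuous_intros continuous_on_compose2[OF cH] assms ballI) (simp_all add: R0)
qed

lemma face_eq_dface_nface:
  assumes "\<beta> \<noteq> \<xi>"
  shows "face a Q (\<beta> - \<xi>) \<xi> \<eta> F G H 1 = dface a Q \<beta> \<xi> \<eta> F G - nface a Q \<beta> \<xi> \<eta> H"
proof -
  have R0: "rad (\<beta> - \<xi>) \<eta> v \<noteq> 0" for v using rad_pos[of "\<beta> - \<xi>" \<eta> v] assms by simp
  have "dface a Q \<beta> \<xi> \<eta> F G - nface a Q \<beta> \<xi> \<eta> H = integral (cbox (- a, 0) (a, Q))
      (\<lambda>v. dkern \<beta> \<xi> \<eta> F G v - H (\<beta>, fst v, rad (\<beta> - \<xi>) \<eta> v) / rad (\<beta> - \<xi>) \<eta> v)"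
    unfolding dface_def nface_def
    by (intro integral_diff[symmetric] integrable_continuous continuous_on_nkern assms continuous_on_dkern continuous_on_id)
  also have "(\<lambda>v. dkern \<beta> \<xi> \<eta> F G v - H (\<beta>, fst v, rad (\<beta> - \<xi>) \<eta> v) / rad (\<beta> - \<xi>) \<eta> v)
     = (\<lambda>v. 1 * F (pos3 (\<beta> - \<xi>) \<xi> \<eta> 1 v) * (\<beta> - \<xi>) / rad (\<beta> - \<xi>) \<eta> v ^ 2
        - G (pos3 (\<beta> - \<xi>) \<xi> \<eta> 1 v) * (\<beta> - \<xi>) / rad (\<beta> - \<xi>) \<eta> v ^ 3
        - 1 * H (pos3 (\<beta> - \<xi>) \<xi> \<eta> 1 v) / rad (\<beta> - \<xi>) \<eta> v)"
  proof
    fix v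
    have gen: "b * (x / r - y / r ^ 2) / r - z / r = 1 * x * b / r ^ 2 - y * b / r ^ 3 - 1 * z / r" if "r \<noteq> 0" for b x y z r :: real
      using that by (simp add: field_simps power2_eq_square power3_eq_cube)
    have p: "pos3 (\<beta> - \<xi>) \<xi> \<eta> 1 v = (\<beta>, fst v, rad (\<beta> - \<xi>) \<eta> v)" by simp
    show "dkern \<beta> \<xi> \<eta> F G v - H (\<beta>, fst v, rad (\<beta> - \<xi>) \<eta> v) / rad (\<beta> - \<xi>) \<eta> v
     = 1 * F (pos3 (\<beta> - \<xi>) \<xi> \<eta> 1 v) * (\<beta> - \<xi>) / rad (\<beta> - \<xi>) \<eta> v ^ 2
        - G (pos3 (\<beta> - \<xi>) \<xi> \<eta> 1 v) * (\<beta> - \<xi>) / rad (\<beta> - \<xi>) \<eta> v ^ 3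
        - 1 * H (pos3 (\<beta> - \<xi>) \<xi> \<eta> 1 v) / rad (\<beta> - \<xi>) \<eta> v"
      unfolding p dkern_def by (rule gen[OF R0])
  qed
  finally show ?thesis unfolding face_def by simp
qed

text \<open>The decay yields the fifth inverse power of the distance. Two powers are traded for a
  factor constant in \<open>q\<close>; three are kept because their integral over \<open>q\<close>
  is explicit.\<close>

lemma dkern_bound:
  assumes "\<beta> \<noteq> \<xi>" "\<bar>\<beta>\<bar> \<le> a" "\<bar>c\<bar> \<le> a"
  shows "\<bar>dkern \<beta> \<xi> \<eta> F G (c, q)\<bar> \<le> 2 * C * \<bar>\<beta> - \<xi>\<bar> / ((\<beta> - \<xi>)\<^sup>2 + (c - \<eta>)\<^sup>2) * (1 / rad (\<beta> - \<xi>) \<eta> (c, q) ^ 3)"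
proof -
  let ?R = "rad (\<beta> - \<xi>) \<eta> (c, q)" and ?b = "\<beta> - \<xi>"
  have R: "0 < ?R" using assms by (intro rad_pos) simp
  have m: "0 < ?b\<^sup>2 + (c - \<eta>)\<^sup>2" using assms by (intro add_pos_nonneg) auto
  have "x / r \<le> C / r ^ 4" if "r ^ 3 * x \<le> C" "0 < r" for x r :: real
  proof -
    have "x / r = r ^ 3 * x / r ^ 4" using that by (simp add: field_simps eval_nat_numeral)
    also have "\<dots> \<le> C / r ^ 4" using that by (intro divide_right_mono) auto
    finally show ?thesis .
  qed
  moreover have "x / r ^ 2 \<le> C / r ^ 4" if "r ^ 2 * x \<le> C" "0 < r" for x r :: real
  proof -
    have "x / r ^ 2 = r ^ 2 * x / r ^ 4" using that by (simp add: field_simps eval_nat_numeral)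
    also have "\<dots> \<le> C / r ^ 4" using that by (intro divide_right_mono) auto
    finally show ?thesis .
  qed
  ultimately have FG: "\<bar>F (\<beta>, c, ?R)\<bar> / ?R \<le> C / ?R ^ 4" "\<bar>G (\<beta>, c, ?R)\<bar> / ?R ^ 2 \<le> C / ?R ^ 4"
    using bF[OF assms(2,3) R] bG[OF assms(2,3) R] R by blast+
  have 1: "\<bar>F (\<beta>, c, ?R) / ?R - G (\<beta>, c, ?R) / ?R ^ 2\<bar> \<le> 2 * C / ?R ^ 4"
  proof -
    have "\<bar>F (\<beta>, c, ?R) / ?R\<bar> = \<bar>F (\<beta>, c, ?R)\<bar> / ?R" "\<bar>G (\<beta>, c, ?R) / ?R ^ 2\<bar> = \<bar>G (\<beta>, c, ?R)\<bar> / ?R ^ 2"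
      using R by (simp_all only: abs_divide abs_power2 abs_of_pos)
    then show ?thesis
      using abs_triangle_ineq4[of "F (\<beta>, c, ?R) / ?R" "G (\<beta>, c, ?R) / ?R ^ 2"] FG by argo
  qed
  have "\<bar>dkern \<beta> \<xi> \<eta> F G (c, q)\<bar> = \<bar>?b\<bar> * \<bar>F (\<beta>, c, ?R) / ?R - G (\<beta>, c, ?R) / ?R ^ 2\<bar> / ?R"
    using R by (simp add: dkern_def abs_mult)
  also have "\<dots> \<le> \<bar>?b\<bar> * (2 * C / ?R ^ 4) / ?R"
    using 1 R by (intro divide_right_mono mult_left_mono) auto
  also have "\<dots> = 2 * C * \<bar>?b\<bar> / ?R\<^sup>2 * (1 / ?R ^ 3)"
    using R by (simp add: field_simps eval_nat_numeral)
  also have "\<dots> \<le> 2 * C * \<bar>?b\<bar> / (?b\<^sup>2 + (c - \<eta>)\<^sup>2) * (1 / ?R ^ 3)"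
    using R m C_nonneg by (intro mult_right_mono divide_left_mono) (auto simp: rad_sq intro!: mult_pos_pos add_pos_nonneg)
  finally show ?thesis .
qed

lemma integral_inverse_rad_cube_le:
  assumes b: "b \<noteq> 0" and Q: "0 \<le> Q"
  shows "integral (cbox (- a, 0) (a, Q)) (\<lambda>v. 1 / rad b \<eta> v ^ 3) \<le> 2 * a / b\<^sup>2"
proof -
  have "integral (cbox (- a, 0) (a, Q)) (\<lambda>v. 1 / rad b \<eta> v ^ 3)
      = integral (cbox (- a) a) (\<lambda>c. integral (cbox 0 Q) (\<lambda>q. 1 / rad b \<eta> (c, q) ^ 3))"
    by (rule integral_prod_continuous[OF continuous_on_inverse_rad_cube[OF b]])
  also have "\<dots> \<le> integral (cbox (- a) a) (\<lambda>c. 1 / b\<^sup>2)"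
  proof (rule integral_le)
    show "(\<lambda>c. integral (cbox 0 Q) (\<lambda>q. 1 / rad b \<eta> (c, q) ^ 3)) integrable_on cbox (- a) a"
      by (intro integrable_continuous integral_continuous_on_param)
        (use continuous_on_inverse_rad_cube[OF b] in \<open>simp add: split_beta\<close>)
    fix c
    have R: "0 < rad b \<eta> (c, Q)" by (rule rad_pos[OF b])
    have "integral (cbox 0 Q) (\<lambda>q. 1 / rad b \<eta> (c, q) ^ 3) = 1 / (b\<^sup>2 + (c - \<eta>)\<^sup>2) * (Q / rad b \<eta> (c, Q))"
      using integral_inverse_rad_cube[OF b Q] by simp
    also have "\<dots> \<le> 1 / b\<^sup>2 * 1"
      using b Q R snd_le_rad[of "(c, Q)" b \<eta>]
      by (intro mult_mono divide_left_mono) (auto intro!: mult_pos_pos add_pos_nonneg)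
    finally show "integral (cbox 0 Q) (\<lambda>q. 1 / rad b \<eta> (c, q) ^ 3) \<le> 1 / b\<^sup>2" by simp
  qed auto
  also have "\<dots> = 2 * a / b\<^sup>2" using a by simp
  finally show ?thesis .
qed

lemma faces_bound:
  assumes b: "1 \<le> \<bar>\<beta> - \<xi>\<bar>" and \<beta>: "\<bar>\<beta>\<bar> \<le> a" and Q: "0 \<le> Q"
  shows "\<bar>dface a Q \<beta> \<xi> \<eta> F G\<bar> \<le> 4 * a * C / (\<beta> - \<xi>)\<^sup>2" "\<bar>nface a Q \<beta> \<xi> \<eta> H\<bar> \<le> 2 * a * C / (\<beta> - \<xi>)\<^sup>2"
proof -
  let ?R = "rad (\<beta> - \<xi>) \<eta>" and ?b = "\<beta> - \<xi>"
  have ne: "\<beta> \<noteq> \<xi>" "?b \<noteq> 0" using b by auto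
  have R: "0 < ?R v" for v by (rule rad_pos[OF ne(2)])
  have i: "(\<lambda>v. K * (1 / ?R v ^ 3)) integrable_on cbox (- a, 0) (a, Q)" for K
    by (intro integrable_continuous continuous_intros continuous_on_inverse_rad_cube[OF ne(2)])
  have "norm (dface a Q \<beta> \<xi> \<eta> F G) \<le> integral (cbox (- a, 0) (a, Q)) (\<lambda>v. 2 * C * (1 / ?R v ^ 3))"
    unfolding dface_def
  proof (rule integral_norm_bound_integral)
    show "dkern \<beta> \<xi> \<eta> F G integrable_on cbox (- a, 0) (a, Q)"
      by (intro integrable_continuous continuous_on_dkern ne continuous_on_id)
    fix v assume v: "v \<in> cbox (- a, 0) (a, Q)"
    obtain c q where cq: "v = (c, q)" by (cases v)
    have c: "\<bar>c\<bar> \<le> a" using v cq by auto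
    have "\<bar>dkern \<beta> \<xi> \<eta> F G (c, q)\<bar> \<le> 2 * C * \<bar>?b\<bar> / (?b\<^sup>2 + (c - \<eta>)\<^sup>2) * (1 / ?R (c, q) ^ 3)"
      by (rule dkern_bound[OF ne(1) \<beta> c])
    also have "\<dots> \<le> 2 * C * (1 / ?R (c, q) ^ 3)"
    proof (intro mult_right_mono)
      \<comment> \<open>Distance at least 1 from the wall lets the numerator
        \<open>\<bar>?b\<bar>\<close> be absorbed by the square in the denominator.\<close>
      have "\<bar>?b\<bar> * 1 \<le> \<bar>?b\<bar> * \<bar>?b\<bar>" using b by (intro mult_left_mono) auto
      then have "\<bar>?b\<bar> \<le> ?b\<^sup>2 + (c - \<eta>)\<^sup>2" by (simp add: power2_eq_square add_increasing2)
      moreover have "0 < ?b\<^sup>2 + (c - \<eta>)\<^sup>2" using ne by (intro add_pos_nonneg) auto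
      ultimately have "\<bar>?b\<bar> / (?b\<^sup>2 + (c - \<eta>)\<^sup>2) \<le> 1" by simp
      then have "2 * C * (\<bar>?b\<bar> / (?b\<^sup>2 + (c - \<eta>)\<^sup>2)) \<le> 2 * C * 1" using C_nonneg by (intro mult_left_mono) auto
      then show "2 * C * \<bar>?b\<bar> / (?b\<^sup>2 + (c - \<eta>)\<^sup>2) \<le> 2 * C" by simp
    qed (use R[of "(c, q)"] in simp)
    finally show "norm (dkern \<beta> \<xi> \<eta> F G v) \<le> 2 * C * (1 / ?R v ^ 3)" by (simp add: cq)
  qed (rule i)
  also have "\<dots> \<le> 2 * C * (2 * a / ?b\<^sup>2)"
    unfolding integral_mult_right using C_nonneg
    by (intro mult_left_mono integral_inverse_rad_cube_le ne Q) auto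
  finally show "\<bar>dface a Q \<beta> \<xi> \<eta> F G\<bar> \<le> 4 * a * C / ?b\<^sup>2" by (simp add: mult_ac)
  have "norm (nface a Q \<beta> \<xi> \<eta> H) \<le> integral (cbox (- a, 0) (a, Q)) (\<lambda>v. C * (1 / ?R v ^ 3))"
    unfolding nface_def
  proof (rule integral_norm_bound_integral)
    show "(\<lambda>v. H (\<beta>, fst v, ?R v) / ?R v) integrable_on cbox (- a, 0) (a, Q)"
      by (intro integrable_continuous continuous_on_nkern ne)
    fix v assume v: "v \<in> cbox (- a, 0) (a, Q)"
    then have c: "\<bar>fst v\<bar> \<le> a" by (cases v) auto
    show "norm (H (\<beta>, fst v, ?R v) / ?R v) \<le> C * (1 / ?R v ^ 3)"
      using bH[OF \<beta> c R[of v]] R[of v] by (simp add: field_simps eval_nat_numeral)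
  qed (rule i)
  also have "\<dots> \<le> C * (2 * a / ?b\<^sup>2)"
    unfolding integral_mult_right using C_nonneg
    by (intro mult_left_mono integral_inverse_rad_cube_le ne Q) auto
  finally show "\<bar>nface a Q \<beta> \<xi> \<eta> H\<bar> \<le> 2 * a * C / ?b\<^sup>2" by (simp add: mult_ac)
qed

text \<open>Reflecting the source in the line of the side reverses the sign of the weight. Thus the
  Neumann terms of a source and of its mirror image cancel, and their Dirichlet terms agree.\<close>

lemma side_sum:
  assumes \<sigma>: "\<sigma> \<in> {1, - 1}" and x: "\<bar>x1\<bar> < a" and Q: "0 \<le> Q" and K: "1 \<le> 4 * real K * a" "0 < K"
  shows "\<bar>(\<Sum>m\<in>{- (2 * int K)..2 * int K}. \<Sum>n\<in>{- (2 * int K)..2 * int K}. parity m * parity n *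
       face a Q (of_int \<sigma> * a - mirror a x1 m) (mirror a x1 m) (mirror a x2 n) F G H 1)
     - 2 * (\<Sum>k\<in>{- int K..int K}. \<Sum>n\<in>{- (2 * int K)..2 * int K}. parity n *
         dface a Q (of_int \<sigma> * a) (mirror a x1 (2 * k)) (mirror a x2 n) F G)\<bar>
     \<le> 2 * C / (a * real K)"
proof -
  let ?I = "{- (2 * int K)..2 * int K}" and ?\<beta> = "of_int \<sigma> * a"
  define v where "v = (\<lambda>m. \<Sum>n\<in>?I. parity m * parity n * dface a Q ?\<beta> (mirror a x1 m) (mirror a x2 n) F G)"
  define w where "w = (\<lambda>m. \<Sum>n\<in>?I. parity m * parity n * nface a Q ?\<beta> (mirror a x1 m) (mirror a x2 n) H)"
  note ne = mirror_ne_side[OF \<sigma> x]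
  have "v (\<sigma> - m) = v m" for m
    unfolding v_def mirror_reflect[OF \<sigma>] dface_reflect by simp
  then have sv: "sum v ?I = 2 * (\<Sum>k\<in>{- int K..int K}. v (2 * k)) - v (- (2 * int K * \<sigma>))"
    using sum_paired[OF \<sigma>, of v 1 K] by simp
  have "w (\<sigma> - m) = - w m" for m
    unfolding w_def mirror_reflect[OF \<sigma>] nface_reflect by (simp add: sum_negf)
  then have sw: "sum w ?I = w (- (2 * int K * \<sigma>))"
    using sum_paired[OF \<sigma>, of w "- 1" K] by simp
  \<comment> \<open>The column of images without partner. It lies at distance at least
    \<open>4 * K * a\<close> from the side, so each of its \<open>4 * K + 1\<close> terms is of
    order 1/K^2, and together they are of order 1/K.\<close>
  let ?m = "- (2 * int K * \<sigma>)"
  let ?b = "?\<beta> - mirror a x1 ?m"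
  have b: "4 * real K * a \<le> \<bar>?b\<bar>"
    using \<sigma> x a by (auto simp: mirror_def algebra_simps)
  have b1: "1 \<le> \<bar>?b\<bar>" using b K by simp
  have \<beta>: "\<bar>?\<beta>\<bar> \<le> a" using \<sigma> a by auto
  have par: "\<bar>parity m\<bar> = 1" for m by (simp add: parity_def)
  have card: "(\<Sum>n\<in>?I. y) = (4 * real K + 1) * y" for y :: real by simp
  have "\<bar>v ?m\<bar> \<le> (4 * real K + 1) * (4 * a * C / ?b\<^sup>2)"
    unfolding v_def card[symmetric]
    by (intro order_trans[OF sum_abs] sum_mono) (simp add: abs_mult par faces_bound[OF b1 \<beta> Q])
  moreover have "\<bar>w ?m\<bar> \<le> (4 * real K + 1) * (2 * a * C / ?b\<^sup>2)"
    unfolding w_def card[symmetric]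
    by (intro order_trans[OF sum_abs] sum_mono) (simp add: abs_mult par faces_bound[OF b1 \<beta> Q])
  moreover have "(4 * real K + 1) * (4 * a * C / ?b\<^sup>2) + (4 * real K + 1) * (2 * a * C / ?b\<^sup>2) = (4 * real K + 1) * (6 * a * C / ?b\<^sup>2)"
    by (simp only: distrib_left[symmetric] add_divide_distrib[symmetric]) simp
  ultimately have "\<bar>v ?m\<bar> + \<bar>w ?m\<bar> \<le> (4 * real K + 1) * (6 * a * C / ?b\<^sup>2)"
    by linarith
  \<comment> \<open>With at most \<open>5 * K\<close> terms and the squared distance at least
    \<open>16 * K^2 * a^2\<close>, the factor \<open>6 * a * C\<close> becomes 30/16, rounded up to
    2.\<close>
  also have "\<dots> \<le> (5 * real K) * (6 * a * C / (4 * real K * a)\<^sup>2)"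
  proof (rule mult_mono)
    have "(4 * real K * a)\<^sup>2 \<le> \<bar>?b\<bar>\<^sup>2" using b a by (intro power_mono) auto
    then show "6 * a * C / ?b\<^sup>2 \<le> 6 * a * C / (4 * real K * a)\<^sup>2"
      using a C_nonneg K b1 by (intro divide_left_mono) (auto intro!: mult_pos_pos)
  qed (use a C_nonneg K in auto)
  also have "\<dots> = 30 / 16 * (C / (a * real K))"
    using a K by (simp add: power2_eq_square field_simps)
  also have "\<dots> \<le> 2 * (C / (a * real K))"
    using a C_nonneg K by (intro mult_right_mono) auto
  finally have vw: "\<bar>v ?m\<bar> + \<bar>w ?m\<bar> \<le> 2 * C / (a * real K)" by simp
  have "(\<Sum>m\<in>?I. \<Sum>n\<in>?I. parity m * parity n *
       face a Q (?\<beta> - mirror a x1 m) (mirror a x1 m) (mirror a x2 n) F G H 1) = sum v ?I - sum w ?I"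
    unfolding face_eq_dface_nface[OF ne] v_def w_def by (simp add: right_diff_distrib sum_subtractf)
  also have "\<dots> = 2 * (\<Sum>k\<in>{- int K..int K}. v (2 * k)) - (v ?m + w ?m)"
    unfolding sv sw by simp
  also have "(\<Sum>k\<in>{- int K..int K}. v (2 * k)) = (\<Sum>k\<in>{- int K..int K}. \<Sum>n\<in>?I. parity n *
         dface a Q ?\<beta> (mirror a x1 (2 * k)) (mirror a x2 n) F G)"
    unfolding v_def by (simp add: parity_def)
  finally show ?thesis using vw by linarith
qed

end

definition dcell where
  "dcell a \<beta> \<xi> \<eta> F G = (LINT c:{- a<..<a}|lborel. dline \<beta> \<xi> \<eta> F G c)"

context side_data begin

lemma dkern_measurable: "(\<lambda>q. dkern \<beta> \<xi> \<eta> F G (c, q)) \<in> borel_measurable borel" if "\<beta> \<noteq> \<xi>"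
  by (intro borel_measurable_continuous_onI continuous_on_dkern that continuous_intros)

lemma dkern_integrable:
  assumes "\<beta> \<noteq> \<xi>" "\<bar>\<beta>\<bar> \<le> a" "\<bar>c\<bar> \<le> a"
  shows "set_integrable lborel {0..} (\<lambda>q. dkern \<beta> \<xi> \<eta> F G (c, q))"
proof -
  let ?K = "2 * C * \<bar>\<beta> - \<xi>\<bar> / ((\<beta> - \<xi>)\<^sup>2 + (c - \<eta>)\<^sup>2)"
  have "set_integrable lborel {0..} (\<lambda>q. ?K * (1 / rad (\<beta> - \<xi>) \<eta> (c, q) ^ 3))"
    by (intro set_integrable_mult_right inverse_rad_cube_integrable) (use assms in simp)
  then show ?thesis
  proof (rule set_integrable_bound)
    show "set_borel_measurable lborel {0..} (\<lambda>q. dkern \<beta> \<xi> \<eta> F G (c, q))"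
      unfolding set_borel_measurable_def using dkern_measurable[OF assms(1)] by measurable
    show "AE q in lborel. q \<in> {0..} \<longrightarrow> norm (dkern \<beta> \<xi> \<eta> F G (c, q)) \<le> norm (?K * (1 / rad (\<beta> - \<xi>) \<eta> (c, q) ^ 3))"
      unfolding real_norm_def by (intro AE_I2 impI order_trans[OF dkern_bound[OF assms] abs_ge_self])
  qed
qed

lemma dline_bound:
  assumes "\<beta> \<noteq> \<xi>" "\<bar>\<beta>\<bar> \<le> a" "\<bar>c\<bar> \<le> a" "A \<in> sets borel"
  shows "\<bar>LINT q:{0..} \<inter> A|lborel. dkern \<beta> \<xi> \<eta> F G (c, q)\<bar> \<le> 2 * C * \<bar>\<beta> - \<xi>\<bar> / ((\<beta> - \<xi>)\<^sup>2 + (c - \<eta>)\<^sup>2)\<^sup>2"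
proof -
  let ?m = "(\<beta> - \<xi>)\<^sup>2 + (c - \<eta>)\<^sup>2"
  let ?K = "2 * C * \<bar>\<beta> - \<xi>\<bar> / ?m"
  have b: "\<beta> - \<xi> \<noteq> 0" using assms by simp
  have m: "0 < ?m" using b by (intro add_pos_nonneg) auto
  have i: "set_integrable lborel {0..} (\<lambda>q. ?K * (1 / rad (\<beta> - \<xi>) \<eta> (c, q) ^ 3))"
    by (intro set_integrable_mult_right inverse_rad_cube_integrable b)
  have "norm (LINT q:{0..} \<inter> A|lborel. dkern \<beta> \<xi> \<eta> F G (c, q)) \<le> (LINT q|lborel. norm (indicator ({0..} \<inter> A) q *\<^sub>R dkern \<beta> \<xi> \<eta> F G (c, q)))"
    unfolding set_lebesgue_integral_def by (rule integral_norm_bound)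
  also have "\<dots> \<le> (LINT q:{0..}|lborel. ?K * (1 / rad (\<beta> - \<xi>) \<eta> (c, q) ^ 3))"
    unfolding set_lebesgue_integral_def
  proof (rule integral_mono)
    show "integrable lborel (\<lambda>q. norm (indicator ({0..} \<inter> A) q *\<^sub>R dkern \<beta> \<xi> \<eta> F G (c, q)))"
      using set_integrable_subset[OF dkern_integrable[OF assms(1-3)], of "{0..} \<inter> A"] assms(4)
      unfolding set_integrable_def by (intro integrable_norm) auto
    show "integrable lborel (\<lambda>q. indicator {0..} q *\<^sub>R (?K * (1 / rad (\<beta> - \<xi>) \<eta> (c, q) ^ 3)))"
      using i unfolding set_integrable_def .
    show "norm (indicator ({0..} \<inter> A) q *\<^sub>R dkern \<beta> \<xi> \<eta> F G (c, q)) \<le> indicator {0..} q *\<^sub>R (?K * (1 / rad (\<beta> - \<xi>) \<eta> (c, q) ^ 3))" for q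
      using dkern_bound[OF assms(1-3), of \<eta> q] rad_pos[OF b, of \<eta> "(c, q)"] C_nonneg m
      by (auto simp: indicator_def)
  qed
  also have "\<dots> = ?K * (1 / ?m)"
    unfolding set_integral_mult_right inverse_rad_cube_integrable(2)[OF b] ..
  finally show ?thesis by (simp add: power2_eq_square)
qed

text \<open>Dominated convergence along integer heights. Away from the source the inner integrals
  are bounded by a constant \<open>B\<close>, and the side has finite length.\<close>

lemma dface_tendsto:
  assumes ne: "\<beta> \<noteq> \<xi>" and \<beta>: "\<bar>\<beta>\<bar> \<le> a"
  shows "(\<lambda>i. dface a (real i) \<beta> \<xi> \<eta> F G) \<longlonglongrightarrow> dcell a \<beta> \<xi> \<eta> F G"
proof -
  let ?d = "dkern \<beta> \<xi> \<eta> F G"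
  let ?J = "\<lambda>i c. LINT q:{0..real i}|lborel. ?d (c, q)"
  define B where "B = 2 * C * \<bar>\<beta> - \<xi>\<bar> / ((\<beta> - \<xi>)\<^sup>2)\<^sup>2"
  have cd: "continuous_on S (\<lambda>x. ?d (g x))" if "continuous_on S g" for S :: "'z::topological_space set" and g
    by (rule continuous_on_dkern[OF ne that])
  have J: "?J i c = integral (cbox 0 (real i)) (\<lambda>q. ?d (c, q))" for i c
    unfolding cbox_interval
    by (rule set_borel_integral_eq_integral(2)) (intro borel_integrable_atLeastAtMost' cd continuous_intros)
  have cJ: "continuous_on {- a..a} (?J i)" for i
    unfolding J cbox_interval[of "- a" a, symmetric]
    by (rule integral_continuous_on_param) (auto simp: split_beta intro!: cd continuous_intros)
  have Jb: "\<bar>?J i c\<bar> \<le> B" "\<bar>dline \<beta> \<xi> \<eta> F G c\<bar> \<le> B" if c: "c \<in> {- a..a}" for i c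
  proof -
    have c': "\<bar>c\<bar> \<le> a" using c by auto
    have m: "0 < (\<beta> - \<xi>)\<^sup>2" using ne by simp
    have "2 * C * \<bar>\<beta> - \<xi>\<bar> / ((\<beta> - \<xi>)\<^sup>2 + (c - \<eta>)\<^sup>2)\<^sup>2 \<le> B"
      unfolding B_def using m C_nonneg by (intro divide_left_mono power_mono mult_pos_pos) (auto intro!: add_pos_nonneg zero_less_power)
    moreover have "{0..} \<inter> {..real i} = {0..real i}" by auto
    ultimately show "\<bar>?J i c\<bar> \<le> B" "\<bar>dline \<beta> \<xi> \<eta> F G c\<bar> \<le> B"
      using dline_bound[OF ne \<beta> c', of "{..real i}" \<eta>] dline_bound[OF ne \<beta> c', of UNIV \<eta>] by (auto simp: dline_def)
  qed
  have lim: "(\<lambda>i. ?J i c) \<longlonglongrightarrow> dline \<beta> \<xi> \<eta> F G c" if c: "c \<in> {- a..a}" for c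
  proof -
    have "integrable lborel (\<lambda>q. indicator {0..} q *\<^sub>R ?d (c, q))"
      using dkern_integrable[OF ne \<beta>, of c \<eta>] c unfolding set_integrable_def by auto
    then have "((\<lambda>y. LINT q|lborel. indicator {..y} q *\<^sub>R (indicator {0..} q *\<^sub>R ?d (c, q))) \<longlongrightarrow> dline \<beta> \<xi> \<eta> F G c) at_top"
      unfolding dline_def set_lebesgue_integral_def by (intro tendsto_integral_at_top) auto
    then have "(\<lambda>i. LINT q|lborel. indicator {..real i} q *\<^sub>R (indicator {0..} q *\<^sub>R ?d (c, q))) \<longlonglongrightarrow> dline \<beta> \<xi> \<eta> F G c"
      by (rule filterlim_compose) (rule filterlim_real_sequentially)
    moreover have "(LINT q|lborel. indicator {..real i} q *\<^sub>R (indicator {0..} q *\<^sub>R ?d (c, q))) = ?J i c" for i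
      unfolding set_lebesgue_integral_def by (intro Bochner_Integration.integral_cong) (auto simp: indicator_def)
    ultimately show ?thesis by simp
  qed
  have eq: "dface a (real i) \<beta> \<xi> \<eta> F G = (LINT c:{- a..a}|lborel. ?J i c)" for i
  proof -
    have "dface a (real i) \<beta> \<xi> \<eta> F G = integral (cbox (- a) a) (\<lambda>c. integral (cbox 0 (real i)) (\<lambda>q. ?d (c, q)))"
      unfolding dface_def by (intro integral_prod_continuous cd continuous_on_id)
    also have "\<dots> = integral {- a..a} (?J i)" unfolding J by simp
    also have "\<dots> = (LINT c:{- a..a}|lborel. ?J i c)"
      by (rule set_borel_integral_eq_integral(2)[symmetric]) (intro borel_integrable_atLeastAtMost' cJ)
    finally show ?thesis .
  qed
  have mJ: "(\<lambda>c. indicator {- a..a} c *\<^sub>R ?J i c) \<in> borel_measurable borel" for i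
    by (rule borel_measurable_continuous_on_indicator[OF _ cJ]) simp
  \<comment> \<open>Measurability of the improper integral as a function of \<open>c\<close> is
    inherited from the truncated ones, which are continuous on the side.\<close>
  have mL: "(\<lambda>c. indicator {- a..a} c *\<^sub>R dline \<beta> \<xi> \<eta> F G c) \<in> borel_measurable borel"
  proof (rule borel_measurable_LIMSEQ_real)
    show "(\<lambda>i. indicator {- a..a} c *\<^sub>R ?J i c) \<longlonglongrightarrow> indicator {- a..a} c *\<^sub>R dline \<beta> \<xi> \<eta> F G c" for c
      using lim by (auto simp: indicator_def)
  qed (rule mJ)
  have "(\<lambda>i. LINT c|lborel. indicator {- a..a} c *\<^sub>R ?J i c) \<longlonglongrightarrow> (LINT c|lborel. indicator {- a..a} c *\<^sub>R dline \<beta> \<xi> \<eta> F G c)"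
  proof (rule integral_dominated_convergence[where w="\<lambda>c. indicator {- a..a} c *\<^sub>R B"])
    show "(\<lambda>c. indicator {- a..a} c *\<^sub>R ?J i c) \<in> borel_measurable lborel" for i using mJ by simp
    show l: "AE c in lborel. (\<lambda>i. indicator {- a..a} c *\<^sub>R ?J i c) \<longlonglongrightarrow> indicator {- a..a} c *\<^sub>R dline \<beta> \<xi> \<eta> F G c"
      using lim by (intro AE_I2) (auto simp: indicator_def)
    show "(\<lambda>c. indicator {- a..a} c *\<^sub>R dline \<beta> \<xi> \<eta> F G c) \<in> borel_measurable lborel" using mL by simp
    show "integrable lborel (\<lambda>c. indicator {- a..a} c *\<^sub>R B)"
      using borel_integrable_atLeastAtMost'[of "- a" a "\<lambda>_. B"] unfolding set_integrable_def by simp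
    show "AE c in lborel. norm (indicator {- a..a} c *\<^sub>R ?J i c) \<le> indicator {- a..a} c *\<^sub>R B" for i
      using Jb by (intro AE_I2) (auto simp: indicator_def)
  qed
  \<comment> \<open>\<open>dcell\<close> leaves out the corners, where the replicated data are set
    to zero; they form a null set.\<close>
  moreover have "(LINT c|lborel. indicator {- a..a} c *\<^sub>R dline \<beta> \<xi> \<eta> F G c) = (LINT c|lborel. indicator {- a<..<a} c *\<^sub>R dline \<beta> \<xi> \<eta> F G c)"
  proof (rule integral_cong_AE)
    show "(\<lambda>c. indicator {- a..a} c *\<^sub>R dline \<beta> \<xi> \<eta> F G c) \<in> borel_measurable lborel" using mL by simp
    have "(\<lambda>c. indicator {- a<..<a} c *\<^sub>R (indicator {- a..a} c *\<^sub>R dline \<beta> \<xi> \<eta> F G c)) \<in> borel_measurable borel"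
      using mL by measurable
    also have "(\<lambda>c. indicator {- a<..<a} c *\<^sub>R (indicator {- a..a} c *\<^sub>R dline \<beta> \<xi> \<eta> F G c)) = (\<lambda>c. indicator {- a<..<a} c *\<^sub>R dline \<beta> \<xi> \<eta> F G c)"
      by (auto simp: indicator_def)
    finally show "(\<lambda>c. indicator {- a<..<a} c *\<^sub>R dline \<beta> \<xi> \<eta> F G c) \<in> borel_measurable lborel" by simp
    show "AE c in lborel. indicator {- a..a} c *\<^sub>R dline \<beta> \<xi> \<eta> F G c = indicator {- a<..<a} c *\<^sub>R dline \<beta> \<xi> \<eta> F G c"
      using AE_lborel_singleton[of a] AE_lborel_singleton[of "- a"] by eventually_elim (auto simp: indicator_def)
  qed
  ultimately show ?thesis
    unfolding eq dcell_def set_lebesgue_integral_def by simp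
qed

end

text \<open>What pairing leaves of one side at infinite height: across the side only the even
  images, one of each pair; along the side all images, with their signs.\<close>

definition cells :: "real \<Rightarrow> int \<Rightarrow> real \<Rightarrow> real \<Rightarrow> (real \<times> real \<times> real \<Rightarrow> real) \<Rightarrow> (real \<times> real \<times> real \<Rightarrow> real) \<Rightarrow> nat \<Rightarrow> real" where
  "cells a \<sigma> x1 x2 F G K = (\<Sum>k\<in>{- int K..int K}. \<Sum>n\<in>{- (2 * int K)..2 * int K}. parity n *
     dcell a (of_int \<sigma> * a) (mirror a x1 (2 * k)) (mirror a x2 n) F G)"

lemma mirror_outside:
  assumes "\<bar>x\<bar> < a" "m \<noteq> 0"
  shows "a < \<bar>mirror a x m\<bar>"
proof -
  have "1 \<le> \<bar>real_of_int m\<bar>" using assms(2) by linarith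
  then have "2 * 1 * a \<le> 2 * \<bar>real_of_int m\<bar> * a" using assms by (intro mult_right_mono mult_left_mono) auto
  also have "\<dots> = \<bar>2 * of_int m * a\<bar>" using assms by (simp add: abs_mult)
  also have "\<dots> \<le> \<bar>mirror a x m\<bar> + \<bar>x\<bar>" by (auto simp: mirror_def)
  finally show ?thesis using assms by linarith
qed

context wave begin

lemma side_data_ex:
  assumes "0 < a"
  obtains C where "side_data a C utt ut ut1" "side_data a C (swap3 utt) (swap3 ut) (swap3 ut2)"
proof -
  obtain C1 C2 C3 C4 where C:
    "\<And>x y t. \<bar>x\<bar> \<le> a \<and> \<bar>y\<bar> \<le> a \<and> 0 < t \<Longrightarrow> t ^ 2 * \<bar>ut (x, y, t)\<bar> \<le> C1"
    "\<And>x y t. \<bar>x\<bar> \<le> a \<and> \<bar>y\<bar> \<le> a \<and> 0 < t \<Longrightarrow> t ^ 2 * \<bar>ut1 (x, y, t)\<bar> \<le> C2"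
    "\<And>x y t. \<bar>x\<bar> \<le> a \<and> \<bar>y\<bar> \<le> a \<and> 0 < t \<Longrightarrow> t ^ 2 * \<bar>ut2 (x, y, t)\<bar> \<le> C3"
    "\<And>x y t. \<bar>x\<bar> \<le> a \<and> \<bar>y\<bar> \<le> a \<and> 0 < t \<Longrightarrow> t ^ 3 * \<bar>utt (x, y, t)\<bar> \<le> C4"
    using decays_wave[of a] unfolding decays_def by auto
  define C where "C = max (max C1 C2) (max C3 C4)"
  have le: "C1 \<le> C" "C2 \<le> C" "C3 \<le> C" "C4 \<le> C" by (simp_all add: C_def)
  note bounds = order_trans[OF C(1) le(1)] order_trans[OF C(2) le(2)] order_trans[OF C(3) le(3)] order_trans[OF C(4) le(4)]
  note cont = continuous_u has_grad3_continuous[OF grad_ut]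
  show ?thesis
  proof (rule that[of C])
    show "side_data a C utt ut ut1"
      using assms bounds cont by unfold_locales auto
    show "side_data a C (swap3 utt) (swap3 ut) (swap3 ut2)"
      using assms bounds cont[THEN continuous_swap3] by unfold_locales (auto simp: swap3_def)
  qed
qed

text \<open>For fixed \<open>K\<close> the height tends to infinity in an estimate uniform in the
  height; its error collects \<open>2 * C / (a * K)\<close> from each of the four sides. Of all
  images only the source itself lies in the square, so the alternating sum of the fluxes tends to
  \<open>- 2 * pi * f\<close>. Half of it belongs to the even images.\<close>

lemma cells_tendsto:
  assumes a: "0 < a" and supp_a: "\<And>p. f p \<noteq> 0 \<Longrightarrow> \<bar>fst p\<bar> < a \<and> \<bar>snd p\<bar> < a"
    and x1: "\<bar>x1\<bar> < a" and x2: "\<bar>x2\<bar> < a"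
  shows "(\<lambda>K. cells a 1 x1 x2 utt ut K - cells a (- 1) x1 x2 utt ut K
      + cells a 1 x2 x1 (swap3 utt) (swap3 ut) K - cells a (- 1) x2 x1 (swap3 utt) (swap3 ut) K)
    \<longlonglongrightarrow> - pi * f (x1, x2)"
proof -
  obtain C where s1: "side_data a C utt ut ut1" and s2: "side_data a C (swap3 utt) (swap3 ut) (swap3 ut2)"
    using side_data_ex[OF a] by blast
  interpret d1: side_data a C utt ut ut1 by (rule s1)
  interpret d2: side_data a C "swap3 utt" "swap3 ut" "swap3 ut2" by (rule s2)
  let ?c = "\<lambda>K. cells a 1 x1 x2 utt ut K - cells a (- 1) x1 x2 utt ut K
      + cells a 1 x2 x1 (swap3 utt) (swap3 ut) K - cells a (- 1) x2 x1 (swap3 utt) (swap3 ut) K"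
  have main: "\<bar>- 2 * pi * f (x1, x2) - 2 * ?c K\<bar> \<le> 8 * C / (a * real K)" if K: "1 \<le> 4 * real K * a" "0 < K" for K
  proof -
    let ?I = "{- (2 * int K)..2 * int K}"
    define Fl where "Fl = (\<lambda>Q. \<Sum>m\<in>?I. \<Sum>n\<in>?I. parity m * parity n * flux a Q (mirror a x1 m) (mirror a x2 n) utt ut ut1 ut2 1)"
    define D where "D = (\<lambda>\<sigma> x1 x2 F G Q. \<Sum>k\<in>{- int K..int K}. \<Sum>n\<in>?I. parity n *
         dface a Q (of_int \<sigma> * a) (mirror a x1 (2 * k)) (mirror a x2 n) F G)"
    define E where "E = (\<lambda>\<sigma> x1 x2 F G H Q. \<Sum>m\<in>?I. \<Sum>n\<in>?I. parity m * parity n *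
       face a Q (of_int \<sigma> * a - mirror a x1 m) (mirror a x1 m) (mirror a x2 n) F G H 1)"
    have FlE: "Fl Q = E 1 x1 x2 utt ut ut1 Q - E (- 1) x1 x2 utt ut ut1 Q
        + E 1 x2 x1 (swap3 utt) (swap3 ut) (swap3 ut2) Q - E (- 1) x2 x1 (swap3 utt) (swap3 ut) (swap3 ut2) Q" for Q
    proof -
      \<comment> \<open>For the sides perpendicular to the second axis the two image indices
        exchange roles; reordering the double sum matches them with the terms of
        \<open>flux\<close>.\<close>
      have sw: "E \<sigma> x2 x1 (swap3 utt) (swap3 ut) (swap3 ut2) Q = (\<Sum>m\<in>?I. \<Sum>n\<in>?I. parity m * parity n *
         face a Q (of_int \<sigma> * a - mirror a x2 n) (mirror a x2 n) (mirror a x1 m) (swap3 utt) (swap3 ut) (swap3 ut2) 1)" for \<sigma>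
        unfolding E_def by (subst sum.swap) (simp add: mult.commute)
      show ?thesis
        unfolding sw unfolding Fl_def E_def flux_def
        by (simp add: algebra_simps sum.distrib sum_subtractf sum_distrib_left)
    qed
    have est: "\<bar>Fl (real i) - 2 * (D 1 x1 x2 utt ut (real i) - D (- 1) x1 x2 utt ut (real i)
        + D 1 x2 x1 (swap3 utt) (swap3 ut) (real i) - D (- 1) x2 x1 (swap3 utt) (swap3 ut) (real i))\<bar> \<le> 8 * C / (a * real K)" for i
    proof -
      have "\<bar>E \<sigma> x1 x2 utt ut ut1 (real i) - 2 * D \<sigma> x1 x2 utt ut (real i)\<bar> \<le> 2 * C / (a * real K)"
        if "\<sigma> \<in> {1, - 1}" for \<sigma>
        unfolding E_def D_def by (rule d1.side_sum[OF that x1 _ K]) simp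
      from this[of 1] this[of "- 1"]
      have e1: "\<bar>E 1 x1 x2 utt ut ut1 (real i) - 2 * D 1 x1 x2 utt ut (real i)\<bar> \<le> 2 * C / (a * real K)"
        "\<bar>E (- 1) x1 x2 utt ut ut1 (real i) - 2 * D (- 1) x1 x2 utt ut (real i)\<bar> \<le> 2 * C / (a * real K)" by auto
      have "\<bar>E \<sigma> x2 x1 (swap3 utt) (swap3 ut) (swap3 ut2) (real i) - 2 * D \<sigma> x2 x1 (swap3 utt) (swap3 ut) (real i)\<bar> \<le> 2 * C / (a * real K)"
        if "\<sigma> \<in> {1, - 1}" for \<sigma>
        unfolding E_def D_def by (rule d2.side_sum[OF that x2 _ K]) simp
      from this[of 1] this[of "- 1"]
      have e2: "\<bar>E 1 x2 x1 (swap3 utt) (swap3 ut) (swap3 ut2) (real i) - 2 * D 1 x2 x1 (swap3 utt) (swap3 ut) (real i)\<bar> \<le> 2 * C / (a * real K)"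
        "\<bar>E (- 1) x2 x1 (swap3 utt) (swap3 ut) (swap3 ut2) (real i) - 2 * D (- 1) x2 x1 (swap3 utt) (swap3 ut) (real i)\<bar> \<le> 2 * C / (a * real K)" by auto
      have "8 * C / (a * real K) = 4 * (2 * C / (a * real K))" by simp
      then show ?thesis unfolding FlE using e1 e2 by argo
    qed
    have Dlim1: "(\<lambda>i. D \<sigma> x1 x2 utt ut (real i)) \<longlonglongrightarrow> cells a \<sigma> x1 x2 utt ut K" if "\<sigma> \<in> {1, - 1}" for \<sigma>
      unfolding D_def cells_def
      by (intro tendsto_sum tendsto_mult tendsto_const d1.dface_tendsto mirror_ne_side that x1) (use that a in auto)
    have Dlim2: "(\<lambda>i. D \<sigma> x2 x1 (swap3 utt) (swap3 ut) (real i)) \<longlonglongrightarrow> cells a \<sigma> x2 x1 (swap3 utt) (swap3 ut) K" if "\<sigma> \<in> {1, - 1}" for \<sigma>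
      unfolding D_def cells_def
      by (intro tendsto_sum tendsto_mult tendsto_const d2.dface_tendsto mirror_ne_side that x2) (use that a in auto)
    have Fllim: "(\<lambda>i. Fl (real i)) \<longlonglongrightarrow> - 2 * pi * f (x1, x2)"
    proof -
      have "(Fl \<longlongrightarrow> (\<Sum>m\<in>?I. \<Sum>n\<in>?I. parity m * parity n * (- 2 * pi * f (mirror a x1 m, mirror a x2 n)))) at_top"
        unfolding Fl_def
      proof (intro tendsto_sum tendsto_mult tendsto_const flux_tendsto)
        fix m n
        show "a - mirror a x1 m \<noteq> 0" "- a - mirror a x1 m \<noteq> 0" "a - mirror a x2 n \<noteq> 0" "- a - mirror a x2 n \<noteq> 0"
          using mirror_ne_side[of 1 x1 a m] mirror_ne_side[of "- 1" x1 a m] mirror_ne_side[of 1 x2 a n]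
            mirror_ne_side[of "- 1" x2 a n] x1 x2 by auto
        show "f (mirror a x1 m, mirror a x2 n) = 0 \<or> (\<bar>mirror a x1 m\<bar> < a \<and> \<bar>mirror a x2 n\<bar> < a)"
          using supp_a[of "(mirror a x1 m, mirror a x2 n)"] by auto
      qed (use a in auto)
      also have "(\<Sum>m\<in>?I. \<Sum>n\<in>?I. parity m * parity n * (- 2 * pi * f (mirror a x1 m, mirror a x2 n)))
          = (\<Sum>m\<in>?I. \<Sum>n\<in>?I. if m = 0 \<and> n = 0 then - 2 * pi * f (x1, x2) else 0)"
      proof (intro sum.cong refl)
        fix m n
        show "parity m * parity n * (- 2 * pi * f (mirror a x1 m, mirror a x2 n)) = (if m = 0 \<and> n = 0 then - 2 * pi * f (x1, x2) else 0)"
        proof (cases "m = 0 \<and> n = 0")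
          case True
          then show ?thesis by (simp add: parity_def mirror_def)
        next
          case False
          then have "f (mirror a x1 m, mirror a x2 n) = 0"
            using supp_a[of "(mirror a x1 m, mirror a x2 n)"] mirror_outside[OF x1, of m] mirror_outside[OF x2, of n]
            by fastforce
          then show ?thesis using False by auto
        qed
      qed
      also have "\<dots> = (\<Sum>m\<in>?I. if m = 0 then (\<Sum>n\<in>?I. if n = 0 then - 2 * pi * f (x1, x2) else 0) else 0)"
        by (intro sum.cong refl) auto
      also have "\<dots> = - 2 * pi * f (x1, x2)" by simp
      finally have "(Fl \<longlongrightarrow> - 2 * pi * f (x1, x2)) at_top" .
      then show ?thesis by (rule filterlim_compose) (rule filterlim_real_sequentially)
    qed
    have "(\<lambda>i. \<bar>Fl (real i) - 2 * (D 1 x1 x2 utt ut (real i) - D (- 1) x1 x2 utt ut (real i)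
        + D 1 x2 x1 (swap3 utt) (swap3 ut) (real i) - D (- 1) x2 x1 (swap3 utt) (swap3 ut) (real i))\<bar>)
       \<longlonglongrightarrow> \<bar>- 2 * pi * f (x1, x2) - 2 * ?c K\<bar>"
      by (intro tendsto_rabs tendsto_diff tendsto_mult tendsto_const tendsto_add Fllim Dlim1 Dlim2) auto
    then show ?thesis by (rule LIMSEQ_le_const2) (use est in blast)
  qed
  have "(\<lambda>K. 4 * C / a * (1 / real K)) \<longlonglongrightarrow> 4 * C / a * 0"
    by (intro tendsto_mult tendsto_const lim_1_over_n)
  then have z: "(\<lambda>K. 4 * C / a * (1 / real K)) \<longlonglongrightarrow> 0" by simp
  obtain K0 :: nat where K0: "1 / (4 * a) \<le> real K0" using real_arch_simple by blast
  have "\<forall>\<^sub>F K in sequentially. norm (?c K - - pi * f (x1, x2)) \<le> 4 * C / a * (1 / real K)"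
  proof (rule eventually_mono[OF eventually_ge_at_top[of "max 1 K0"]])
    fix K assume K: "max 1 K0 \<le> K"
    have "1 / (4 * a) \<le> real K" using K0 K by (meson max.boundedE of_nat_le_iff order_trans)
    then have "1 \<le> 4 * real K * a" using a by (simp add: field_simps)
    from main[OF this] K have "\<bar>- 2 * pi * f (x1, x2) - 2 * ?c K\<bar> \<le> 2 * (4 * C / a * (1 / real K))" by simp
    moreover have "?c K - - pi * f (x1, x2) = - ((- 2 * pi * f (x1, x2) - 2 * ?c K) / 2)" by (simp add: field_simps)
    ultimately show "norm (?c K - - pi * f (x1, x2)) \<le> 4 * C / a * (1 / real K)" by simp
  qed
  then have "(\<lambda>K. ?c K - - pi * f (x1, x2)) \<longlonglongrightarrow> 0"
    using z by (rule Lim_null_comparison)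
  then show ?thesis by (simp only: LIM_zero_iff)
qed

end

section \<open>Integration over the families of lines\<close>

text \<open>Agrees with the index of the replication operator inside the cells. A point between two
  cells is counted to the right one, but such points are treated separately in
  \<open>lineint\<close>.\<close>

definition cellno :: "real \<Rightarrow> real \<Rightarrow> int" where
  "cellno a s = \<lfloor>(s + a) / (2 * a)\<rfloor>"

definition fold_cell :: "real \<Rightarrow> real \<Rightarrow> real" where
  "fold_cell a s = parity (cellno a s) * (s - 2 * of_int (cellno a s) * a)"

definition cell :: "real \<Rightarrow> int \<Rightarrow> real set" where
  "cell a n = {2 * of_int n * a - a<..<2 * of_int n * a + a}"

text \<open>The inner integral of the reconstruction formula at the point \<open>s\<close> of a line, up to its sign and in the
  variable \<open>q = sqrt (r\<^sup>2 - \<rho>\<^sup>2)\<close>.\<close>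

definition lineint where
  "lineint a \<beta> \<xi> x2 F G s = (if \<exists>m::int. s = (2 * of_int m + 1) * a then 0 else parity (cellno a s) *
     (LINT q:{0..}|lborel. (\<beta> - \<xi>) * (F (\<beta>, fold_cell a s, rad (\<beta> - \<xi>) x2 (s, q)) / rad (\<beta> - \<xi>) x2 (s, q)
       - G (\<beta>, fold_cell a s, rad (\<beta> - \<xi>) x2 (s, q)) / rad (\<beta> - \<xi>) x2 (s, q) ^ 2) / rad (\<beta> - \<xi>) x2 (s, q)))"

lemma cellno_eq:
  assumes "0 < a" "s \<in> cell a n"
  shows "cellno a s = n"
  unfolding cellno_def using assms by (intro floor_unique) (auto simp: cell_def field_simps)

lemma not_cell_boundary:
  assumes "0 < a" "s \<in> cell a n"
  shows "\<not> (\<exists>m::int. s = (2 * of_int m + 1) * a)"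
proof
  assume "\<exists>m::int. s = (2 * of_int m + 1) * a"
  then obtain m :: int where "s = (2 * of_int m + 1) * a" by blast
  then have "(2 * of_int n - 1) * a < (2 * of_int m + 1) * a" "(2 * of_int m + 1) * a < (2 * of_int n + 1) * a"
    using assms by (auto simp: cell_def algebra_simps)
  then have "2 * of_int n - 1 < (2 * of_int m + 1 :: real)" "2 * of_int m + 1 < (2 * of_int n + 1 :: real)"
    using assms(1) by auto
  then have "real_of_int (n - 1) < real_of_int m" "real_of_int m < real_of_int n" by simp_all
  then show False unfolding of_int_less_iff by simp
qed

lemma in_cell_cellno:
  assumes "0 < a" "\<not> (\<exists>m::int. s = (2 * of_int m + 1) * a)"
  shows "s \<in> cell a (cellno a s)"
proof -
  let ?n = "cellno a s"
  have "of_int ?n \<le> (s + a) / (2 * a)" "(s + a) / (2 * a) < of_int ?n + 1"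
    unfolding cellno_def using floor_correct[of "(s + a) / (2 * a)"] by auto
  then have "2 * of_int ?n * a - a \<le> s" "s < 2 * of_int ?n * a + a"
    using assms(1) by (simp_all add: field_simps)
  moreover have "s \<noteq> 2 * of_int ?n * a - a"
    using assms(2)[unfolded not_ex, rule_format, of "?n - 1"] by (simp add: algebra_simps)
  ultimately show ?thesis by (simp add: cell_def)
qed

text \<open>Folding the cell \<open>n\<close> of a line back to the side moves the source \<open>x2\<close> to its mirror image
  with index \<open>flip_even n\<close>.\<close>

definition flip_even :: "int \<Rightarrow> int" where
  "flip_even n = (if even n then - n else n)"

lemma flip_even_simps: "flip_even (flip_even n) = n" "parity (flip_even n) = parity n"
  "\<bar>flip_even n\<bar> = \<bar>n\<bar>"
  by (auto simp: flip_even_def parity_def)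

text \<open>Folding is an isometry, so moving the source along with the point keeps all distances.
  The source moves by the inverse of the group element that unfolds the cell: a translation has the
  opposite index, while a reflection is its own inverse, whence \<open>flip_even\<close>.\<close>

lemma lineint_eq_dline:
  assumes "0 < a" "s \<in> cell a n"
  shows "lineint a \<beta> \<xi> x2 F G s = parity n * dline \<beta> \<xi> (mirror a x2 (flip_even n)) F G (parity n * (s - 2 * of_int n * a))"
proof -
  have r: "rad b (mirror a x2 (flip_even n)) (parity n * (s - 2 * of_int n * a), q) = rad b x2 (s, q)" for b q
  proof -
    have "(parity n * (s - 2 * of_int n * a) - mirror a x2 (flip_even n))\<^sup>2 = (s - x2)\<^sup>2"
      by (auto simp: parity_def mirror_def flip_even_def power2_eq_square algebra_simps)
    then show ?thesis by (simp add: rad_def)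
  qed
  show ?thesis
    using not_cell_boundary[OF assms]
    by (simp add: lineint_def dline_def dkern_def r cellno_eq[OF assms] fold_cell_def)
qed

lemma parity_measurable [measurable]: "(\<lambda>s. parity (cellno a s)) \<in> borel_measurable borel"
  unfolding cellno_def by (rule measurable_compose[of _ _ "count_space UNIV" parity]) simp_all

lemma fold_cell_measurable [measurable]: "fold_cell a \<in> borel_measurable borel"
  unfolding fold_cell_def[abs_def] unfolding cellno_def[of a] using parity_measurable[of a, unfolded cellno_def]
  by measurable

lemma rad_measurable [measurable]: "(\<lambda>v. rad b \<eta> v) \<in> borel_measurable borel"
  by (intro borel_measurable_continuous_onI continuous_intros)

lemma lineint_measurable:
  assumes F: "continuous_on UNIV F" and G: "continuous_on UNIV G"
  shows "lineint a \<beta> \<xi> x2 F G \<in> borel_measurable borel"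
proof -
  have c: "countable {s :: real. \<exists>m::int. s = (2 * of_int m + 1) * a}"
    by (rule countable_subset[of _ "range (\<lambda>m::int. (2 * of_int m + 1) * a)"]) auto
  have S: "{s :: real. \<exists>m::int. s = (2 * of_int m + 1) * a} \<in> sets borel"
    by (rule sets.countable[OF _ c]) (rule borel_singleton, simp)
  have [measurable]: "F \<in> borel_measurable borel" "G \<in> borel_measurable borel"
    using F G by (auto intro: borel_measurable_continuous_onI)
  let ?R = "\<lambda>p :: real \<times> real. rad (\<beta> - \<xi>) x2 p"
  have R [measurable]: "?R \<in> borel_measurable (borel \<Otimes>\<^sub>M borel)"
    unfolding borel_prod by measurable
  have p: "(\<lambda>p :: real \<times> real. (\<beta>, fold_cell a (fst p), ?R p)) \<in> borel_measurable (borel \<Otimes>\<^sub>M borel)"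
    by (intro borel_measurable_Pair) measurable
  have [measurable]: "(\<lambda>p. F (\<beta>, fold_cell a (fst p), ?R p)) \<in> borel_measurable (borel \<Otimes>\<^sub>M borel)"
    "(\<lambda>p. G (\<beta>, fold_cell a (fst p), ?R p)) \<in> borel_measurable (borel \<Otimes>\<^sub>M borel)"
    by (rule measurable_compose[OF p]; measurable)+
  have "(\<lambda>p. indicator {0..} (snd p) *\<^sub>R ((\<beta> - \<xi>) * (F (\<beta>, fold_cell a (fst p), ?R p) / ?R p
       - G (\<beta>, fold_cell a (fst p), ?R p) / ?R p ^ 2) / ?R p)) \<in> borel_measurable (borel \<Otimes>\<^sub>M borel)"
    by measurable
  then have "(\<lambda>p. indicator {0..} (snd p) *\<^sub>R ((\<beta> - \<xi>) * (F (\<beta>, fold_cell a (fst p), ?R p) / ?R p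
       - G (\<beta>, fold_cell a (fst p), ?R p) / ?R p ^ 2) / ?R p)) \<in> borel_measurable (borel \<Otimes>\<^sub>M lborel)"
    by (simp cong: measurable_cong_sets sets_pair_measure_cong)
  then have I: "(\<lambda>s. LINT q|lborel. indicator {0..} q *\<^sub>R ((\<beta> - \<xi>) * (F (\<beta>, fold_cell a s, rad (\<beta> - \<xi>) x2 (s, q)) / rad (\<beta> - \<xi>) x2 (s, q)
       - G (\<beta>, fold_cell a s, rad (\<beta> - \<xi>) x2 (s, q)) / rad (\<beta> - \<xi>) x2 (s, q) ^ 2) / rad (\<beta> - \<xi>) x2 (s, q))) \<in> borel_measurable borel"
    by (intro lborel.borel_measurable_lebesgue_integral) (simp add: split_beta)
  show ?thesis
    unfolding lineint_def[abs_def] set_lebesgue_integral_def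
  proof (rule measurable_If)
    show "(\<lambda>_. 0) \<in> borel_measurable borel" by (rule borel_measurable_const)
    show "{s \<in> space borel. \<exists>m::int. s = (2 * of_int m + 1) * a} \<in> sets borel" using S by simp
  qed (rule borel_measurable_times[OF parity_measurable I])
qed

lemma integrable_inverse_1_plus_sq: "integrable lborel (\<lambda>w::real. 1 / (1 + w\<^sup>2))"
proof -
  have p: "0 < 1 + w\<^sup>2" for w :: real by (intro add_pos_nonneg) auto
  have nn: "(\<integral>\<^sup>+w. ennreal (1 / (1 + w\<^sup>2)) * indicator {0..} w \<partial>lborel) = ennreal (pi / 2 - arctan 0)"
  proof (rule nn_integral_FTC_atLeast)
    show "(arctan has_real_derivative 1 / (1 + w\<^sup>2)) (at w)" for w
      using DERIV_arctan[of w] by (simp add: inverse_eq_divide)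
    show "(arctan \<longlongrightarrow> pi / 2) at_top" by (rule tendsto_arctan_at_top)
  qed (use p in \<open>auto intro: less_imp_le\<close>)
  have i: "integrable lborel (\<lambda>w::real. indicator {0..} w * (1 / (1 + w\<^sup>2)))"
  proof (rule integrableI_nonneg)
    have "(\<integral>\<^sup>+w. ennreal (indicator {0..} w * (1 / (1 + w\<^sup>2))) \<partial>lborel) = (\<integral>\<^sup>+w. ennreal (1 / (1 + w\<^sup>2)) * indicator {0..} w \<partial>lborel)"
      by (intro nn_integral_cong) (simp add: indicator_def)
    then show "(\<integral>\<^sup>+w. ennreal (indicator {0..} w * (1 / (1 + w\<^sup>2))) \<partial>lborel) < \<infinity>" by (simp add: nn)
    show "AE w in lborel. 0 \<le> indicator {0..} w * (1 / (1 + (w::real)\<^sup>2))"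
      by (intro AE_I2) (simp add: indicator_def)
  qed simp
  have j: "integrable lborel (\<lambda>w::real. indicator {0..} (- w) * (1 / (1 + w\<^sup>2)))"
    using lborel_integrable_real_affine[OF i, of "- 1" 0] by simp
  show ?thesis
    by (rule Bochner_Integration.integrable_bound[OF Bochner_Integration.integrable_add[OF i j]])
      (use p in \<open>auto intro!: AE_I2 simp: indicator_def less_imp_le abs_of_pos add_nonneg_nonneg\<close>)
qed

text \<open>Rescaling by \<open>\<bar>b\<bar>\<close> shows that the mass of the kernel does not
  depend on \<open>b\<close>; hence the lines of a family can be compared through a numerical factor
  alone.\<close>

lemma integral_poisson_kernel:
  assumes "(b::real) \<noteq> 0"
  shows "integrable lborel (\<lambda>s. \<bar>b\<bar> / (b\<^sup>2 + (s - y)\<^sup>2))"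
    "(LINT s|lborel. \<bar>b\<bar> / (b\<^sup>2 + (s - y)\<^sup>2)) = (LINT w|lborel. 1 / (1 + w\<^sup>2))"
proof -
  have p: "0 < 1 + w\<^sup>2" for w :: real by (intro add_pos_nonneg) auto
  have e: "\<bar>b\<bar> / (b\<^sup>2 + (y + \<bar>b\<bar> * w - y)\<^sup>2) = 1 / \<bar>b\<bar> * (1 / (1 + w\<^sup>2))" for w
  proof -
    have "b\<^sup>2 + (y + \<bar>b\<bar> * w - y)\<^sup>2 = \<bar>b\<bar> * (\<bar>b\<bar> * (1 + w\<^sup>2))"
      by (simp add: power2_eq_square algebra_simps)
    then show ?thesis using assms by simp
  qed
  have e': "1 / (1 + (- y / \<bar>b\<bar> + 1 / \<bar>b\<bar> * s)\<^sup>2) = \<bar>b\<bar> * (\<bar>b\<bar> / (b\<^sup>2 + (s - y)\<^sup>2))" for s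
  proof -
    have "1 + (- y / \<bar>b\<bar> + 1 / \<bar>b\<bar> * s)\<^sup>2 = (b\<^sup>2 + (s - y)\<^sup>2) / (\<bar>b\<bar> * \<bar>b\<bar>)"
      using assms by (simp add: power2_eq_square field_simps)
    then show ?thesis by simp
  qed
  have "integrable lborel (\<lambda>s. \<bar>b\<bar> * (\<bar>b\<bar> / (b\<^sup>2 + (s - y)\<^sup>2)))"
    using lborel_integrable_real_affine[OF integrable_inverse_1_plus_sq, of "1 / \<bar>b\<bar>" "- y / \<bar>b\<bar>"] assms
    unfolding e' by simp
  then show "integrable lborel (\<lambda>s. \<bar>b\<bar> / (b\<^sup>2 + (s - y)\<^sup>2))"
  proof -
    assume i: "integrable lborel (\<lambda>s. \<bar>b\<bar> * (\<bar>b\<bar> / (b\<^sup>2 + (s - y)\<^sup>2)))"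
    have "1 / \<bar>b\<bar> * (\<bar>b\<bar> * z) = z" for z using assms by simp
    then show ?thesis using integrable_mult_right[OF i, of "1 / \<bar>b\<bar>"] by (simp only:)
  qed
  show "(LINT s|lborel. \<bar>b\<bar> / (b\<^sup>2 + (s - y)\<^sup>2)) = (LINT w|lborel. 1 / (1 + w\<^sup>2))"
    using assms by (subst lborel_integral_real_affine[where t=y and c="\<bar>b\<bar>"])
      (simp_all only: e integral_mult_right_zero, simp_all)
qed

lemma integrable_count_space_int_inverse_sq:
  "integrable (count_space UNIV) (\<lambda>k::int. 1 / (1 + \<bar>of_int k\<bar>)\<^sup>2 :: real)"
proof -
  \<comment> \<open>The standard enumeration alternates between the two signs, so the modulus of the
    n-th integer grows like n/2.\<close>
  have b: "real n + 1 \<le> 2 * (1 + \<bar>of_int (int_decode n)\<bar>)" for n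
  proof -
    have "n = int_encode (int_decode n)" by simp
    moreover have "real (int_encode z) \<le> 2 * \<bar>of_int z\<bar> + 1" for z
      by (auto simp: int_encode_def sum_encode_def)
    ultimately have "real n \<le> 2 * \<bar>of_int (int_decode n)\<bar> + 1" by metis
    then show ?thesis by simp
  qed
  have s: "summable (\<lambda>n. 4 * (1 / (real n + 1)\<^sup>2))"
    using inverse_power_summable[of 2, where ?'a = real]
    by (intro summable_mult) (simp add: summable_Suc_iff[of "\<lambda>n. 1 / (real n)\<^sup>2", symmetric] inverse_eq_divide add.commute)
  have "integrable (count_space UNIV) (\<lambda>n. 1 / (1 + \<bar>of_int (int_decode n)\<bar>)\<^sup>2 :: real)"
    unfolding integrable_count_space_nat_iff
  proof (rule summable_comparison_test'[OF s, of 0])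
    fix n
    have "(real n + 1)\<^sup>2 \<le> (2 * (1 + \<bar>of_int (int_decode n)\<bar>))\<^sup>2"
      using b[of n] by (intro power_mono) auto
    then have "1 / (2 * (1 + \<bar>of_int (int_decode n)\<bar>))\<^sup>2 \<le> 1 / (real n + 1)\<^sup>2"
      by (intro divide_left_mono mult_pos_pos zero_less_power) auto
    moreover have "(2 * (1 + \<bar>of_int (int_decode n)\<bar>))\<^sup>2 = 4 * (1 + \<bar>of_int (int_decode n)\<bar> :: real)\<^sup>2"
      by (simp only: power_mult_distrib) simp
    ultimately show "norm (norm (1 / (1 + \<bar>of_int (int_decode n)\<bar>)\<^sup>2 :: real)) \<le> 4 * (1 / (real n + 1)\<^sup>2)"
      by simp
  qed
  then show ?thesis by (subst (asm) integrable_bij_count_space[OF bij_int_decode])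
qed

lemma sigma_finite_lines: "pair_sigma_finite (count_space (UNIV :: int set)) (lborel :: real measure)"
  by (intro pair_sigma_finite.intro sigma_finite_measure_count_space lborel.sigma_finite_measure_axioms)

context side_data begin

text \<open>One of the two factors in the denominator of \<open>dline_bound\<close> is reduced to
  the squared distance of the line, which makes the family summable; the other one forms a Poisson
  kernel, which is integrable along the line.\<close>

lemma lineint_bound:
  assumes ne: "\<beta> \<noteq> \<xi>" and \<beta>: "\<bar>\<beta>\<bar> \<le> a"
  shows "\<bar>lineint a \<beta> \<xi> x2 F G s\<bar> \<le> 2 * C / (\<beta> - \<xi>)\<^sup>2 * (\<bar>\<beta> - \<xi>\<bar> / ((\<beta> - \<xi>)\<^sup>2 + (s - x2)\<^sup>2))"
proof (cases "\<exists>m::int. s = (2 * of_int m + 1) * a")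
  case True
  then have "lineint a \<beta> \<xi> x2 F G s = 0" by (simp add: lineint_def)
  then show ?thesis using C_nonneg by simp
next
  case False
  let ?n = "cellno a s"
  let ?c = "parity ?n * (s - 2 * of_int ?n * a)" and ?\<eta> = "mirror a x2 (flip_even ?n)"
  have cell: "s \<in> cell a ?n" using in_cell_cellno[OF a False] .
  then have c: "\<bar>?c\<bar> \<le> a" by (auto simp: cell_def parity_def)
  have z: "(?c - ?\<eta>)\<^sup>2 = (s - x2)\<^sup>2"
    by (auto simp: parity_def mirror_def flip_even_def power2_eq_square algebra_simps)
  let ?b = "\<beta> - \<xi>" and ?m = "(\<beta> - \<xi>)\<^sup>2 + (s - x2)\<^sup>2"
  have b2: "0 < ?b\<^sup>2" using ne by simp
  have m: "0 < ?m" using b2 by (intro add_pos_nonneg) auto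
  have "\<bar>lineint a \<beta> \<xi> x2 F G s\<bar> = \<bar>LINT q:{0..} \<inter> UNIV|lborel. dkern \<beta> \<xi> ?\<eta> F G (?c, q)\<bar>"
    unfolding lineint_eq_dline[OF a cell] dline_def by (simp add: abs_mult parity_def)
  also have "\<dots> \<le> 2 * C * \<bar>?b\<bar> / (?b\<^sup>2 + (?c - ?\<eta>)\<^sup>2)\<^sup>2"
    by (rule dline_bound[OF ne \<beta> c]) simp
  also have "\<dots> = 2 * C / ?m * (\<bar>?b\<bar> / ?m)" unfolding z by (simp add: power2_eq_square)
  also have "\<dots> \<le> 2 * C / ?b\<^sup>2 * (\<bar>?b\<bar> / ?m)"
    using C_nonneg m b2 by (intro mult_right_mono divide_left_mono mult_pos_pos) auto
  finally show ?thesis .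
qed

lemma lineint_integrable:
  assumes \<sigma>: "\<sigma> \<in> {1, - 1 :: int}" and x1: "\<bar>x1\<bar> < a"
  shows "integrable (count_space UNIV \<Otimes>\<^sub>M lborel) (\<lambda>(k::int, s). lineint a (of_int \<sigma> * a) (x1 - 4 * of_int k * a) x2 F G s)"
proof -
  interpret pair_sigma_finite "count_space (UNIV :: int set)" "lborel :: real measure" by (rule sigma_finite_lines)
  let ?\<beta> = "of_int \<sigma> * a :: real"
  define b where "b = (\<lambda>k::int. ?\<beta> - (x1 - 4 * of_int k * a))"
  \<comment> \<open>For \<open>k = 0\<close> the distance to the side counts; the other lines are at
    distance at least \<open>a * (4 * \<bar>k\<bar> - 2)\<close>, and this is at least
    \<open>a * (1 + \<bar>k\<bar>)\<close>.\<close>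
  define \<delta> where "\<delta> = min a \<bar>?\<beta> - x1\<bar>"
  have \<delta>: "0 < \<delta>" using a \<sigma> x1 by (auto simp: \<delta>_def)
  have b: "\<delta> * (1 + \<bar>of_int k\<bar>) \<le> \<bar>b k\<bar>" for k
  proof (cases "k = 0")
    case False
    have "1 \<le> \<bar>real_of_int k\<bar>" using False by linarith
    then have "a * (1 + \<bar>of_int k\<bar>) \<le> a * (4 * \<bar>of_int k\<bar> - 2)" using a by (intro mult_left_mono) auto
    also have "\<dots> = \<bar>4 * of_int k * a\<bar> - 2 * a" using a by (simp add: abs_mult algebra_simps)
    also have "\<dots> \<le> \<bar>b k\<bar>"
    proof -
      have "\<bar>?\<beta>\<bar> \<le> a" using \<sigma> a by auto
      then show ?thesis using x1 unfolding b_def by argo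
    qed
    finally show ?thesis
      using mult_right_mono[of \<delta> a "1 + \<bar>of_int k\<bar>"] by (simp add: \<delta>_def)
  qed (simp add: \<delta>_def b_def)
  have b0: "b k \<noteq> 0" for k
  proof -
    have "0 < \<delta> * (1 + \<bar>real_of_int k\<bar>)" using \<delta> by (intro mult_pos_pos) auto
    then show ?thesis using b[of k] by auto
  qed
  let ?g = "\<lambda>(k::int, s). 2 * C / (b k)\<^sup>2 * (\<bar>b k\<bar> / ((b k)\<^sup>2 + (s - x2)\<^sup>2))"
  let ?J = "LINT w|lborel. 1 / (1 + (w::real)\<^sup>2)"
  have J: "0 \<le> ?J" by (intro Bochner_Integration.integral_nonneg) simp
  have "integrable (count_space UNIV \<Otimes>\<^sub>M lborel) ?g"
  proof (rule Fubini_integrable)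
    show "?g \<in> borel_measurable (count_space UNIV \<Otimes>\<^sub>M lborel)"
      by (rule measurable_pair_measure_countable1) simp_all
    have inner: "(LINT s|lborel. norm (?g (k, s))) = 2 * C / (b k)\<^sup>2 * ?J" for k
    proof -
      have "(LINT s|lborel. norm (?g (k, s))) = (LINT s|lborel. 2 * C / (b k)\<^sup>2 * (\<bar>b k\<bar> / ((b k)\<^sup>2 + (s - x2)\<^sup>2)))"
        using C_nonneg by (intro Bochner_Integration.integral_cong) (simp_all add: abs_mult)
      then show ?thesis by (simp only: integral_mult_right_zero integral_poisson_kernel(2)[OF b0])
    qed
    show "integrable (count_space UNIV) (\<lambda>k. LINT s|lborel. norm (?g (k, s)))"
      unfolding inner
    proof (rule Bochner_Integration.integrable_bound)
      show "integrable (count_space UNIV) (\<lambda>k::int. 2 * C / \<delta>\<^sup>2 * ?J * (1 / (1 + \<bar>of_int k\<bar>)\<^sup>2))"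
        by (intro integrable_mult_right integrable_count_space_int_inverse_sq)
      show "AE k in count_space UNIV. norm (2 * C / (b k)\<^sup>2 * ?J) \<le> norm (2 * C / \<delta>\<^sup>2 * ?J * (1 / (1 + \<bar>of_int k\<bar>)\<^sup>2))"
      proof (intro AE_I2)
        fix k
        have "(\<delta> * (1 + \<bar>of_int k\<bar>))\<^sup>2 \<le> \<bar>b k\<bar>\<^sup>2" using b[of k] \<delta> by (intro power_mono) auto
        then have "2 * C / (b k)\<^sup>2 \<le> 2 * C / (\<delta> * (1 + \<bar>of_int k\<bar>))\<^sup>2"
          using C_nonneg \<delta> b0[of k] by (intro divide_left_mono mult_pos_pos) auto
        then have "2 * C / (b k)\<^sup>2 * ?J \<le> 2 * C / (\<delta> * (1 + \<bar>of_int k\<bar>))\<^sup>2 * ?J"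
          using J by (rule mult_right_mono)
        also have "\<dots> = 2 * C / \<delta>\<^sup>2 * ?J * (1 / (1 + \<bar>of_int k\<bar>)\<^sup>2)" by (simp add: power_mult_distrib)
        finally show "norm (2 * C / (b k)\<^sup>2 * ?J) \<le> norm (2 * C / \<delta>\<^sup>2 * ?J * (1 / (1 + \<bar>of_int k\<bar>)\<^sup>2))"
          using C_nonneg J by (simp add: abs_mult)
      qed
    qed simp
    show "AE k in count_space UNIV. integrable lborel (\<lambda>s. ?g (k, s))"
      unfolding split_conv by (intro AE_I2 integrable_mult_right integral_poisson_kernel(1) b0)
  qed
  then show ?thesis
  proof (rule Bochner_Integration.integrable_bound)
    show "(\<lambda>(k::int, s). lineint a ?\<beta> (x1 - 4 * of_int k * a) x2 F G s) \<in> borel_measurable (count_space UNIV \<Otimes>\<^sub>M lborel)"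
      by (rule measurable_pair_measure_countable1) (simp_all add: lineint_measurable[OF cF cG])
    show "AE p in count_space UNIV \<Otimes>\<^sub>M lborel. norm (case p of (k, s) \<Rightarrow> lineint a ?\<beta> (x1 - 4 * of_int k * a) x2 F G s) \<le> norm (?g p)"
    proof (intro AE_I2)
      fix p :: "int \<times> real"
      obtain k s where p: "p = (k, s)" by (cases p)
      have "\<bar>?\<beta>\<bar> \<le> a" using \<sigma> a by auto
      from lineint_bound[of ?\<beta> "x1 - 4 * of_int k * a" x2 s, OF _ this] b0[of k]
      show "norm (case p of (k, s) \<Rightarrow> lineint a ?\<beta> (x1 - 4 * of_int k * a) x2 F G s) \<le> norm (?g p)"
        using C_nonneg by (simp add: p b_def abs_mult)
    qed
  qed
qed

lemma lineint_cell:
  "(LINT s:cell a n|lborel. lineint a \<beta> \<xi> x2 F G s) = parity n * dcell a \<beta> \<xi> (mirror a x2 (flip_even n)) F G"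
proof -
  have c: "parity n \<noteq> 0" "\<bar>parity n\<bar> = 1" "parity n * parity n = 1" by (auto simp: parity_def)
  have "(LINT s:cell a n|lborel. lineint a \<beta> \<xi> x2 F G s) =
     (LINT w|lborel. indicator (cell a n) (2 * of_int n * a + parity n * w) *\<^sub>R lineint a \<beta> \<xi> x2 F G (2 * of_int n * a + parity n * w))"
    unfolding set_lebesgue_integral_def
    by (subst lborel_integral_real_affine[where t="2 * of_int n * a" and c="parity n"]) (use c in simp_all)
  also have "\<dots> = (LINT w|lborel. parity n * (indicator {- a<..<a} w *\<^sub>R dline \<beta> \<xi> (mirror a x2 (flip_even n)) F G w))"
  proof (intro Bochner_Integration.integral_cong refl)
    fix w
    let ?s = "2 * of_int n * a + parity n * w"
    have iff: "?s \<in> cell a n \<longleftrightarrow> w \<in> {- a<..<a}" by (auto simp: cell_def parity_def)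
    show "indicator (cell a n) ?s *\<^sub>R lineint a \<beta> \<xi> x2 F G ?s = parity n * (indicator {- a<..<a} w *\<^sub>R dline \<beta> \<xi> (mirror a x2 (flip_even n)) F G w)"
    proof (cases "?s \<in> cell a n")
      case True
      have ar: "parity n * (?s - 2 * of_int n * a) = w"
        by (simp only: add_diff_cancel_left' mult.assoc[symmetric] c(3) mult_1)
      have "lineint a \<beta> \<xi> x2 F G ?s = parity n * dline \<beta> \<xi> (mirror a x2 (flip_even n)) F G w"
        using lineint_eq_dline[OF a True, of \<beta> \<xi> x2 F G] unfolding ar .
      then show ?thesis using True iff by simp
    next
      case False
      then show ?thesis using iff by simp
    qed
  qed
  also have "\<dots> = parity n * dcell a \<beta> \<xi> (mirror a x2 (flip_even n)) F G"
    unfolding dcell_def set_lebesgue_integral_def by simp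
  finally show ?thesis .
qed

text \<open>After relabelling the images, \<open>cells\<close> is the integral over the finitely
  many lines and cells of a box; the boxes exhaust the family, and integrability over the whole
  family provides the dominating function.\<close>

lemma cells_tendsto_integral:
  assumes \<sigma>: "\<sigma> \<in> {1, - 1 :: int}" and x1: "\<bar>x1\<bar> < a"
  shows "(\<lambda>K. cells a \<sigma> x1 x2 F G K) \<longlonglongrightarrow>
    (LINT p|(count_space UNIV \<Otimes>\<^sub>M lborel). (case p of (k::int, s) \<Rightarrow> lineint a (of_int \<sigma> * a) (x1 - 4 * of_int k * a) x2 F G s))"
proof -
  interpret pair_sigma_finite "count_space (UNIV :: int set)" "lborel :: real measure" by (rule sigma_finite_lines)
  let ?\<beta> = "of_int \<sigma> * a :: real"
  let ?L = "\<lambda>p. case p of (k::int, s) \<Rightarrow> lineint a ?\<beta> (x1 - 4 * of_int k * a) x2 F G s"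
  let ?M = "count_space (UNIV :: int set) \<Otimes>\<^sub>M (lborel :: real measure)"
  let ?A = "\<lambda>K::nat. {- int K..int K}" and ?B = "\<lambda>K::nat. {- (2 * int K)..2 * int K}"
  define h where "h = (\<lambda>K p. \<Sum>k\<in>?A K. \<Sum>n\<in>?B K. indicator ({k} \<times> cell a n) p *\<^sub>R ?L p)"
  have L: "integrable ?M ?L" by (rule lineint_integrable[OF \<sigma> x1])
  have set: "{k} \<times> cell a n \<in> sets ?M" for k n by (simp add: cell_def)
  have piece: "integrable ?M (\<lambda>p. indicator ({k} \<times> cell a n) p *\<^sub>R ?L p)" for k n
    by (rule integrable_mult_indicator[OF set L])
  \<comment> \<open>The line shifted by \<open>4 * k * a\<close>, seen from the source, is the side
    seen from the source shifted back, the image with index \<open>2 * (- k)\<close>.\<close>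
  have piece_int: "(LINT p|?M. indicator ({k} \<times> cell a n) p *\<^sub>R ?L p) = parity n * dcell a ?\<beta> (mirror a x1 (2 * (- k))) (mirror a x2 (flip_even n)) F G" for k n
  proof -
    have "(LINT p|?M. indicator ({k} \<times> cell a n) p *\<^sub>R ?L p) = (LINT k'|count_space UNIV. LINT s|lborel. indicator ({k} \<times> cell a n) (k', s) *\<^sub>R ?L (k', s))"
      by (rule integral_fst'[OF piece, symmetric])
    also have "\<dots> = (LINT k'|count_space UNIV. (if k' = k then LINT s:cell a n|lborel. lineint a ?\<beta> (x1 - 4 * of_int k * a) x2 F G s else 0))"
      by (intro Bochner_Integration.integral_cong) (auto simp: set_lebesgue_integral_def indicator_def)
    also have "\<dots> = (\<Sum>k'\<in>{k}. if k' = k then LINT s:cell a n|lborel. lineint a ?\<beta> (x1 - 4 * of_int k * a) x2 F G s else 0)"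
      by (subst lebesgue_integral_count_space_finite_support)
        (auto intro!: sum.mono_neutral_cong_left split: if_splits)
    finally show ?thesis by (simp add: lineint_cell mirror_def)
  qed
  have h_int: "(LINT p|?M. h K p) = cells a \<sigma> x1 x2 F G K" for K
  proof -
    have "(LINT p|?M. h K p) = (\<Sum>k\<in>?A K. \<Sum>n\<in>?B K. parity n * dcell a ?\<beta> (mirror a x1 (2 * (- k))) (mirror a x2 (flip_even n)) F G)"
      unfolding h_def
      by (subst Bochner_Integration.integral_sum, intro Bochner_Integration.integrable_sum piece)
        (subst Bochner_Integration.integral_sum, rule piece, simp only: piece_int)
    also have "\<dots> = (\<Sum>k\<in>?A K. \<Sum>n\<in>?B K. parity n * dcell a ?\<beta> (mirror a x1 (2 * k)) (mirror a x2 (flip_even n)) F G)"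
      by (rule sum.reindex_bij_witness[where i=uminus and j=uminus]) auto
    also have "\<dots> = cells a \<sigma> x1 x2 F G K"
    proof -
      have B: "flip_even n \<in> ?B K" if "n \<in> ?B K" for n
      proof -
        have "\<bar>flip_even n\<bar> \<le> 2 * int K" using that by (auto simp: flip_even_simps)
        then show ?thesis by auto
      qed
      show ?thesis
        unfolding cells_def
        by (rule sum.cong[OF refl], rule sum.reindex_bij_witness[where i=flip_even and j=flip_even])
          (use B in \<open>simp_all only: flip_even_simps\<close>)
    qed
    finally show ?thesis .
  qed
  have h_eq: "h K (k, s) = (if k \<in> ?A K \<and> cellno a s \<in> ?B K then ?L (k, s) else 0)" for K k s
  proof (cases "\<exists>m::int. s = (2 * of_int m + 1) * a")
    case True
    then have "?L (k, s) = 0" by (simp add: lineint_def)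
    then have "h K (k, s) = 0" unfolding h_def
      by (intro sum.neutral ballI) (auto simp: indicator_def)
    then show ?thesis using \<open>?L (k, s) = 0\<close> by simp
  next
    case False
    have "s \<in> cell a n \<longleftrightarrow> n = cellno a s" for n
      using cellno_eq[OF a, of s n] in_cell_cellno[OF a False] by auto
    then have "indicator ({k'} \<times> cell a n) (k, s) *\<^sub>R ?L (k, s) = (if k' = k then if n = cellno a s then ?L (k, s) else 0 else 0)" for k' n
      by (auto simp: indicator_def)
    then have "h K (k, s) = (\<Sum>k'\<in>?A K. \<Sum>n\<in>?B K. if k' = k then if n = cellno a s then ?L (k, s) else 0 else 0)"
      unfolding h_def by (simp only:)
    also have "\<dots> = (\<Sum>k'\<in>?A K. if k' = k then \<Sum>n\<in>?B K. if n = cellno a s then ?L (k, s) else 0 else 0)"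
      by (intro sum.cong refl) auto
    also have "\<dots> = (if k \<in> ?A K \<and> cellno a s \<in> ?B K then ?L (k, s) else 0)" by simp
    finally show ?thesis .
  qed
  have "(\<lambda>K. LINT p|?M. h K p) \<longlonglongrightarrow> (LINT p|?M. ?L p)"
  proof (rule integral_dominated_convergence[where w="\<lambda>p. norm (?L p)"])
    show "?L \<in> borel_measurable ?M" using L by (rule borel_measurable_integrable)
    show "h K \<in> borel_measurable ?M" for K
      unfolding h_def by (intro borel_measurable_sum borel_measurable_integrable[OF piece])
    show "integrable ?M (\<lambda>p. norm (?L p))" using L by (rule integrable_norm)
    show "AE p in ?M. norm (h K p) \<le> norm (?L p)" for K
      by (intro AE_I2) (use h_eq in \<open>force split: if_splits\<close>)
    show "AE p in ?M. (\<lambda>K. h K p) \<longlonglongrightarrow> ?L p"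
    proof (intro AE_I2)
      fix p :: "int \<times> real"
      obtain k s where p: "p = (k, s)" by (cases p)
      have "\<forall>\<^sub>F K in sequentially. h K p = ?L p"
        using eventually_ge_at_top[of "nat (\<bar>k\<bar> + \<bar>cellno a s\<bar>)"]
        by eventually_elim (auto simp: p h_eq)
      then show "(\<lambda>K. h K p) \<longlonglongrightarrow> ?L p" by (rule tendsto_eventually)
    qed
  qed
  then show ?thesis unfolding h_int .
qed

end

section \<open>Changes of variables\<close>

lemma lborel_substitution:
  fixes g g' h :: "real \<Rightarrow> real"
  assumes S: "S \<in> sets borel" "g ` S \<in> sets borel"
    and d: "\<And>x. x \<in> S \<Longrightarrow> (g has_field_derivative g' x) (at x within S)" and inj: "inj_on g S"
    and h: "h \<in> borel_measurable borel"
    and i: "set_integrable lborel S (\<lambda>x. \<bar>g' x\<bar> * h (g x))"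
  shows "set_integrable lborel (g ` S) h"
    "(LINT x:g ` S|lborel. h x) = (LINT x:S|lborel. \<bar>g' x\<bar> * h (g x))"
proof -
  \<comment> \<open>For Borel measurable integrands the completed measure gives the same integrals,
    so the substitution rule for Lebesgue measure applies.\<close>
  have conv: "set_integrable lebesgue A k \<longleftrightarrow> set_integrable lborel A k"
    "(LINT x:A|lebesgue. k x) = (LINT x:A|lborel. k x)"
    if "(\<lambda>x. indicator A x *\<^sub>R k x) \<in> borel_measurable lborel" for A and k :: "real \<Rightarrow> real"
    using integrable_completion[OF that] integral_completion[OF that]
    unfolding set_integrable_def set_lebesgue_integral_def by auto
  have m1: "(\<lambda>x. indicator S x *\<^sub>R (\<bar>g' x\<bar> * h (g x))) \<in> borel_measurable lborel"
    using i unfolding set_integrable_def by (rule borel_measurable_integrable)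
  have m2: "(\<lambda>x. indicator (g ` S) x *\<^sub>R h x) \<in> borel_measurable lborel"
    using S(2) h by simp
  have ai: "(\<lambda>x. \<bar>g' x\<bar> * h (g x)) absolutely_integrable_on S" using i conv(1)[OF m1] by simp
  have "S \<in> sets lebesgue" using S(1) by simp
  from has_absolute_integral_change_of_variables_1'[OF this d inj, where f=h and b="integral S (\<lambda>x. \<bar>g' x\<bar> * h (g x))"] ai
  have *: "h absolutely_integrable_on g ` S" "integral (g ` S) h = integral S (\<lambda>x. \<bar>g' x\<bar> * h (g x))"
    by auto
  show "set_integrable lborel (g ` S) h" using *(1) conv(1)[OF m2] by simp
  show "(LINT x:g ` S|lborel. h x) = (LINT x:S|lborel. \<bar>g' x\<bar> * h (g x))"
    using *(2) set_lebesgue_integral_eq_integral(2)[OF *(1)] set_lebesgue_integral_eq_integral(2)[OF ai]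
      conv(2)[OF m1] conv(2)[OF m2] by simp
qed

text \<open>With \<open>r = sqrt (\<rho>^2 + q^2)\<close> the singular root is \<open>q\<close>
  itself and cancels against the Jacobian \<open>q / r\<close>. This is the passage from the kernel
  of the formula to the three-dimensional one.\<close>

lemma radial_substitution:
  fixes D :: "real \<Rightarrow> real"
  assumes \<rho>: "0 < \<rho>" and D: "continuous_on {0<..} D"
    and i: "set_integrable lborel {0..} (\<lambda>q. c * D (sqrt (\<rho>\<^sup>2 + q\<^sup>2)) / sqrt (\<rho>\<^sup>2 + q\<^sup>2))"
  shows "set_integrable lborel {\<rho>..} (\<lambda>r. D r * (c / sqrt (r\<^sup>2 - \<rho>\<^sup>2)))"
    "(LINT r:{\<rho>..}|lborel. D r * (c / sqrt (r\<^sup>2 - \<rho>\<^sup>2))) = (LINT q:{0..}|lborel. c * D (sqrt (\<rho>\<^sup>2 + q\<^sup>2)) / sqrt (\<rho>\<^sup>2 + q\<^sup>2))"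
proof -
  let ?g = "\<lambda>q. sqrt (\<rho>\<^sup>2 + q\<^sup>2)" and ?k = "\<lambda>q. c * D (sqrt (\<rho>\<^sup>2 + q\<^sup>2)) / sqrt (\<rho>\<^sup>2 + q\<^sup>2)"
  \<comment> \<open>The indicator extends \<open>D\<close>, continuous only at positive arguments,
    to a Borel function on the line.\<close>
  define h where "h = (\<lambda>r. indicator {0<..} r *\<^sub>R D r * (c / sqrt (r\<^sup>2 - \<rho>\<^sup>2)))"
  have p: "0 < \<rho>\<^sup>2 + q\<^sup>2" for q using \<rho> by (intro add_pos_nonneg) auto
  have gp: "0 < ?g q" for q using p by simp
  have image: "?g ` {0<..} = {\<rho><..}"
  proof (intro equalityI subsetI)
    fix r assume "r \<in> ?g ` {0<..}"
    then obtain q where q: "0 < q" "r = ?g q" by auto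
    have "sqrt (\<rho>\<^sup>2) < ?g q" using q by (intro real_sqrt_less_mono) simp
    then show "r \<in> {\<rho><..}" using q \<rho> by simp
  next
    fix r assume r: "r \<in> {\<rho><..}"
    then have "\<rho>\<^sup>2 < r\<^sup>2" using \<rho> by (intro power_strict_mono) auto
    then have q: "0 < sqrt (r\<^sup>2 - \<rho>\<^sup>2)" "?g (sqrt (r\<^sup>2 - \<rho>\<^sup>2)) = r" using r \<rho> by auto
    show "r \<in> ?g ` {0<..}" by (rule image_eqI[where x="sqrt (r\<^sup>2 - \<rho>\<^sup>2)"]) (use q in simp_all)
  qed
  have hm: "h \<in> borel_measurable borel"
    unfolding h_def using borel_measurable_continuous_on_indicator[OF _ D] by measurable
  have hg: "\<bar>q / ?g q\<bar> * h (?g q) = ?k q" if "q \<in> {0<..}" for q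
  proof -
    have "sqrt ((?g q)\<^sup>2 - \<rho>\<^sup>2) = q" using that p[of q] by simp
    then show ?thesis using that gp[of q] by (simp add: h_def)
  qed
  have i': "set_integrable lborel {0<..} ?k"
    by (rule set_integrable_subset[OF i]) auto
  have "set_integrable lborel {0<..} (\<lambda>q. \<bar>q / ?g q\<bar> * h (?g q)) = set_integrable lborel {0<..} ?k"
    by (rule set_integrable_cong) (use hg in auto)
  then have i2: "set_integrable lborel {0<..} (\<lambda>q. \<bar>q / ?g q\<bar> * h (?g q))" using i' by simp
  have d: "(?g has_field_derivative q / ?g q) (at q within {0<..})" for q
    using p[of q] by (auto intro!: derivative_eq_intros simp: field_simps)
  have inj: "inj_on ?g {0<..}"
    by (rule inj_onI) (auto simp: power2_eq_iff_nonneg)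
  have gS: "?g ` {0<..} \<in> sets borel" unfolding image by simp
  note sub = lborel_substitution[OF _ gS d inj hm i2, unfolded image]
  \<comment> \<open>The closed and the open half line agree pointwise: at \<open>r = \<rho>\<close>
    the quotient is \<open>c / 0 = 0\<close>.\<close>
  have H: "indicator {\<rho><..} r *\<^sub>R h r = indicator {\<rho>..} r *\<^sub>R (D r * (c / sqrt (r\<^sup>2 - \<rho>\<^sup>2)))" for r
    using \<rho> by (cases "r = \<rho>") (auto simp: indicator_def h_def)
  show "set_integrable lborel {\<rho>..} (\<lambda>r. D r * (c / sqrt (r\<^sup>2 - \<rho>\<^sup>2)))"
    using sub(1) unfolding set_integrable_def H by simp
  have "(LINT r:{\<rho>..}|lborel. D r * (c / sqrt (r\<^sup>2 - \<rho>\<^sup>2))) = (LINT q:{0<..}|lborel. \<bar>q / ?g q\<bar> * h (?g q))"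
    using sub(2) unfolding set_lebesgue_integral_def H by simp
  also have "\<dots> = (LINT q:{0<..}|lborel. ?k q)"
    by (rule set_lebesgue_integral_cong) (use hg in auto)
  also have "\<dots> = (LINT q:{0..}|lborel. ?k q)"
    unfolding set_lebesgue_integral_def
  proof (rule integral_cong_AE)
    show "AE q in lborel. indicator {0<..} q *\<^sub>R ?k q = indicator {0..} q *\<^sub>R ?k q"
      using AE_lborel_singleton[of 0] by eventually_elim (auto simp: indicator_def)
  qed (use i i' in \<open>auto simp: set_integrable_def intro: borel_measurable_integrable\<close>)
  finally show "(LINT r:{\<rho>..}|lborel. D r * (c / sqrt (r\<^sup>2 - \<rho>\<^sup>2))) = (LINT q:{0..}|lborel. ?k q)" .
qed

context wave begin

text \<open>Setting \<open>r = s * sin \<phi>\<close> lifts Poisson's integral over the disc of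
  radius \<open>s\<close> to the half sphere above it, whose area element absorbs the singular
  root.\<close>

lemma spherical_substitution:
  assumes s: "0 < s"
  shows "(LINT r:{0..s}|lborel. (1 / (2 * pi) * integral {0..2 * pi} (\<lambda>\<theta>. f (y1 + r * cos \<theta>, y2 + r * sin \<theta>))) * r / sqrt (s\<^sup>2 - r\<^sup>2))
    = u (y1, y2, s)"
proof -
  define m where "m = (\<lambda>r. 1 / (2 * pi) * integral (cbox 0 (2 * pi)) (\<lambda>\<theta>. f (y1 + r * cos \<theta>, y2 + r * sin \<theta>)))"
  have cm: "continuous_on S m" for S
    unfolding m_def
    by (intro continuous_intros integral_continuous_on_param)
      (auto simp: split_beta intro!: continuous_intros continuous_on_compose2[OF cf])
  define h where "h = (\<lambda>r. m r * r / sqrt (s\<^sup>2 - r\<^sup>2))"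
  let ?S = "{0..pi / 2}" and ?g = "\<lambda>\<phi>. s * sin \<phi>" and ?k = "\<lambda>\<phi>. m (s * sin \<phi>) * (s * sin \<phi>)"
  have image: "?g ` ?S = {0..s}"
  proof (intro equalityI subsetI)
    fix r assume r: "r \<in> {0..s}"
    then have "r = ?g (arcsin (r / s))" "arcsin (r / s) \<in> ?S"
      using s arcsin_le_arcsin[of 0 "r / s"] arcsin_bounded[of "r / s"] by (auto simp: field_simps)
    then show "r \<in> ?g ` ?S" by blast
  next
    fix r assume "r \<in> ?g ` ?S"
    then obtain \<phi> where \<phi>: "\<phi> \<in> ?S" "r = s * sin \<phi>" by blast
    then have "0 \<le> sin \<phi>" by (auto intro!: sin_ge_zero)
    moreover have "s * sin \<phi> \<le> s * 1" using s by (intro mult_left_mono) auto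
    ultimately show "r \<in> {0..s}" using \<phi> s by auto
  qed
  have inj: "inj_on ?g ?S"
  proof (rule inj_onI)
    fix \<phi> \<psi> assume "\<phi> \<in> ?S" "\<psi> \<in> ?S" "s * sin \<phi> = s * sin \<psi>"
    then show "\<phi> = \<psi>" using s sin_inj_pi[of \<phi> \<psi>] by auto
  qed
  have hm: "h \<in> borel_measurable borel"
    unfolding h_def using borel_measurable_continuous_onI[OF cm] by measurable
  have ck: "continuous_on ?S ?k"
    by (intro continuous_intros continuous_on_compose2[OF cm[of UNIV]]) auto
  \<comment> \<open>At the equator \<open>\<phi> = pi / 2\<close> the cosine vanishes and the
    cancellation fails; that single angle is a null set.\<close>
  have hg: "\<bar>s * cos \<phi>\<bar> * h (s * sin \<phi>) = ?k \<phi>" if "\<phi> \<in> ?S" "\<phi> \<noteq> pi / 2" for \<phi>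
  proof -
    have c: "0 < cos \<phi>" using that by (intro cos_gt_zero_pi) auto
    have "s\<^sup>2 - (s * sin \<phi>)\<^sup>2 = (s * cos \<phi>)\<^sup>2" by (simp add: power_mult_distrib cos_squared_eq algebra_simps)
    then have "sqrt (s\<^sup>2 - (s * sin \<phi>)\<^sup>2) = s * cos \<phi>" using c s by simp
    then show ?thesis using c s by (simp add: h_def)
  qed
  have ae: "AE \<phi> in lborel. indicator ?S \<phi> *\<^sub>R (\<bar>s * cos \<phi>\<bar> * h (s * sin \<phi>)) = indicator ?S \<phi> *\<^sub>R ?k \<phi>"
    using AE_lborel_singleton[of "pi / 2"] by eventually_elim (use hg in \<open>auto simp: indicator_def\<close>)
  have m1: "(\<lambda>\<phi>. indicator ?S \<phi> *\<^sub>R (\<bar>s * cos \<phi>\<bar> * h (s * sin \<phi>))) \<in> borel_measurable lborel"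
    using hm by measurable
  have ik: "set_integrable lborel ?S ?k" by (rule borel_integrable_atLeastAtMost'[OF ck])
  then have m2: "(\<lambda>\<phi>. indicator ?S \<phi> *\<^sub>R ?k \<phi>) \<in> borel_measurable lborel"
    unfolding set_integrable_def by (rule borel_measurable_integrable)
  have i: "set_integrable lborel ?S (\<lambda>\<phi>. \<bar>s * cos \<phi>\<bar> * h (s * sin \<phi>))"
    using ik integrable_cong_AE[OF m1 m2 ae] unfolding set_integrable_def by simp
  have gS: "?g ` ?S \<in> sets borel" unfolding image by simp
  have d: "(?g has_field_derivative s * cos \<phi>) (at \<phi> within ?S)" for \<phi>
    by (auto intro!: derivative_eq_intros)
  have "(LINT r:{0..s}|lborel. h r) = (LINT \<phi>:?S|lborel. \<bar>s * cos \<phi>\<bar> * h (s * sin \<phi>))"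
    using lborel_substitution(2)[OF _ gS d inj hm i] unfolding image by simp
  also have "\<dots> = (LINT \<phi>:?S|lborel. ?k \<phi>)"
    unfolding set_lebesgue_integral_def by (rule integral_cong_AE[OF m1 m2 ae])
  also have "\<dots> = integral (cbox 0 (pi / 2)) ?k"
    unfolding cbox_interval by (rule set_borel_integral_eq_integral(2)[OF ik])
  also have "\<dots> = integral (cbox 0 (pi / 2)) (\<lambda>\<phi>. s / (2 * pi) * integral (cbox 0 (2 * pi)) (\<lambda>\<theta>. sin \<phi> * f (y1 + s * (sin \<phi> * cos \<theta>), y2 + s * (sin \<phi> * sin \<theta>))))"
  proof -
    have "?k \<phi> = s / (2 * pi) * integral (cbox 0 (2 * pi)) (\<lambda>\<theta>. sin \<phi> * f (y1 + s * (sin \<phi> * cos \<theta>), y2 + s * (sin \<phi> * sin \<theta>)))" for \<phi>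
      unfolding integral_mult_right m_def by (simp add: mult.assoc)
    then show ?thesis by (simp only:)
  qed
  also have "\<dots> = s / (2 * pi) * integral (cbox 0 (pi / 2)) (\<lambda>\<phi>. integral (cbox 0 (2 * pi)) (\<lambda>\<theta>. sin \<phi> * f (y1 + s * (sin \<phi> * cos \<theta>), y2 + s * (sin \<phi> * sin \<theta>))))"
    by (simp only: integral_mult_right)
  also have "\<dots> = s / (2 * pi) * integral quarter (\<lambda>v. sin (fst v) * f (y1 + s * sx v, y2 + s * sy v))"
    using integral_prod_continuous[OF continuous_on_hmean_integrand[OF cw(1) cf]] by (simp only: fst_conv snd_conv)
  also have "\<dots> = u (y1, y2, s)" by (simp add: u_def hmean_def)
  finally show ?thesis by (simp add: h_def m_def)
qed

lemma wave_solution_eq: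
  assumes g: "\<And>x. g x = f (x $ 1, x $ 2)" and t: "0 < t"
  shows "wave_solution g x t = ut (x $ 1, x $ 2, t)"
proof -
  have circ: "circular_mean g x r = 1 / (2 * pi) * integral {0..2 * pi} (\<lambda>\<theta>. f (x $ 1 + r * cos \<theta>, x $ 2 + r * sin \<theta>))" for r
  proof -
    have "continuous_on {0..2 * pi} (\<lambda>\<theta>. f (x $ 1 + r * cos \<theta>, x $ 2 + r * sin \<theta>))"
      by (intro continuous_on_compose2[OF cf] continuous_intros) auto
    then show ?thesis
      unfolding circular_mean_def g
      by (simp add: set_borel_integral_eq_integral(2)[OF borel_integrable_atLeastAtMost'])
  qed
  have "((\<lambda>s. u (x $ 1, x $ 2, s)) has_real_derivative ut (x $ 1, x $ 2, t)) (at t within {0..})"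
    using has_grad3_chain[OF grad_u, of "\<lambda>_. x $ 1" 0 t "{0..}" "\<lambda>_. x $ 2" 0 "\<lambda>s. s" 1] by auto
  then have "((\<lambda>s. u (x $ 1, x $ 2, s)) has_vector_derivative ut (x $ 1, x $ 2, t)) (at t within {0..})"
    by (simp add: has_real_derivative_iff_has_vector_derivative)
  then have "((\<lambda>s. LINT r:{0..s}|lborel. circular_mean g x r * r / sqrt (s\<^sup>2 - r\<^sup>2)) has_vector_derivative ut (x $ 1, x $ 2, t)) (at t within {0..})"
  proof (rule has_vector_derivative_transform_within[OF _ t])
    fix s assume "s \<in> {0..}" "dist s t < t"
    then have "0 < s" by (auto simp: dist_real_def)
    then show "u (x $ 1, x $ 2, s) = (LINT r:{0..s}|lborel. circular_mean g x r * r / sqrt (s\<^sup>2 - r\<^sup>2))"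
      unfolding circ by (rule spherical_substitution[symmetric])
  qed (use t in simp)
  moreover have "at t within {0..} = at t" using t by (intro at_within_open_subset[of t "{0<..}"]) auto
  ultimately show ?thesis
    unfolding wave_solution_def by (simp add: vector_derivative_at)
qed

end

section \<open>The reconstruction formula\<close>

lemma derivative_extend_by_zero:
  fixes h :: "'a::real_normed_vector \<Rightarrow> 'b::real_normed_vector" and h' :: "'a \<Rightarrow> 'a \<Rightarrow>\<^sub>L 'b"
  assumes S: "open S" and K: "closed K" "K \<subseteq> S"
    and h: "\<And>x. x \<in> S \<Longrightarrow> (h has_derivative blinfun_apply (h' x)) (at x)"
    and z: "\<And>x. x \<in> S - K \<Longrightarrow> h x = 0"
  shows "x \<in> S - K \<Longrightarrow> h' x = 0"
    and "((\<lambda>x. if x \<in> S then h x else 0) has_derivative blinfun_apply (if y \<in> S then h' y else 0)) (at y)"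
proof -
  have zero: "h' x = 0" if x: "x \<in> S - K" for x
  proof -
    have o: "open (S - K)" using S K(1) by (rule open_Diff)
    have "((\<lambda>x. 0) has_derivative blinfun_apply (h' x)) (at x)"
      by (rule has_derivative_transform_within_open[OF h o x]) (use x z in auto)
    then have "blinfun_apply (h' x) = (\<lambda>_. 0)" by (rule has_derivative_unique) simp
    then show ?thesis by (intro blinfun_eqI) simp
  qed
  then show "x \<in> S - K \<Longrightarrow> h' x = 0" .
  show "((\<lambda>x. if x \<in> S then h x else 0) has_derivative blinfun_apply (if y \<in> S then h' y else 0)) (at y)"
  proof (cases "y \<in> S")
    case True
    have "((\<lambda>x. if x \<in> S then h x else 0) has_derivative blinfun_apply (h' y)) (at y)"
      by (rule has_derivative_transform_within_open[OF h[OF True] S True]) simp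
    then show ?thesis using True by simp
  next
    case False
    then have y: "y \<in> - K" using K(2) by auto
    have "((\<lambda>x. if x \<in> S then h x else 0) has_derivative (\<lambda>_. 0)) (at y)"
      by (rule has_derivative_transform_within_open[OF has_derivative_const _ y]) (use K(1) z in auto)
    then show ?thesis using False by (simp add: zero_blinfun.rep_eq)
  qed
qed

text \<open>The derivatives supplied by \<open>C2_on\<close> are arbitrary off \<open>S\<close> and
  are replaced by zero there. \<open>S\<close> and the complement of the support form an open cover,
  and on the overlap all derivatives vanish, so the two definitions fit together.\<close>

lemma C2_extend_by_zero:
  fixes g :: "'a::real_normed_vector \<Rightarrow> real"
  assumes S: "open S" and g: "C2_compact_support S g"
  obtains G' :: "'a \<Rightarrow> 'a \<Rightarrow>\<^sub>L real" and G'' :: "'a \<Rightarrow> 'a \<Rightarrow>\<^sub>L ('a \<Rightarrow>\<^sub>L real)"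
  where "\<And>x. (g has_derivative blinfun_apply (G' x)) (at x)"
    "\<And>x. (G' has_derivative blinfun_apply (G'' x)) (at x)"
    "continuous_on UNIV G''" "\<And>x. x \<notin> S \<Longrightarrow> g x = 0 \<and> G' x = 0 \<and> G'' x = 0"
proof -
  obtain g' :: "'a \<Rightarrow> 'a \<Rightarrow>\<^sub>L real" and g'' :: "'a \<Rightarrow> 'a \<Rightarrow>\<^sub>L ('a \<Rightarrow>\<^sub>L real)"
    where g': "\<And>x. x \<in> S \<Longrightarrow> (g has_derivative blinfun_apply (g' x)) (at x)"
      and g'': "\<And>x. x \<in> S \<Longrightarrow> (g' has_derivative blinfun_apply (g'' x)) (at x)"
      and c: "continuous_on S g''"
    using g unfolding C2_compact_support_def C2_on_def by blast
  define K where "K = closure {x. g x \<noteq> 0}"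
  have K: "closed K" "K \<subseteq> S" using g unfolding K_def C2_compact_support_def by auto
  have z: "g x = 0" if "x \<notin> K" for x
    using that closure_subset[of "{x. g x \<noteq> 0}"] unfolding K_def by auto
  define G' where "G' = (\<lambda>x. if x \<in> S then g' x else 0)"
  define G'' where "G'' = (\<lambda>x. if x \<in> S then g'' x else 0)"
  have z': "g' x = 0" if "x \<in> S - K" for x
    using derivative_extend_by_zero(1)[OF S K g' _ that] z by auto
  have z'': "g'' x = 0" if "x \<in> S - K" for x
    using derivative_extend_by_zero(1)[OF S K g'' _ that] z' by auto
  have e: "(\<lambda>x. if x \<in> S then g x else 0) = g"
  proof
    show "(if x \<in> S then g x else 0) = g x" for x using z[of x] K(2) by auto
  qed
  have "(g has_derivative blinfun_apply (G' x)) (at x)" for x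
    using derivative_extend_by_zero(2)[OF S K g', of x] z unfolding G'_def e by auto
  moreover have "(G' has_derivative blinfun_apply (G'' x)) (at x)" for x
    unfolding G'_def G''_def by (rule derivative_extend_by_zero(2)[OF S K g'']) (use z' in auto)
  moreover have "continuous_on (S \<union> - K) G''"
  proof (rule continuous_on_open_Un[OF S])
    show "open (- K)" using K(1) by auto
    show "continuous_on S G''"
      using c by (rule continuous_on_eq) (simp add: G''_def)
    show "continuous_on (- K) G''"
      by (rule continuous_on_eq[OF continuous_on_const[of _ 0]]) (auto simp: G''_def z'')
  qed
  then have "continuous_on UNIV G''" proof -
    assume "continuous_on (S \<union> - K) G''"
    moreover have "S \<union> - K = UNIV" using K(2) by auto
    ultimately show ?thesis by simp
  qed
  moreover have "g x = 0 \<and> G' x = 0 \<and> G'' x = 0" if "x \<notin> S" for x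
    using that z K(2) by (auto simp: G'_def G''_def)
  ultimately show ?thesis by (rule that)
qed

lemma open_square: "open (square a)"
proof -
  have "square a = (\<Inter>i\<in>UNIV. {x. - a < x $ i} \<inter> {x. x $ i < a})" by (auto simp: square_def)
  then show ?thesis
    by (auto intro!: open_INT open_Int open_Collect_less continuous_intros)
qed

lemma wave_of_C2:
  fixes g :: "real^2 \<Rightarrow> real"
  assumes a: "0 < a" and g: "C2_compact_support (square a) g"
  obtains f f1 f2 f11 f12 f22 where "wave f f1 f2 f11 f12 f22 a" "\<And>x. g x = f (x $ 1, x $ 2)"
    "\<And>p. f p \<noteq> 0 \<Longrightarrow> \<bar>fst p\<bar> < a \<and> \<bar>snd p\<bar> < a"
proof -
  obtain G' G'' where G': "\<And>x. (g has_derivative blinfun_apply (G' x)) (at x)"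
    and G'': "\<And>x. (G' has_derivative blinfun_apply (G'' x)) (at x)"
    and c: "continuous_on UNIV G''" and z: "\<And>x. x \<notin> square a \<Longrightarrow> g x = 0 \<and> G' x = 0 \<and> G'' x = 0"
    using C2_extend_by_zero[OF open_square g] by blast
  define v :: "real \<times> real \<Rightarrow> real^2" where "v = (\<lambda>p. fst p *\<^sub>R axis 1 1 + snd p *\<^sub>R axis 2 1)"
  have v_nth: "v p $ 1 = fst p" "v p $ 2 = snd p" for p
    by (simp_all add: v_def axis_def)
  have dv: "(v has_derivative v) (at p)" for p
    unfolding v_def by (auto intro!: derivative_eq_intros)
  have cv: "continuous_on S v" for S unfolding v_def by (intro continuous_intros)
  have vsq: "v p \<in> square a \<longleftrightarrow> \<bar>fst p\<bar> < a \<and> \<bar>snd p\<bar> < a" for p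
    by (auto simp: square_def forall_2 v_nth)
  define F where "F = (\<lambda>p. g (v p))"
  define F' where "F' = (\<lambda>i p. blinfun_apply (G' (v p)) (axis i 1))"
  define F'' where "F'' = (\<lambda>i j p. blinfun_apply (blinfun_apply (G'' (v p)) (axis j 1)) (axis i 1))"
  have gF: "has_grad2 F (F' 1) (F' 2)"
    unfolding has_grad2_def
  proof
    fix p
    show "(F has_derivative (\<lambda>d. F' 1 p * fst d + F' 2 p * snd d)) (at p)"
      unfolding F_def
      by (rule has_derivative_eq_rhs[OF has_derivative_compose[OF dv G']])
        (simp add: F'_def v_def blinfun.bilinear_simps fun_eq_iff mult.commute)
  qed
  have gF': "has_grad2 (F' i) (F'' i 1) (F'' i 2)" for i
    unfolding has_grad2_def
  proof
    fix p
    have "((\<lambda>p. G' (v p)) has_derivative (\<lambda>d. blinfun_apply (G'' (v p)) (v d))) (at p)"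
      by (rule has_derivative_compose[OF dv G''])
    then have "((\<lambda>p. blinfun_apply (G' (v p)) (axis i 1)) has_derivative
        (\<lambda>d. blinfun_apply (blinfun_apply (G'' (v p)) (v d)) (axis i 1))) (at p)"
      by (rule bounded_linear.has_derivative[OF blinfun.bounded_linear_left])
    then show "(F' i has_derivative (\<lambda>d. F'' i 1 p * fst d + F'' i 2 p * snd d)) (at p)"
      unfolding F'_def
      by (rule has_derivative_eq_rhs)
        (simp add: F''_def v_def blinfun.bilinear_simps fun_eq_iff mult.commute)
  qed
  have cF'': "continuous_on UNIV (F'' i j)" for i j
    unfolding F''_def by (intro continuous_intros continuous_on_compose2[OF c cv]) auto
  have sym: "F'' 1 2 = F'' 2 1"
    by (rule has_grad2_mixed_eq[OF gF gF' gF' cF''])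
  have out: "v p \<notin> square a" if "a < \<bar>fst p\<bar> \<or> a < \<bar>snd p\<bar>" for p
    using that by (auto simp: vsq)
  have "wave F (F' 1) (F' 2) (F'' 1 1) (F'' 1 2) (F'' 2 2) a"
  proof
    show "has_grad2 F (F' 1) (F' 2)" by (rule gF)
    show "has_grad2 (F' 1) (F'' 1 1) (F'' 1 2)" by (rule gF')
    show "has_grad2 (F' 2) (F'' 1 2) (F'' 2 2)" unfolding sym by (rule gF')
    fix p :: "real \<times> real" assume "a < \<bar>fst p\<bar> \<or> a < \<bar>snd p\<bar>"
    from z[OF out[OF this]]
    show "F p = 0 \<and> F' 1 p = 0 \<and> F' 2 p = 0 \<and> F'' 1 1 p = 0 \<and> F'' 1 2 p = 0 \<and> F'' 2 2 p = 0"
      by (simp add: F_def F'_def F''_def)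
  qed (use a cF'' in auto)
  moreover have "g x = F (x $ 1, x $ 2)" for x
  proof -
    have "v (x $ 1, x $ 2) = x" by (simp add: vec_eq_iff forall_2 v_nth)
    then show ?thesis by (simp add: F_def)
  qed
  moreover have "\<bar>fst p\<bar> < a \<and> \<bar>snd p\<bar> < a" if "F p \<noteq> 0" for p
    using that z[of "v p"] vsq[of p] by (auto simp: F_def)
  ultimately show ?thesis by (rule that)
qed

lemma square_nth:
  assumes "x \<in> square a"
  shows "\<bar>x $ i\<bar> < a"
proof -
  have "- a < x $ i \<and> x $ i < a" using assms unfolding square_def by blast
  then show ?thesis by linarith
qed

lemma vec2_norm: "norm (x - y :: real^2) = sqrt ((x $ i - y $ i)\<^sup>2 + (x $ other_index i - y $ other_index i)\<^sup>2)"
  using exhaust_2[of i] by (auto simp: norm_vec_def L2_set_def sum_2 add.commute)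

lemma axis_line_point_nth: "axis_line_point i c s $ i = c" "axis_line_point i c s $ other_index i = s"
  using exhaust_2[of i] by (auto simp: axis_line_point_def)

lemma axis_line_point_in_frontier:
  assumes a: "0 < a" and \<sigma>: "\<sigma> \<in> {1, - 1}" and s: "\<bar>s\<bar> < a"
  shows "axis_line_point i (\<sigma> * a) s \<in> frontier (square a)"
proof -
  let ?y = "axis_line_point i (\<sigma> * a) s"
  have "?y \<notin> square a" using \<sigma> axis_line_point_nth[of i "\<sigma> * a" s] by (auto simp: square_def intro!: exI[of _ i])
  moreover have "?y \<in> closure (square a)"
    unfolding closure_sequential
  proof (intro exI conjI allI)
    let ?z = "\<lambda>n. (1 - 1 / (real n + 1)) *\<^sub>R ?y"
    have "(\<lambda>n. 1 / (real n + 1)) \<longlonglongrightarrow> 0"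
      using LIMSEQ_inverse_real_of_nat by (simp add: inverse_eq_divide add.commute)
    then have "?z \<longlonglongrightarrow> (1 - 0) *\<^sub>R ?y" by (intro tendsto_intros)
    then show "?z \<longlonglongrightarrow> ?y" by simp
    fix n
    have t: "0 \<le> 1 - 1 / (real n + 1)" "1 - 1 / (real n + 1) < 1" by (auto simp: field_simps)
    have "\<bar>(1 - 1 / (real n + 1)) * (?y $ k)\<bar> < a" for k
    proof -
      have "\<bar>?y $ k\<bar> \<le> a" using \<sigma> s a by (auto simp: axis_line_point_def)
      then have "\<bar>(1 - 1 / (real n + 1)) * (?y $ k)\<bar> \<le> (1 - 1 / (real n + 1)) * a"
        using t by (simp add: abs_mult mult_left_mono)
      also have "\<dots> < 1 * a" using t a by (intro mult_strict_right_mono) auto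
      finally show ?thesis by simp
    qed
    then have "- a < (1 - 1 / (real n + 1)) * (?y $ k) \<and> (1 - 1 / (real n + 1)) * (?y $ k) < a" for k
      unfolding abs_less_iff by (meson minus_less_iff)
    then show "?z n \<in> square a" unfolding square_def by simp
  qed
  ultimately show ?thesis using open_square[of a] by (simp add: frontier_def interior_open)
qed

section \<open>Replicated data on the lines\<close>

lemma powi_parity: "(-1 :: real) powi n = parity n"
  by (simp add: parity_def power_int_minus_left)

lemma replicate_odd_eq:
  assumes a: "0 < a"
  shows "replicate_odd a h s = (if \<exists>m::int. s = (2 * of_int m + 1) * a then 0 else parity (cellno a s) * h (fold_cell a s))"
proof (cases "\<exists>m::int. s = (2 * of_int m + 1) * a")
  case False
  have mem: "s \<in> cell a n \<longleftrightarrow> \<bar>s - 2 * of_int n * a\<bar> < a" for n by (auto simp: cell_def)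
  have "(THE n::int. \<bar>s - 2 * of_int n * a\<bar> < a) = cellno a s"
  proof (rule the_equality)
    show "\<bar>s - 2 * of_int (cellno a s) * a\<bar> < a"
      using in_cell_cellno[OF a False] unfolding mem .
    show "n = cellno a s" if "\<bar>s - 2 * of_int n * a\<bar> < a" for n
      using that unfolding mem[symmetric] by (rule cellno_eq[OF a, symmetric])
  qed
  then show ?thesis using False by (simp add: replicate_odd_def fold_cell_def powi_parity Let_def)
qed (auto simp: replicate_odd_def)

lemma fold_cell_bound:
  assumes "0 < a" "\<not> (\<exists>m::int. s = (2 * of_int m + 1) * a)"
  shows "\<bar>fold_cell a s\<bar> < a"
  using in_cell_cellno[OF assms] by (auto simp: cell_def fold_cell_def parity_def)

context side_data begin

context
  fixes P :: "real^2 \<Rightarrow> real \<Rightarrow> real" and i :: 2 and \<sigma> :: int and x :: "real^2"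
  assumes \<sigma>: "\<sigma> \<in> {1, - 1}" and x: "x \<in> square a"
    and P: "\<And>s t. \<bar>s\<bar> < a \<Longrightarrow> 0 < t \<Longrightarrow> P (axis_line_point i (of_int \<sigma> * a) s) t = G (of_int \<sigma> * a, s, t)"
    and dG: "\<And>y s t. ((\<lambda>t. G (y, s, t)) has_real_derivative F (y, s, t)) (at t)"
begin

abbreviation (input) "side \<equiv> (i, of_int \<sigma> :: real)"
abbreviation (input) "\<beta> \<equiv> of_int \<sigma> * a :: real"
abbreviation (input) "\<xi> k \<equiv> x $ i - 4 * of_int k * a"

definition datum_deriv :: "real \<Rightarrow> real \<Rightarrow> real" where
  "datum_deriv s r = (if \<exists>m::int. s = (2 * of_int m + 1) * a then 0 else parity (cellno a s) *
     (F (\<beta>, fold_cell a s, r) / r - G (\<beta>, fold_cell a s, r) / r ^ 2))"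

lemma datum_has_derivative:
  assumes r: "0 < r"
  shows "((\<lambda>r. replicated_data a P side y r / r) has_real_derivative datum_deriv (y $ other_index i) r) (at r)"
proof -
  let ?s = "y $ other_index i"
  have rep: "replicated_data a P side y r = (if \<exists>m::int. ?s = (2 * of_int m + 1) * a then 0 else parity (cellno a ?s) * G (\<beta>, fold_cell a ?s, r))"
    if "0 < r" for r
    using that fold_cell_bound[OF a, of ?s] by (simp add: replicated_data_def replicate_odd_eq[OF a] P)
  have "((\<lambda>r. (if \<exists>m::int. ?s = (2 * of_int m + 1) * a then 0 else parity (cellno a ?s) * G (\<beta>, fold_cell a ?s, r)) / r)
      has_real_derivative datum_deriv ?s r) (at r)"
  proof (cases "\<exists>m::int. ?s = (2 * of_int m + 1) * a")
    case True
    then show ?thesis by (simp add: datum_deriv_def)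
  next
    case False
    have A: "((\<lambda>r. parity (cellno a ?s) * (G (\<beta>, fold_cell a ?s, r) / r)) has_real_derivative
       parity (cellno a ?s) * ((F (\<beta>, fold_cell a ?s, r) * r - G (\<beta>, fold_cell a ?s, r) * 1) / (r * r))) (at r)"
      by (intro DERIV_cmult DERIV_divide dG DERIV_ident) (use r in simp)
    have E: "(F (\<beta>, fold_cell a ?s, r) * r - G (\<beta>, fold_cell a ?s, r) * 1) / (r * r) = F (\<beta>, fold_cell a ?s, r) / r - G (\<beta>, fold_cell a ?s, r) / r ^ 2"
      using r by (simp add: field_simps power2_eq_square)
    show ?thesis using A[unfolded E] False by (simp add: datum_deriv_def)
  qed
  then show ?thesis
    by (rule has_field_derivative_transform_within_open[of _ _ _ "{0<..}"]) (use r rep in auto)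
qed

lemma continuous_on_datum_deriv: "continuous_on {0<..} (datum_deriv s)"
proof -
  have "continuous_on {0<..} (\<lambda>r. parity (cellno a s) * (F (\<beta>, fold_cell a s, r) / r - G (\<beta>, fold_cell a s, r) / r ^ 2))"
    by (intro continuous_intros continuous_on_compose2[OF cF] continuous_on_compose2[OF cG]) auto
  then show ?thesis
    by (cases "\<exists>m::int. s = (2 * of_int m + 1) * a") (simp_all add: datum_deriv_def)
qed

definition inner_integral :: "real^2 \<Rightarrow> real" where
  "inner_integral y = (LINT r:{norm (x - y)..}|lborel.
     deriv (\<lambda>r. replicated_data a P side y r / r) r
       * ((outer_normal side \<bullet> (x - y)) / sqrt (r\<^sup>2 - (norm (x - y))\<^sup>2)))"

lemma side_ne: "\<beta> \<noteq> \<xi> k"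
proof -
  have "\<bar>x $ i\<bar> < a" by (rule square_nth[OF x])
  from mirror_ne_side[OF \<sigma> this, of "2 * - k"] show ?thesis by (simp add: mirror_def algebra_simps)
qed

text \<open>The distance from \<open>x\<close> to a point of line \<open>k\<close> is the distance
  from the shifted source to the corresponding point of the extended side, so
  \<open>radial_substitution\<close> leads to \<open>lineint\<close>. The sign arises because the
  normal is multiplied by \<open>x - y\<close>, whereas \<open>b\<close> points from the source to
  the wall.\<close>

lemma inner_integral:
  assumes y: "y $ i = \<beta> + 4 * of_int k * a"
  shows "0 < norm (x - y)"
    "set_integrable lborel {norm (x - y)..} (\<lambda>r. deriv (\<lambda>r. replicated_data a P side y r / r) r
        * ((outer_normal side \<bullet> (x - y)) / sqrt (r\<^sup>2 - (norm (x - y))\<^sup>2)))"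
    "inner_integral y = - of_int \<sigma> * lineint a \<beta> (\<xi> k) (x $ other_index i) F G (y $ other_index i)"
proof -
  let ?s = "y $ other_index i" and ?xo = "x $ other_index i" and ?\<rho> = "norm (x - y)"
  let ?b = "\<beta> - \<xi> k" and ?c = "outer_normal side \<bullet> (x - y)"
  have b: "?b \<noteq> 0" using side_ne by simp
  have yb: "x $ i - y $ i = - ?b" using y by simp
  have \<rho>: "?\<rho> = sqrt (?b\<^sup>2 + (?s - ?xo)\<^sup>2)"
    unfolding vec2_norm[of x y i] yb by (simp add: power2_commute)
  have \<rho>pos: "0 < ?\<rho>" unfolding \<rho> using b by (intro real_sqrt_gt_zero add_pos_nonneg) auto
  then show "0 < norm (x - y)" .
  have rad: "sqrt (?\<rho>\<^sup>2 + q\<^sup>2) = rad ?b ?xo (?s, q)" for q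
    unfolding \<rho> rad_def by (subst real_sqrt_pow2) (auto intro!: add_nonneg_nonneg)
  have "?c = of_int \<sigma> * (x $ i - y $ i)"
    by (simp add: outer_normal_def inner_axis' inner_diff_right algebra_simps)
  then have c: "?c = - of_int \<sigma> * ?b"
    unfolding yb by (simp only: mult_minus_left mult_minus_right)
  let ?K = "\<lambda>q. ?c * datum_deriv ?s (sqrt (?\<rho>\<^sup>2 + q\<^sup>2)) / sqrt (?\<rho>\<^sup>2 + q\<^sup>2)"
  have K: "set_integrable lborel {0..} ?K \<and> (LINT q:{0..}|lborel. ?K q) = - of_int \<sigma> * lineint a \<beta> (\<xi> k) ?xo F G ?s"
  proof (cases "\<exists>m::int. ?s = (2 * of_int m + 1) * a")
    case True
    then show ?thesis by (simp add: datum_deriv_def lineint_def set_integrable_def set_lebesgue_integral_def)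
  next
    case False
    let ?n = "cellno a ?s"
    let ?\<eta> = "mirror a ?xo (flip_even ?n)"
    have cell: "?s \<in> cell a ?n" using in_cell_cellno[OF a False] .
    have fold: "parity ?n * (?s - 2 * of_int ?n * a) = fold_cell a ?s" by (simp add: fold_cell_def)
    have r: "rad ?b ?\<eta> (fold_cell a ?s, q) = rad ?b ?xo (?s, q)" for q
    proof -
      have "(fold_cell a ?s - ?\<eta>)\<^sup>2 = (?s - ?xo)\<^sup>2"
        by (auto simp: fold_cell_def parity_def mirror_def flip_even_def power2_eq_square algebra_simps)
      then show ?thesis by (simp add: rad_def)
    qed
    have eq: "?K q = - of_int \<sigma> * parity ?n * dkern \<beta> (\<xi> k) ?\<eta> F G (fold_cell a ?s, q)" for q
      unfolding rad c dkern_def r fst_conv using False by (simp add: datum_deriv_def)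
    have "set_integrable lborel {0..} (\<lambda>q. - of_int \<sigma> * parity ?n * dkern \<beta> (\<xi> k) ?\<eta> F G (fold_cell a ?s, q))"
      using \<sigma> a fold_cell_bound[OF a False]
      by (intro set_integrable_mult_right dkern_integrable side_ne) auto
    moreover have "(LINT q:{0..}|lborel. - of_int \<sigma> * parity ?n * dkern \<beta> (\<xi> k) ?\<eta> F G (fold_cell a ?s, q))
        = - of_int \<sigma> * lineint a \<beta> (\<xi> k) ?xo F G ?s"
      unfolding lineint_eq_dline[OF a cell] fold dline_def set_integral_mult_right by simp
    ultimately show ?thesis unfolding eq by blast
  qed
  have deriv: "deriv (\<lambda>r. replicated_data a P side y r / r) r = datum_deriv ?s r" if "r \<in> {?\<rho>..}" for r
    by (rule DERIV_imp_deriv[OF datum_has_derivative[OF less_le_trans[OF \<rho>pos]]]) (use that in simp)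
  note rs = radial_substitution[OF \<rho>pos continuous_on_datum_deriv K[THEN conjunct1]]
  have cong: "indicator {?\<rho>..} r *\<^sub>R (deriv (\<lambda>r. replicated_data a P side y r / r) r * (?c / sqrt (r\<^sup>2 - ?\<rho>\<^sup>2)))
      = indicator {?\<rho>..} r *\<^sub>R (datum_deriv ?s r * (?c / sqrt (r\<^sup>2 - ?\<rho>\<^sup>2)))" for r
    using deriv[of r] by (simp add: indicator_def)
  show "set_integrable lborel {norm (x - y)..} (\<lambda>r. deriv (\<lambda>r. replicated_data a P side y r / r) r
        * (?c / sqrt (r\<^sup>2 - (norm (x - y))\<^sup>2)))"
    using rs(1) unfolding set_integrable_def cong .
  show "inner_integral y = - of_int \<sigma> * lineint a \<beta> (\<xi> k) ?xo F G ?s"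
    using rs(2) K[THEN conjunct2] unfolding inner_integral_def set_lebesgue_integral_def cong by simp
qed

lemma lines_integral:
  shows "set_integrable (arc_length a side) (\<Union>(line_family a side)) inner_integral"
    "(LINT y:\<Union>(line_family a side)|arc_length a side. inner_integral y) =
      - of_int \<sigma> * (LINT p|(count_space UNIV \<Otimes>\<^sub>M lborel). (case p of (k::int, s) \<Rightarrow> lineint a \<beta> (\<xi> k) (x $ other_index i) F G s))"
proof -
  let ?A = "\<Union>(line_family a side)" and ?xo = "x $ other_index i"
  let ?M = "count_space (UNIV :: int set) \<Otimes>\<^sub>M (lborel :: real measure)"
  let ?T = "\<lambda>(k, s). axis_line_point (fst side) (line_offset a side k) s"
  let ?L = "\<lambda>p. case p of (k::int, s) \<Rightarrow> lineint a \<beta> (\<xi> k) ?xo F G s"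
  let ?H = "\<lambda>y. indicator ?A y *\<^sub>R inner_integral y"
  have off: "line_offset a side k = \<beta> + 4 * of_int k * a" for k by (simp add: line_offset_def)
  have A: "y \<in> ?A \<longleftrightarrow> (\<exists>k::int. y $ i = \<beta> + 4 * of_int k * a)" for y
    by (auto simp: line_family_def off)
  have HT: "?H (?T p) = - of_int \<sigma> * ?L p" for p
  proof -
    obtain k s where p: "p = (k, s)" by (cases p)
    have yi: "?T p $ i = \<beta> + 4 * of_int k * a" and yo: "?T p $ other_index i = s"
      by (simp_all only: p split_conv fst_conv off axis_line_point_nth)
    have "?T p \<in> ?A" unfolding A using yi by blast
    then show ?thesis using inner_integral(3)[OF yi] unfolding yo by (simp add: p)
  qed
  have T: "?T \<in> ?M \<rightarrow>\<^sub>M borel" by (rule measurable_axis_line_point)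
  have "?A = (\<Union>k::int. {y. y $ i = \<beta> + 4 * of_int k * a})" using A by auto
  moreover have "closed {y :: real^2. y $ i = \<beta> + 4 * of_int k * a}" for k :: int
    by (intro closed_Collect_eq continuous_intros)
  ultimately have Ab: "?A \<in> sets borel" by (auto intro!: sets.countable_UN)
  \<comment> \<open>The index of the line through \<open>y\<close>, written as a function of
    \<open>y\<close>: it turns measurability on the union of the lines into a countable case
    distinction.\<close>
  define kk where "kk = (\<lambda>y :: real^2. \<lfloor>(y $ i - \<beta>) / (4 * a)\<rfloor>)"
  have H_eq: "?H y = indicator ?A y *\<^sub>R (- of_int \<sigma> * lineint a \<beta> (\<xi> (kk y)) ?xo F G (y $ other_index i))" for y
  proof (cases "y \<in> ?A")
    case True
    then obtain k :: int where k: "y $ i = \<beta> + 4 * of_int k * a" using A by auto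
    then have "kk y = k" using a by (simp add: kk_def)
    then show ?thesis using inner_integral(3)[OF k] by simp
  qed simp
  have nth: "(\<lambda>y :: real^2. y $ j) \<in> borel_measurable borel" for j
    by (intro borel_measurable_continuous_onI continuous_intros)
  have kkm: "kk \<in> borel \<rightarrow>\<^sub>M count_space UNIV"
    unfolding kk_def using nth[of i] by measurable
  have "(\<lambda>y. lineint a \<beta> (\<xi> (kk y)) ?xo F G (y $ other_index i)) \<in> borel_measurable borel"
    by (rule measurable_compose_countable[OF _ kkm, of "\<lambda>k y. lineint a \<beta> (\<xi> k) ?xo F G (y $ other_index i)"])
      (rule measurable_compose[OF nth lineint_measurable[OF cF cG]])
  then have "(\<lambda>y. indicator ?A y *\<^sub>R (- of_int \<sigma> * lineint a \<beta> (\<xi> (kk y)) ?xo F G (y $ other_index i))) \<in> borel_measurable borel"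
    using Ab by measurable
  then have Hm: "?H \<in> borel_measurable borel" unfolding H_eq[symmetric] .
  have xi: "\<bar>x $ i\<bar> < a" by (rule square_nth[OF x])
  have "integrable ?M (\<lambda>p. - of_int \<sigma> * ?L p)"
    by (intro integrable_mult_right lineint_integrable[OF \<sigma> xi])
  then show "set_integrable (arc_length a side) ?A inner_integral"
    unfolding set_integrable_def arc_length_def integrable_distr_eq[OF T Hm] HT .
  show "(LINT y:?A|arc_length a side. inner_integral y) = - of_int \<sigma> * (LINT p|?M. ?L p)"
    unfolding set_lebesgue_integral_def arc_length_def integral_distr[OF T Hm] HT by simp
qed

end

end

text \<open>Differentiability of the data and integrability at both levels are part of the
  conclusion, because \<open>deriv\<close> and the Lebesgue integral are total: without these claims
  the formula could hold between default values.\<close>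

theorem theorem2:
  fixes a :: real and f :: "real^2 \<Rightarrow> real" and P :: "real^2 \<Rightarrow> real \<Rightarrow> real" and x :: "real^2"
  assumes "a > 0"
    and "C2_compact_support (square a) f"
    and "\<And>y t. y \<in> frontier (square a) \<Longrightarrow> t \<ge> 0 \<Longrightarrow> P y t = wave_solution f y t"
    and "x \<in> square a"
  shows "(\<forall>j\<in>sides. \<forall>y\<in>\<Union>(line_family a j).
            (\<forall>r\<ge>norm (x - y). (\<lambda>r. replicated_data a P j y r / r) differentiable (at r)) \<and>
            set_integrable lborel {norm (x - y)..}
              (\<lambda>r. deriv (\<lambda>r. replicated_data a P j y r / r) r
                 * ((outer_normal j \<bullet> (x - y)) / sqrt (r\<^sup>2 - (norm (x - y))\<^sup>2)))) \<and>
         (\<forall>j\<in>sides. set_integrable (arc_length a j) (\<Union>(line_family a j))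
            (\<lambda>y. LINT r:{norm (x - y)..}|lborel.
               deriv (\<lambda>r. replicated_data a P j y r / r) r
                 * ((outer_normal j \<bullet> (x - y)) / sqrt (r\<^sup>2 - (norm (x - y))\<^sup>2)))) \<and>
         f x = 1 / pi * (\<Sum>j\<in>sides.
            LINT y:\<Union>(line_family a j)|arc_length a j.
              LINT r:{norm (x - y)..}|lborel.
                deriv (\<lambda>r. replicated_data a P j y r / r) r
                  * ((outer_normal j \<bullet> (x - y)) / sqrt (r\<^sup>2 - (norm (x - y))\<^sup>2)))"
proof -
  note a = assms(1) and x = assms(4)
  obtain g g1 g2 g11 g12 g22 where w: "wave g g1 g2 g11 g12 g22 a" and g: "\<And>x. f x = g (x $ 1, x $ 2)"
    and sg: "\<And>p. g p \<noteq> 0 \<Longrightarrow> \<bar>fst p\<bar> < a \<and> \<bar>snd p\<bar> < a"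
    using wave_of_C2[OF a assms(2)] by blast
  interpret wave g g1 g2 g11 g12 g22 a by (rule w)
  \<comment> \<open>For the sides perpendicular to the second axis the coordinates are exchanged, so
    that \<open>side_data\<close> applies to both directions alike.\<close>
  define F where "F = (\<lambda>i::2. if i = 1 then utt else swap3 utt)"
  define G where "G = (\<lambda>i::2. if i = 1 then ut else swap3 ut)"
  define H where "H = (\<lambda>i::2. if i = 1 then ut1 else swap3 ut2)"
  obtain C where "side_data a C utt ut ut1" "side_data a C (swap3 utt) (swap3 ut) (swap3 ut2)"
    using side_data_ex[OF a] by blast
  then have sd: "side_data a C (F i) (G i) (H i)" for i by (simp add: F_def G_def H_def)
  have P: "P (axis_line_point i (of_int \<sigma> * a) s) t = G i (of_int \<sigma> * a, s, t)"
    if "\<sigma> \<in> {1, - 1}" "\<bar>s\<bar> < a" "0 < t" for i \<sigma> s t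
  proof -
    have "P (axis_line_point i (of_int \<sigma> * a) s) t = wave_solution f (axis_line_point i (of_int \<sigma> * a) s) t"
      using that by (intro assms(3) axis_line_point_in_frontier a) auto
    also have "\<dots> = ut (axis_line_point i (of_int \<sigma> * a) s $ 1, axis_line_point i (of_int \<sigma> * a) s $ 2, t)"
      by (rule wave_solution_eq[OF g that(3)])
    also have "\<dots> = G i (of_int \<sigma> * a, s, t)"
      using exhaust_2[of i] by (auto simp: G_def swap3_def axis_line_point_def)
    finally show ?thesis .
  qed
  have dG: "((\<lambda>t. G i (y, s, t)) has_real_derivative F i (y, s, t)) (at t)" for i y s t
    using has_grad3_chain[OF grad_ut, of "\<lambda>_. y" 0 t UNIV "\<lambda>_. s" 0 "\<lambda>t. t" 1]
      has_grad3_chain[OF grad_ut, of "\<lambda>_. s" 0 t UNIV "\<lambda>_. y" 0 "\<lambda>t. t" 1]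
    by (auto simp: G_def F_def swap3_def)
  have x12: "\<bar>x $ 1\<bar> < a" "\<bar>x $ 2\<bar> < a" by (rule square_nth[OF x])+
  have sidesE: "\<exists>i \<sigma>. \<sigma> \<in> {1, - 1} \<and> j = (i, of_int \<sigma>)" if "j \<in> sides" for j
    using that by (cases j) (auto simp: sides_def intro: exI[of _ "1::int"] exI[of _ "- 1::int"])
  define I where "I = (\<lambda>i \<sigma>. LINT p|(count_space UNIV \<Otimes>\<^sub>M lborel). (case p of (k::int, s) \<Rightarrow>
     lineint a (of_int \<sigma> * a) (x $ i - 4 * of_int k * a) (x $ other_index i) (F i) (G i) s))"
  let ?inner = "\<lambda>j y. LINT r:{norm (x - y)..}|lborel.
                deriv (\<lambda>r. replicated_data a P j y r / r) r
                  * ((outer_normal j \<bullet> (x - y)) / sqrt (r\<^sup>2 - (norm (x - y))\<^sup>2))"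
  have part1: "(\<lambda>r. replicated_data a P j y r / r) differentiable (at r)"
    "set_integrable lborel {norm (x - y)..}
              (\<lambda>r. deriv (\<lambda>r. replicated_data a P j y r / r) r
                 * ((outer_normal j \<bullet> (x - y)) / sqrt (r\<^sup>2 - (norm (x - y))\<^sup>2)))"
    if j: "j \<in> sides" and y: "y \<in> \<Union>(line_family a j)" and r: "norm (x - y) \<le> r" for j y r
  proof -
    obtain i \<sigma> where j': "\<sigma> \<in> {1, - 1}" "j = (i, of_int \<sigma>)" using sidesE[OF j] by blast
    obtain k :: int where k: "y $ i = of_int \<sigma> * a + 4 * of_int k * a"
      using y by (auto simp: line_family_def line_offset_def j')
    note hyp = sd[of i] j'(1) x P[OF j'(1)] dG
    have "0 < r" using side_data.inner_integral(1)[OF hyp k] r by (rule less_le_trans)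
    from side_data.datum_has_derivative[OF hyp this, of y]
    show "(\<lambda>r. replicated_data a P j y r / r) differentiable (at r)"
      unfolding j'(2) unfolding real_differentiable_def by blast
    show "set_integrable lborel {norm (x - y)..}
              (\<lambda>r. deriv (\<lambda>r. replicated_data a P j y r / r) r
                 * ((outer_normal j \<bullet> (x - y)) / sqrt (r\<^sup>2 - (norm (x - y))\<^sup>2)))"
      unfolding j'(2) by (rule side_data.inner_integral(2)[OF hyp k])
  qed
  have part2: "set_integrable (arc_length a j) (\<Union>(line_family a j)) (?inner j)"
    "(LINT y:\<Union>(line_family a j)|arc_length a j. ?inner j y) = - of_int \<sigma> * I i \<sigma>"
    if j: "\<sigma> \<in> {1, - 1}" "j = (i, of_int \<sigma>)" for i \<sigma> j
  proof -
    note hyp = sd[of i] j(1) x P[OF j(1)] dG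
    have inner: "side_data.inner_integral a P i \<sigma> x = ?inner j"
      unfolding j(2) by (rule ext) (rule side_data.inner_integral_def[OF hyp])
    show "set_integrable (arc_length a j) (\<Union>(line_family a j)) (?inner j)"
      using side_data.lines_integral(1)[OF hyp] unfolding inner j(2)[symmetric] .
    show "(LINT y:\<Union>(line_family a j)|arc_length a j. ?inner j y) = - of_int \<sigma> * I i \<sigma>"
      using side_data.lines_integral(2)[OF hyp] unfolding inner j(2)[symmetric] I_def .
  qed
  have c: "(\<lambda>K. cells a \<sigma> (x $ i) (x $ other_index i) (F i) (G i) K) \<longlonglongrightarrow> I i \<sigma>" if "\<sigma> \<in> {1, - 1}" for i \<sigma>
    unfolding I_def
    by (rule side_data.cells_tendsto_integral[OF sd that square_nth[OF x]])
  have "(\<lambda>K. cells a 1 (x $ 1) (x $ 2) utt ut K - cells a (- 1) (x $ 1) (x $ 2) utt ut K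
      + cells a 1 (x $ 2) (x $ 1) (swap3 utt) (swap3 ut) K - cells a (- 1) (x $ 2) (x $ 1) (swap3 utt) (swap3 ut) K)
      \<longlonglongrightarrow> I 1 1 - I 1 (- 1) + I 2 1 - I 2 (- 1)"
    using c[of 1 1] c[of "- 1" 1] c[of 1 2] c[of "- 1" 2]
    by (intro tendsto_diff tendsto_add) (simp_all add: F_def G_def)
  moreover have "(\<lambda>K. cells a 1 (x $ 1) (x $ 2) utt ut K - cells a (- 1) (x $ 1) (x $ 2) utt ut K
      + cells a 1 (x $ 2) (x $ 1) (swap3 utt) (swap3 ut) K - cells a (- 1) (x $ 2) (x $ 1) (swap3 utt) (swap3 ut) K)
      \<longlonglongrightarrow> - pi * g (x $ 1, x $ 2)"
    by (rule cells_tendsto[OF a sg x12])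
  ultimately have lim: "I 1 1 - I 1 (- 1) + I 2 1 - I 2 (- 1) = - pi * f x"
    unfolding g by (rule LIMSEQ_unique)
  have "(\<Sum>j\<in>sides. LINT y:\<Union>(line_family a j)|arc_length a j. ?inner j y)
      = (\<Sum>i\<in>UNIV. \<Sum>\<sigma>\<in>{1, - 1}. LINT y:\<Union>(line_family a (i, \<sigma>))|arc_length a (i, \<sigma>). ?inner (i, \<sigma>) y)"
    unfolding sides_def by (simp only: sum.cartesian_product case_prod_unfold prod.collapse)
  \<comment> \<open>The factor \<open>- \<sigma>\<close> of each side is the opposite of its sign in
    the limit of \<open>cells\<close>, which turns \<open>- pi * f x\<close> into
    \<open>pi * f x\<close>.\<close>
  also have "\<dots> = (\<Sum>i\<in>UNIV. - I i 1 + I i (- 1))"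
    using part2(2)[of 1 "(i, 1)" i for i] part2(2)[of "- 1" "(i, - 1)" i for i] by simp
  also have "\<dots> = pi * f x"
    using lim by (simp add: sum_2)
  finally have "f x = 1 / pi * (\<Sum>j\<in>sides. LINT y:\<Union>(line_family a j)|arc_length a j. ?inner j y)"
    by simp
  moreover have "set_integrable (arc_length a j) (\<Union>(line_family a j)) (?inner j)" if "j \<in> sides" for j
    using sidesE[OF that] part2(1) by blast
  ultimately show ?thesis using part1 by blast
qed

end
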